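(* Let $S(t)$, $t\ge 0$, be a strongly continuous semigroup with generator $A$ on a complex Hilbert space $\mathcal H$. Assume that $\{\Re z\ge0\}$ is contained in the resolvent set of $A$, that $\|(z-A)^{-1}\|$ is uniformly bounded there, and that $\sup_{\Re z>0}\|(z-A)^{-1}\|=1$. Let $0<m\in C^1([0,+\infty[)$ satisfy $\|S(t)\|\le m(t)$ for all $t\ge0$, and let $a^*=a^*(m)\in\,]0,+\infty]$ and $\psi_0$ be associated with $m$ as in the context. If $a,b\in\,]0,+\infty[\,\cap\,]0,a^*]$ and $t>a+b$, then $$\|e^tS(t)\|\le e^{a+b}\,m(a)\,m(b)\,\psi_0(a)^{1/2}\,\psi_0(b)^{1/2}.$$ In particular, when $a^*<+\infty$, $$\|e^tS(t)\|\le e^{2a^*}\,m(a^* )^2,\qquad t>2a^*.$$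
   Context: For $a>0$, let $K_{m,a}^{DR}$ be the realization in $L^2(]0,a[;m^2ds)$ of the operator $K_m=-\frac1{m^2}\partial_s\circ m^2\partial_s-1$ with domain $\{u\in H^2(]0,a[);\ u(0)=0,\ u'(a)=u(a)\}$ (self-adjoint, bounded from below, purely discrete spectrum), and let $\lambda^{DR}(a,m)$ be its lowest eigenvalue. Define $a^*(m)=\sup\{\tilde a\in\,]0,+\infty[\,;\ \lambda^{DR}(a,m)>0\text{ for }0<a<\tilde a\}\in\,]0,+\infty]$. Let $u_0:[0,+\infty[\to\mathbb R$ be the solution, unique up to a positive constant factor, of $(m^2u_0')'+m^2u_0=0$, $u_0(0)=0$, $u_0'(0)>0$. Then $u_0>0$ on $]0,a^*[$, and when $a^*<+\infty$, $u_0'(a^* )=u_0(a^* )>0$ and $u_0$ restricted to $]0,a^*[$ is the first eigenfunction of $K^{DR}_{m,a^*}$, with eigenvalue $0$. Set $\psi_0=u_0'/u_0$ on $]0,+\infty[\,\cap\,]0,a^*]$; thus $\psi_0(a^* )=1$ when $a^*<+\infty$. *)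

theory Defs
  imports "HOL-Analysis.Analysis"
begin

section \<open>Complex Hilbert spaces\<close>

text \<open>
  The class \<open>real_inner\<close> supplies the norm and the topology; \<open>cinner\<close> is linear in its first
  argument and its real part is the underlying real inner product, so that
  \<open>cinner x x = (norm x)^2\<close>.
\<close>

class complex_vector = real_vector +
  fixes scaleC :: "complex \<Rightarrow> 'a \<Rightarrow> 'a" (infixr "*\<^sub>C" 75)
  assumes scaleC_add_right: "c *\<^sub>C (x + y) = c *\<^sub>C x + c *\<^sub>C y"
    and scaleC_add_left: "(c + d) *\<^sub>C x = c *\<^sub>C x + d *\<^sub>C x"
    and scaleC_scaleC: "c *\<^sub>C (d *\<^sub>C x) = (c * d) *\<^sub>C x"
    and scaleC_of_real: "complex_of_real r *\<^sub>C x = r *\<^sub>R x"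

class complex_inner = complex_vector + real_inner +
  fixes cinner :: "'a \<Rightarrow> 'a \<Rightarrow> complex"
  assumes cinner_commute: "cinner x y = cnj (cinner y x)"
    and cinner_add_left: "cinner (x + y) z = cinner x z + cinner y z"
    and cinner_scaleC_left: "cinner (c *\<^sub>C x) y = c * cinner x y"
    and Re_cinner: "Re (cinner x y) = inner x y"

class complex_hilbert_space = complex_inner + complete_space

instantiation complex :: complex_hilbert_space
begin

definition scaleC_complex :: "complex \<Rightarrow> complex \<Rightarrow> complex"
  where "scaleC_complex c x = c * x"

definition cinner_complex :: "complex \<Rightarrow> complex \<Rightarrow> complex"
  where "cinner_complex x y = x * cnj y"

instance
  by standard
    (auto simp: scaleC_complex_def cinner_complex_def inner_complex_def algebra_simps
      scaleR_conv_of_real)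

end

section \<open>Strongly continuous semigroups, generators and resolvents\<close>

definition C0_semigroup :: "(real \<Rightarrow> 'h::complex_hilbert_space \<Rightarrow>\<^sub>L 'h) \<Rightarrow> bool" where
  "C0_semigroup S \<longleftrightarrow>
     (\<forall>t\<ge>0. \<forall>c x. S t (c *\<^sub>C x) = c *\<^sub>C S t x) \<and>
     S 0 = id_blinfun \<and>
     (\<forall>s\<ge>0. \<forall>t\<ge>0. S (s + t) = S s o\<^sub>L S t) \<and>
     (\<forall>x. continuous_on {0..} (\<lambda>t. S t x))"

text \<open>
  An unbounded operator is represented by its graph; its domain is \<open>Domain A\<close>.
\<close>

definition generator :: "(real \<Rightarrow> 'h::complex_hilbert_space \<Rightarrow>\<^sub>L 'h) \<Rightarrow> ('h \<times> 'h) set" where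
  "generator S = {(x, y). ((\<lambda>h. (1 / h) *\<^sub>R (S h x - x)) \<longlongrightarrow> y) (at_right 0)}"

text \<open>
  \<open>R\<close> is a bounded two-sided inverse of \<open>z - A : Domain A \<rightarrow> H\<close>.
\<close>

definition is_resolvent ::
    "('h::complex_hilbert_space \<times> 'h) set \<Rightarrow> complex \<Rightarrow> ('h \<Rightarrow>\<^sub>L 'h) \<Rightarrow> bool" where
  "is_resolvent A z R \<longleftrightarrow>
     (\<forall>(x, y)\<in>A. R (z *\<^sub>C x - y) = x) \<and>
     (\<forall>f. \<exists>y. (R f, y) \<in> A \<and> z *\<^sub>C R f - y = f)"

lemma is_resolvent_unique:
  assumes "is_resolvent A z R" "is_resolvent A z R'"
  shows "R = R'"
proof (rule blinfun_eqI)
  fix f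
  obtain y where "(R' f, y) \<in> A" "z *\<^sub>C R' f - y = f"
    using assms(2) by (auto simp: is_resolvent_def)
  then show "blinfun_apply R f = blinfun_apply R' f"
    using assms(1) by (auto simp: is_resolvent_def)
qed

definition resolvent_set :: "('h::complex_hilbert_space \<times> 'h) set \<Rightarrow> complex set" where
  "resolvent_set A = {z. \<exists>R. is_resolvent A z R}"

definition resolvent :: "('h::complex_hilbert_space \<times> 'h) set \<Rightarrow> complex \<Rightarrow> 'h \<Rightarrow>\<^sub>L 'h" where
  "resolvent A z = (THE R. is_resolvent A z R)"

section \<open>Weak derivatives and Sobolev spaces on an interval\<close>

definition test_function :: "real set \<Rightarrow> (real \<Rightarrow> real) \<Rightarrow> bool" where
  "test_function I \<phi> \<longleftrightarrow>
     (\<forall>n x. ((deriv ^^ n) \<phi>) field_differentiable (at x)) \<and>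
     (\<exists>K. compact K \<and> K \<subseteq> I \<and> (\<forall>x. x \<notin> K \<longrightarrow> \<phi> x = 0))"

definition locally_integrable :: "real set \<Rightarrow> (real \<Rightarrow> real) \<Rightarrow> bool" where
  "locally_integrable I u \<longleftrightarrow> (\<forall>K. compact K \<and> K \<subseteq> I \<longrightarrow> integrable (lebesgue_on K) u)"

definition weak_deriv :: "real set \<Rightarrow> (real \<Rightarrow> real) \<Rightarrow> (real \<Rightarrow> real) \<Rightarrow> bool" where
  "weak_deriv I u v \<longleftrightarrow>
     locally_integrable I u \<and> locally_integrable I v \<and>
     (\<forall>\<phi>. test_function I \<phi> \<longrightarrow>
        integral\<^sup>L (lebesgue_on I) (\<lambda>s. u s * deriv \<phi> s) =
        - integral\<^sup>L (lebesgue_on I) (\<lambda>s. v s * \<phi> s))"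

definition L2 :: "real measure \<Rightarrow> (real \<Rightarrow> real) \<Rightarrow> bool" where
  "L2 M u \<longleftrightarrow> u \<in> borel_measurable M \<and> integrable M (\<lambda>s. (u s)\<^sup>2)"

definition H2 :: "real set \<Rightarrow> (real \<Rightarrow> real) \<Rightarrow> bool" where
  "H2 I u \<longleftrightarrow> (\<exists>v w. weak_deriv I u v \<and> weak_deriv I v w \<and>
     L2 (lebesgue_on I) u \<and> L2 (lebesgue_on I) v \<and> L2 (lebesgue_on I) w)"

section \<open>The Dirichlet--Robin realization and its lowest eigenvalue\<close>

text \<open>
  The measure \<open>m^2 ds\<close> on the open interval from \<open>0\<close> to \<open>a\<close>.
\<close>

definition weighted :: "(real \<Rightarrow> real) \<Rightarrow> real \<Rightarrow> real measure" where
  "weighted m a = density (lebesgue_on {0<..<a}) (\<lambda>s. ennreal ((m s)\<^sup>2))"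

text \<open>
  The boundary values of a function in \<open>H2\<close> are those of its representative in
  \<open>C^1([0,a])\<close>, here \<open>U\<close> with derivative \<open>U'\<close>.
\<close>

definition DR_domain :: "real \<Rightarrow> (real \<Rightarrow> real) set" where
  "DR_domain a = {u. H2 {0<..<a} u \<and>
     (\<exists>U U'. (AE s in lebesgue_on {0<..<a}. u s = U s) \<and>
        (\<forall>s\<in>{0..a}. (U has_real_derivative U' s) (at s within {0..a})) \<and>
        continuous_on {0..a} U' \<and> U 0 = 0 \<and> U' a = U a)}"

text \<open>
  \<open>K_DR m a u f\<close>: the function \<open>u\<close> lies in the domain and
  \<open>- (1/m^2) (m^2 u')' - u = f\<close> in \<open>L2 (weighted m a)\<close>, derivatives in the weak sense.
\<close>

definition K_DR :: "(real \<Rightarrow> real) \<Rightarrow> real \<Rightarrow> (real \<Rightarrow> real) \<Rightarrow> (real \<Rightarrow> real) \<Rightarrow> bool" where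
  "K_DR m a u f \<longleftrightarrow>
     u \<in> DR_domain a \<and> L2 (weighted m a) u \<and> L2 (weighted m a) f \<and>
     (\<exists>v w. weak_deriv {0<..<a} u v \<and> weak_deriv {0<..<a} (\<lambda>s. (m s)\<^sup>2 * v s) w \<and>
        (AE s in weighted m a. f s = - (1 / (m s)\<^sup>2) * w s - u s))"

definition DR_eigenvalue :: "(real \<Rightarrow> real) \<Rightarrow> real \<Rightarrow> real \<Rightarrow> bool" where
  "DR_eigenvalue m a l \<longleftrightarrow>
     (\<exists>u. K_DR m a u (\<lambda>s. l * u s) \<and> \<not> (AE s in weighted m a. u s = 0))"

definition lambda_DR :: "real \<Rightarrow> (real \<Rightarrow> real) \<Rightarrow> real" where
  "lambda_DR a m = (LEAST l. DR_eigenvalue m a l)"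

definition a_star :: "(real \<Rightarrow> real) \<Rightarrow> ereal" where
  "a_star m = Sup {ereal b | b. 0 < b \<and> (\<forall>a. 0 < a \<and> a < b \<longrightarrow> lambda_DR a m > 0)}"

section \<open>The function \<open>\<psi>\<^sub>0\<close>\<close>

definition C1_half_line :: "(real \<Rightarrow> real) \<Rightarrow> bool" where
  "C1_half_line m \<longleftrightarrow>
     (\<exists>m'. continuous_on {0..} m' \<and>
        (\<forall>s\<ge>0. (m has_real_derivative m' s) (at s within {0..})))"

text \<open>
  \<open>(m^2 u')' + m^2 u = 0\<close> on the closed half-line, \<open>u 0 = 0\<close> and \<open>u' 0 > 0\<close>.
\<close>

definition is_u0 :: "(real \<Rightarrow> real) \<Rightarrow> (real \<Rightarrow> real) \<Rightarrow> bool" where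
  "is_u0 m u \<longleftrightarrow>
     (\<exists>u'. (\<forall>s\<ge>0. (u has_real_derivative u' s) (at s within {0..})) \<and>
        (\<forall>s\<ge>0. ((\<lambda>r. (m r)\<^sup>2 * u' r) has_real_derivative - ((m s)\<^sup>2 * u s)) (at s within {0..})) \<and>
        u 0 = 0 \<and> u' 0 > 0)"

text \<open>
  The solution \<open>u0 m\<close> is determined on the half-line up to a positive constant factor, on which
  the logarithmic derivative \<open>psi0 m\<close> does not depend. Only \<open>psi0 m s\<close> with \<open>s > 0\<close> is meaningful.
\<close>

definition u0 :: "(real \<Rightarrow> real) \<Rightarrow> real \<Rightarrow> real" where
  "u0 m = (SOME u. is_u0 m u)"

definition psi0 :: "(real \<Rightarrow> real) \<Rightarrow> real \<Rightarrow> real" where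
  "psi0 m s = deriv (u0 m) s / u0 m s"

end

theory Submission
  imports Defs
begin

text \<open>
  For an orbit \<open>u(s) = S(s)x\<close> and a scalar weight \<open>\<phi>\<close> that vanishes at the two ends of its support,
  \<open>(d/ds - A)(\<phi> u) = \<phi>' u\<close>. A Fourier transform in \<open>s\<close> turns the left-hand side into
  \<open>z - A\<close> on a vertical line, where the resolvent is a contraction, so that
  \<open>\<integral> \<phi>\<^sup>2 |u|\<^sup>2 \<le> \<integral> \<phi>'\<^sup>2 |u|\<^sup>2\<close>. This energy inequality is all that is used about the resolvent.

  It is applied to the following weight. On \<open>[0,a]\<close> take \<open>\<phi> = u\<^sub>0 / u\<^sub>0(a)\<close>; there \<open>\<phi>'\<^sup>2 - \<phi>\<^sup>2 \<ge> 0\<close>,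
  the bound \<open>|u| \<le> m |x|\<close> applies, and the equation of \<open>u\<^sub>0\<close> integrates the cost to \<open>m(a)\<^sup>2 \<psi>\<^sub>0(a) |x|\<^sup>2\<close>.
  On \<open>[a, t-b]\<close> take an exponential, which costs nothing. On \<open>[t-b, t]\<close> take a multiple of
  \<open>(m\<^sup>2 u\<^sub>0')(t-s)\<close>; there \<open>\<phi>\<^sup>2 - \<phi>'\<^sup>2 \<ge> 0\<close>, the semigroup law gives \<open>|u(s)| \<ge> |u(t)| / m(t-s)\<close>, and the
  same equation integrates the gain to \<open>e^(2(t-a-b)) |u(t)|\<^sup>2 / (m(b)\<^sup>2 \<psi>\<^sub>0(b))\<close>. Comparing the two gives
  the estimate (lemma \<open>semigroup_bound_of_robin_solution\<close>). The signs require \<open>u\<^sub>0' \<ge> u\<^sub>0 > 0\<close> on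
  \<open>(0,a]\<close> and \<open>(0,b]\<close>.

  Beyond \<open>t\<close> the weight decays exponentially, and has to be cut off at no cost. That is
  possible once \<open>|u|\<^sup>2\<close> is integrable against \<open>e^(-s)\<close>. The inequality itself, on the lines
  \<open>Re z = \<omega>\<close>, shows this by descent: integrability against \<open>e^(-(2\<omega>+1)s)\<close> implies integrability
  against \<open>e^(-2\<omega>s)\<close>, and the descent starts from the exponential bound that every semigroup has.

  The second half identifies \<open>a\<^sup>*\<close> as the supremum of the \<open>b\<close> with \<open>u\<^sub>0' > u\<^sub>0\<close> on \<open>(0,b)\<close>
  (lemma \<open>lambda_DR_pos_iff\<close>). A positive solution of the equation with parameter \<open>\<mu>\<close> that satisfies
  the Robin condition is a ground state: Picone's identity shows that every eigenvalue is at
  least \<open>\<mu> - 1\<close>. At the first point where \<open>u\<^sub>0' = u\<^sub>0\<close> this gives the lowest eigenvalue \<open>0\<close>. If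
  \<open>u\<^sub>0' > u\<^sub>0\<close> up to and including \<open>a\<close>, a shooting argument in the parameter produces such a ground state with
  \<open>\<mu> > 1\<close>, so that the lowest eigenvalue exists and is positive.
\<close>

section \<open>A Parseval comparison for Hilbert-space-valued functions\<close>

instance complex_hilbert_space \<subseteq> banach ..

lemma inner_scaleC_scaleC:
  fixes x y :: "'h::complex_inner"
  shows "inner (c *\<^sub>C x) (d *\<^sub>C y) = Re (c * cnj d * cinner x y)"
proof -
  have "cinner (c *\<^sub>C x) (d *\<^sub>C y) = c * cnj (cinner (d *\<^sub>C y) x)"
    by (metis cinner_commute cinner_scaleC_left)
  also have "\<dots> = c * cnj d * cinner x y"
    by (metis cinner_commute cinner_scaleC_left complex_cnj_mult mult.assoc)
  finally show ?thesis
    by (metis Re_cinner)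
qed

lemma norm_scaleC:
  fixes x :: "'h::complex_inner"
  shows "norm (c *\<^sub>C x) = cmod c * norm x"
proof -
  have "(norm (c *\<^sub>C x))\<^sup>2 = Re (c * cnj c * cinner x x)"
    by (simp only: power2_norm_eq_inner inner_scaleC_scaleC)
  also have "\<dots> = (cmod c)\<^sup>2 * Re (cinner x x)"
    by (simp flip: complex_norm_square)
  also have "\<dots> = (cmod c * norm x)\<^sup>2"
    by (simp add: Re_cinner power2_norm_eq_inner power_mult_distrib)
  finally show ?thesis
    by (simp add: power2_eq_iff_nonneg)
qed

lemma bounded_bilinear_scaleC:
  "bounded_bilinear (scaleC :: complex \<Rightarrow> 'h::complex_inner \<Rightarrow> 'h)"
proof
  fix r :: real and c :: complex and x :: 'h
  show "(r *\<^sub>R c) *\<^sub>C x = r *\<^sub>R (c *\<^sub>C x)"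
    by (metis scaleC_of_real scaleC_scaleC scaleR_conv_of_real)
  show "c *\<^sub>C (r *\<^sub>R x) = r *\<^sub>R (c *\<^sub>C x)"
    by (metis scaleC_of_real scaleC_scaleC mult.commute)
  show "\<exists>K. \<forall>(a::complex) (b::'h). norm (a *\<^sub>C b) \<le> norm a * norm b * K"
    by (rule exI[of _ 1]) (simp add: norm_scaleC)
qed (simp_all add: scaleC_add_left scaleC_add_right)

interpretation scaleC: bounded_bilinear "scaleC :: complex \<Rightarrow> 'h::complex_inner \<Rightarrow> 'h"
  by (rule bounded_bilinear_scaleC)

lemma C0_semigroup_orbit_continuous:
  assumes "C0_semigroup S" "A \<subseteq> {0..}"
  shows "continuous_on A (\<lambda>s. S s x)"
  using assms continuous_on_subset unfolding C0_semigroup_def by blast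

lemma continuous_Icc_bounded:
  fixes f :: "real \<Rightarrow> 'a::real_normed_vector"
  assumes "continuous_on {a..b} f"
  obtains B where "B > 0" "\<And>s. s \<in> {a..b} \<Longrightarrow> norm (f s) \<le> B"
proof -
  have "bounded (f ` {a..b})"
    by (intro compact_imp_bounded compact_continuous_image assms) simp
  then obtain B where "B > 0" "\<forall>y\<in>f ` {a..b}. norm y \<le> B"
    unfolding bounded_pos by blast
  then show ?thesis by (intro that[of B]) auto
qed

definition fourier_coeff :: "real \<Rightarrow> (real \<Rightarrow> 'h::complex_hilbert_space) \<Rightarrow> int \<Rightarrow> 'h" where
  "fourier_coeff L F k = integral {0..L} (\<lambda>s. cis (- (2 * pi * real_of_int k * s / L)) *\<^sub>C F s)"

text \<open>
  The Fejer kernel without its factor \<open>1 / (n + 1)\<close>.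
\<close>
definition fejer :: "nat \<Rightarrow> real \<Rightarrow> real" where
  "fejer n \<theta> = (cmod (\<Sum>j\<le>n. cis (real j * \<theta>)))\<^sup>2"

lemma fejer_nonneg: "fejer n \<theta> \<ge> 0"
  by (simp add: fejer_def)

lemma fejer_double_sum:
  "(\<Sum>j\<le>n. \<Sum>l\<le>n. cis (- (real_of_int (int j - int l) * \<theta>))) = complex_of_real (fejer n \<theta>)"
proof -
  have "(\<Sum>j\<le>n. \<Sum>l\<le>n. cis (- (real_of_int (int j - int l) * \<theta>)))
      = (\<Sum>j\<le>n. \<Sum>l\<le>n. cnj (cis (real j * \<theta>)) * cis (real l * \<theta>))"
    by (intro sum.cong refl) (simp add: cis_mult cis_cnj algebra_simps)
  also have "\<dots> = cnj (\<Sum>j\<le>n. cis (real j * \<theta>)) * (\<Sum>l\<le>n. cis (real l * \<theta>))"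
    by (simp add: sum_product)
  also have "\<dots> = complex_of_real (fejer n \<theta>)"
    by (simp only: fejer_def complex_norm_square mult.commute)
  finally show ?thesis .
qed

lemma fejer_eq_cos_sum:
  "fejer n \<theta> = (\<Sum>j\<le>n. \<Sum>l\<le>n. cos (real_of_int (int j - int l) * \<theta>))"
proof -
  have "fejer n \<theta> = Re (\<Sum>j\<le>n. \<Sum>l\<le>n. cis (- (real_of_int (int j - int l) * \<theta>)))"
    by (simp only: fejer_double_sum Re_complex_of_real)
  then show ?thesis by simp
qed

text \<open>
  The Dirichlet sum is geometric, so the kernel tames a squared chord uniformly in \<open>n\<close>. This
  replaces every approximate-identity estimate for the kernel.
\<close>
lemma fejer_mult_chord_le: "fejer n \<theta> * (cmod (cis \<theta> - 1))\<^sup>2 \<le> 4"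
proof -
  have "(\<Sum>j\<le>n. cis (real j * \<theta>)) * (cis \<theta> - 1) = cis (real (Suc n) * \<theta>) - 1"
    by (induction n) (simp_all add: algebra_simps cis_mult)
  then have "fejer n \<theta> * (cmod (cis \<theta> - 1))\<^sup>2 = (cmod (cis (real (Suc n) * \<theta>) - 1))\<^sup>2"
    by (metis fejer_def norm_mult power_mult_distrib)
  also have "\<dots> \<le> 2\<^sup>2"
    by (rule power_mono) (use norm_triangle_ineq4[of "cis (real (Suc n) * \<theta>)" 1] in simp_all)
  finally show ?thesis by simp
qed

lemma continuous_on_fejer [continuous_intros]:
  "continuous_on A f \<Longrightarrow> continuous_on A (\<lambda>x. fejer n (f x))"
  unfolding fejer_def by (intro continuous_intros)

lemma integral_cos_period:
  fixes k :: int
  assumes "L > 0"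
  shows "integral {0..L} (\<lambda>r. cos (real_of_int k * (2 * pi * (s - r) / L))) = (if k = 0 then L else 0)"
proof (cases "k = 0")
  case False
  define c where "c = real_of_int k * 2 * pi / L"
  have c: "c \<noteq> 0" using False assms by (simp add: c_def)
  have "((\<lambda>r. cos (c * (s - r))) has_integral (- sin (c * (s - L)) / c - (- sin (c * (s - 0)) / c))) {0..L}"
    using assms c
    by (intro fundamental_theorem_of_calculus)
       (auto intro!: derivative_eq_intros simp flip: has_real_derivative_iff_has_vector_derivative)
  moreover have "sin (c * (s - L)) = sin (c * s)"
  proof -
    have "c * (s - L) = c * s - 2 * pi * real_of_int k"
      using assms by (simp add: c_def field_simps)
    then show ?thesis
      by (simp add: sin_diff)
  qed
  ultimately have "((\<lambda>r. cos (c * (s - r))) has_integral 0) {0..L}" by simp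
  then have "integral {0..L} (\<lambda>r. cos (c * (s - r))) = 0" by (rule integral_unique)
  moreover have "\<And>r. real_of_int k * (2 * pi * (s - r) / L) = c * (s - r)"
    by (simp add: c_def)
  ultimately show ?thesis using False by simp
qed (use assms in simp)

lemma integral_fejer:
  assumes "L > 0"
  shows "integral {0..L} (\<lambda>r. fejer n (2 * pi * (s - r) / L)) = real (Suc n) * L"
proof -
  have "integral {0..L} (\<lambda>r. fejer n (2 * pi * (s - r) / L))
     = (\<Sum>j\<le>n. \<Sum>l\<le>n. integral {0..L} (\<lambda>r. cos (real_of_int (int j - int l) * (2 * pi * (s - r) / L))))"
    unfolding fejer_eq_cos_sum
    by (subst integral_sum, simp, intro integrable_continuous_interval continuous_intros, use assms in simp,
        intro sum.cong refl, subst integral_sum, simp,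
        intro integrable_continuous_interval continuous_intros, use assms in simp, simp)
  also have "\<dots> = (\<Sum>j\<le>n. \<Sum>l\<le>n. if l = j then L else 0)"
    unfolding integral_cos_period[OF assms] by (intro sum.cong refl) auto
  also have "\<dots> = real (Suc n) * L"
    by simp
  finally show ?thesis .
qed

lemma fejer_sym: "fejer n (2 * pi * (s - r) / L) = fejer n (2 * pi * (r - s) / L)"
proof -
  have "2 * pi * (s - r) / L = - (2 * pi * (r - s) / L)" by (simp add: algebra_simps diff_divide_distrib)
  then show ?thesis unfolding fejer_eq_cos_sum by simp
qed

text \<open>
  Each \<open>|c\<^sub>k|\<^sup>2\<close> is an iterated integral of inner products, by pulling the inner product into the two
  integrals one after the other; summing over \<open>k = j - l\<close> assembles the kernel.
\<close>
lemma sum_norm_fourier_coeff: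
  fixes F :: "real \<Rightarrow> 'h::complex_hilbert_space"
  assumes F: "continuous_on {0..L} F" and L: "L > 0"
  shows "(\<Sum>j\<le>n. \<Sum>l\<le>n. (norm (fourier_coeff L F (int j - int l)))\<^sup>2)
    = integral {0..L} (\<lambda>s. integral {0..L} (\<lambda>r. fejer n (2 * pi * (s - r) / L) * inner (F s) (F r)))"
proof -
  define f where "f k s = cis (- (2 * pi * real_of_int k * s / L)) *\<^sub>C F s" for k s
  have cf: "continuous_on {0..L} (f k)" for k
    unfolding f_def by (intro scaleC.continuous_on continuous_intros F) (use L in simp)
  have int_f: "f k integrable_on {0..L}" for k
    by (rule integrable_continuous_interval[OF cf])
  have fc: "fourier_coeff L F k = integral {0..L} (f k)" for k
    by (simp add: fourier_coeff_def f_def[abs_def])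
  have in1: "inner y (integral {0..L} (f k)) = integral {0..L} (\<lambda>r. inner y (f k r))" for y :: 'h and k
    using integral_linear[OF int_f bounded_linear_inner_right] by (simp add: o_def)
  have in2: "inner (integral {0..L} (f k)) y = integral {0..L} (\<lambda>r. inner (f k r) y)" for y :: 'h and k
    using integral_linear[OF int_f bounded_linear_inner_left] by (simp add: o_def)
  have nk: "(norm (fourier_coeff L F k))\<^sup>2 = integral {0..L} (\<lambda>s. integral {0..L} (\<lambda>r. inner (f k s) (f k r)))" for k
    by (simp add: power2_norm_eq_inner fc in2 in1[of "f k _"])
  have oint: "(\<lambda>s. integral {0..L} (\<lambda>r. inner (f k s) (f k r))) integrable_on {0..L}" for k
    unfolding in1[symmetric] by (intro integrable_continuous_interval continuous_intros cf)
  have iint: "(\<lambda>r. inner (f k s) (f k r)) integrable_on {0..L}" for k s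
    by (intro integrable_continuous_interval continuous_intros cf)
  have kern: "(\<Sum>j\<le>n. \<Sum>l\<le>n. inner (f (int j - int l) s) (f (int j - int l) r))
      = fejer n (2 * pi * (s - r) / L) * inner (F s) (F r)" for s r
  proof -
    have "inner (f k s) (f k r) = Re (cis (- (real_of_int k * (2 * pi * (s - r) / L))) * cinner (F s) (F r))" for k
    proof -
      have "cis (- (2 * pi * real_of_int k * s / L)) * cnj (cis (- (2 * pi * real_of_int k * r / L)))
           = cis (- (real_of_int k * (2 * pi * (s - r) / L)))"
        using L by (simp add: cis_cnj cis_mult algebra_simps diff_divide_distrib)
      then show ?thesis
        by (simp only: f_def inner_scaleC_scaleC)
    qed
    then have "(\<Sum>j\<le>n. \<Sum>l\<le>n. inner (f (int j - int l) s) (f (int j - int l) r))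
       = Re ((\<Sum>j\<le>n. \<Sum>l\<le>n. cis (- (real_of_int (int j - int l) * (2 * pi * (s - r) / L)))) * cinner (F s) (F r))"
      by (simp only: Re_sum sum_distrib_right)
    then show ?thesis
      by (simp only: fejer_double_sum) (simp add: Re_cinner)
  qed
  have "(\<Sum>j\<le>n. \<Sum>l\<le>n. (norm (fourier_coeff L F (int j - int l)))\<^sup>2)
     = integral {0..L} (\<lambda>s. \<Sum>j\<le>n. \<Sum>l\<le>n. integral {0..L} (\<lambda>r. inner (f (int j - int l) s) (f (int j - int l) r)))"
    unfolding nk using oint by (simp add: integral_sum integrable_sum)
  also have "\<dots> = integral {0..L} (\<lambda>s. integral {0..L} (\<lambda>r. \<Sum>j\<le>n. \<Sum>l\<le>n. inner (f (int j - int l) s) (f (int j - int l) r)))"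
    using iint by (simp add: integral_sum integrable_sum)
  finally show ?thesis unfolding kern .
qed

text \<open>
  Polarization of the inner product. The first term is the value demanded by Parseval's identity;
  the second is the defect of the Fejer means, which is nonnegative and small for continuous
  periodic \<open>F\<close>.
\<close>
lemma sum_norm_fourier_coeff_defect:
  fixes F :: "real \<Rightarrow> 'h::complex_hilbert_space"
  assumes F: "continuous_on {0..L} F" and L: "L > 0"
  shows "(\<Sum>j\<le>n. \<Sum>l\<le>n. (norm (fourier_coeff L F (int j - int l)))\<^sup>2)
    = real (Suc n) * L * integral {0..L} (\<lambda>s. (norm (F s))\<^sup>2)
      - integral {0..L} (\<lambda>s. integral {0..L}
          (\<lambda>r. fejer n (2 * pi * (s - r) / L) * (norm (F s - F r))\<^sup>2)) / 2"
proof -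
  define K where "K s r = fejer n (2 * pi * (s - r) / L)" for s r
  let ?I = "integral {0..L}"
  have [continuous_intros]: "continuous_on A (\<lambda>x. K (f x) (g x))"
    if "continuous_on A f" "continuous_on A g" for A and f g :: "'b::topological_space \<Rightarrow> real"
    unfolding K_def by (intro continuous_intros that) (use L in simp)
  have cF: "continuous_on A (\<lambda>x. F (f x))"
    if "continuous_on A f" "f ` A \<subseteq> {0..L}" for A and f :: "'b::topological_space \<Rightarrow> real"
    by (rule continuous_on_compose2[OF F that])
  have outer: "(\<lambda>s. ?I (\<lambda>r. K s r * g s r)) integrable_on {0..L}"
    and inner: "s \<in> {0..L} \<Longrightarrow> (\<lambda>r. K s r * g s r) integrable_on {0..L}"
    if g: "continuous_on ({0..L} \<times> {0..L}) (\<lambda>(s, r). g s r)" for g and s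
  proof -
    have *: "continuous_on ({0..L} \<times> {0..L}) (\<lambda>(s, r). K s r * g s r)"
      using g unfolding case_prod_beta by (intro continuous_intros)
    show "(\<lambda>s. ?I (\<lambda>r. K s r * g s r)) integrable_on {0..L}"
      using integral_continuous_on_param[of "{0..L}" 0 L "\<lambda>s r. K s r * g s r"] *
      by (auto intro: integrable_continuous_interval)
    show "(\<lambda>r. K s r * g s r) integrable_on {0..L}" if "s \<in> {0..L}"
      by (intro integrable_continuous_interval
           continuous_on_compose2[OF *, of _ "\<lambda>r. (s, r)", simplified])
         (use that in \<open>auto intro!: continuous_intros\<close>)
  qed
  have c1: "continuous_on ({0..L} \<times> {0..L}) (\<lambda>(s, r). (norm (F s))\<^sup>2)"
    and c2: "continuous_on ({0..L} \<times> {0..L}) (\<lambda>(s, r). (norm (F r))\<^sup>2)"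
    and c3: "continuous_on ({0..L} \<times> {0..L}) (\<lambda>(s, r). (norm (F s - F r))\<^sup>2)"
    unfolding case_prod_beta by (intro continuous_intros cF; auto)+
  have "(\<Sum>j\<le>n. \<Sum>l\<le>n. (norm (fourier_coeff L F (int j - int l)))\<^sup>2) = ?I (\<lambda>s. ?I (\<lambda>r. K s r * inner (F s) (F r)))"
    unfolding K_def by (rule sum_norm_fourier_coeff[OF F L])
  also have "\<dots> = ?I (\<lambda>s. (?I (\<lambda>r. K s r * (norm (F s))\<^sup>2) + ?I (\<lambda>r. K s r * (norm (F r))\<^sup>2)
       - ?I (\<lambda>r. K s r * (norm (F s - F r))\<^sup>2)) / 2)"
  proof (rule integral_cong)
    fix s assume s: "s \<in> {0..L}"
    have "?I (\<lambda>r. K s r * inner (F s) (F r))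
      = ?I (\<lambda>r. (K s r * (norm (F s))\<^sup>2 + K s r * (norm (F r))\<^sup>2 - K s r * (norm (F s - F r))\<^sup>2) / 2)"
      by (rule integral_cong)
         (simp add: power2_norm_eq_inner inner_diff_left inner_diff_right inner_commute algebra_simps)
    also have "\<dots> = ?I (\<lambda>r. K s r * (norm (F s))\<^sup>2 + K s r * (norm (F r))\<^sup>2 - K s r * (norm (F s - F r))\<^sup>2) / 2"
      by simp
    also have "?I (\<lambda>r. K s r * (norm (F s))\<^sup>2 + K s r * (norm (F r))\<^sup>2 - K s r * (norm (F s - F r))\<^sup>2)
      = ?I (\<lambda>r. K s r * (norm (F s))\<^sup>2) + ?I (\<lambda>r. K s r * (norm (F r))\<^sup>2)
       - ?I (\<lambda>r. K s r * (norm (F s - F r))\<^sup>2)"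
      using inner[OF c1 s] inner[OF c2 s] inner[OF c3 s]
      by (simp only: integral_diff integrable_add integral_add)
    finally show "?I (\<lambda>r. K s r * inner (F s) (F r)) = \<dots> / 2" .
  qed
  also have "\<dots> = (?I (\<lambda>s. ?I (\<lambda>r. K s r * (norm (F s))\<^sup>2)) + ?I (\<lambda>s. ?I (\<lambda>r. K s r * (norm (F r))\<^sup>2))
       - ?I (\<lambda>s. ?I (\<lambda>r. K s r * (norm (F s - F r))\<^sup>2))) / 2"
    using outer[OF c1] outer[OF c2] outer[OF c3]
    by (simp only: integral_divide integral_diff integrable_add integral_add)
  also have "?I (\<lambda>s. ?I (\<lambda>r. K s r * (norm (F s))\<^sup>2)) = real (Suc n) * L * ?I (\<lambda>s. (norm (F s))\<^sup>2)"
    unfolding K_def by (simp add: integral_fejer[OF L])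
  also have "?I (\<lambda>s. ?I (\<lambda>r. K s r * (norm (F r))\<^sup>2)) = real (Suc n) * L * ?I (\<lambda>s. (norm (F s))\<^sup>2)"
  proof -
    have "continuous_on (cbox (0,0) (L,L)) (\<lambda>(s,r). K s r * (norm (F r))\<^sup>2)"
      unfolding case_prod_beta by (intro continuous_intros cF) (auto simp: cbox_Pair_eq)
    from integral_swap_continuous[OF this]
    have "?I (\<lambda>s. ?I (\<lambda>r. K s r * (norm (F r))\<^sup>2)) = ?I (\<lambda>r. ?I (\<lambda>s. K r s) * (norm (F r))\<^sup>2)"
      unfolding K_def by (simp add: fejer_sym[of n _ _ L])
    then show ?thesis
      unfolding K_def by (simp only: integral_fejer[OF L] integral_mult_right)
  qed
  finally show ?thesis by (simp add: K_def field_simps)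
qed

text \<open>
  Uniform continuity on the circle of length \<open>L\<close>, in a form that meets
  \<open>fejer_mult_chord_le\<close>: away from the diagonal of the circle the chord is bounded below.
\<close>
lemma periodic_modulus:
  fixes F :: "real \<Rightarrow> 'h::real_normed_vector"
  assumes F: "continuous_on {0..L} F" and F0: "F 0 = F L" and L: "L > 0" and e: "e > 0"
  obtains C where "C \<ge> 0"
    "\<And>s r. s \<in> {0..L} \<Longrightarrow> r \<in> {0..L} \<Longrightarrow>
       (norm (F s - F r))\<^sup>2 \<le> e + C * (cmod (cis (2 * pi * (s - r) / L) - 1))\<^sup>2"
proof -
  have "uniformly_continuous_on {0..L} F"
    by (rule compact_uniformly_continuous[OF F]) simp
  moreover have "sqrt e / 2 > 0" using e by simp
  ultimately obtain d where d: "d > 0"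
    and ud: "\<And>s r. s \<in> {0..L} \<Longrightarrow> r \<in> {0..L} \<Longrightarrow> dist r s < d \<Longrightarrow> dist (F r) (F s) < sqrt e / 2"
    unfolding uniformly_continuous_on_def by blast
  define d' where "d' = min d (L/2)"
  have d': "d' > 0" "d' \<le> d" "d' \<le> L / 2" using d L by (auto simp: d'_def)
  obtain B where "B > 0" and B: "\<And>s. s \<in> {0..L} \<Longrightarrow> norm (F s) \<le> B"
    by (rule continuous_Icc_bounded[OF F]) (rule that, assumption+)
  define \<eta> where "\<eta> = sin (pi * d' / L)"
  have \<eta>: "\<eta> > 0"
    unfolding \<eta>_def using d' L by (intro sin_gt_zero) (auto simp: field_simps)
  have chord: "(cmod (cis x - 1))\<^sup>2 = (2 * sin (x / 2))\<^sup>2" for x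
  proof -
    have "(cmod (cis x - 1))\<^sup>2 = 2 - 2 * cos x"
      unfolding cmod_power2 using sin_cos_squared_add[of x] by (simp add: power2_eq_square algebra_simps)
    also have "cos x = 1 - 2 * (sin (x / 2))\<^sup>2"
      using cos_double_sin[of "x / 2"] by simp
    finally show ?thesis by (simp add: power2_eq_square)
  qed
  define C where "C = (2 * B)\<^sup>2 / \<eta>\<^sup>2"
  have near: "(norm (F s - F r))\<^sup>2 \<le> e" if "norm (F s - F r) \<le> sqrt e" for s r
    using power_mono[OF that, of 2] e by simp
  have main: "(norm (F s - F r))\<^sup>2 \<le> e + C * (cmod (cis (2 * pi * (s - r) / L) - 1))\<^sup>2"
    if s: "s \<in> {0..L}" and r: "r \<in> {0..L}" and le: "r \<le> s" for s r
  proof -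
    consider "s - r < d'" | "L - (s - r) < d'" | "d' \<le> s - r" "s - r \<le> L - d'" by linarith
    then have "(norm (F s - F r))\<^sup>2 \<le> e \<or> \<eta>\<^sup>2 \<le> (cmod (cis (2 * pi * (s - r) / L) - 1))\<^sup>2"
    proof cases
      case 1
      then have "dist (F s) (F r) < sqrt e / 2"
        using ud[OF r s] 1 le d' by (auto simp: dist_real_def)
      moreover have "sqrt e > 0" using e by simp
      ultimately have "norm (F s - F r) \<le> sqrt e" unfolding dist_norm by linarith
      then show ?thesis by (intro disjI1 near)
    next
      case 2
      then have "dist (F s) (F L) < sqrt e / 2" "dist (F 0) (F r) < sqrt e / 2"
        using ud[of L s] ud[of r 0] s r d' L by (auto simp: dist_real_def)
      then have "dist (F s) (F r) \<le> sqrt e"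
        using dist_triangle[of "F s" "F r" "F 0"] F0 by simp
      then show ?thesis by (intro disjI1 near) (auto simp: dist_norm)
    next
      case 3
      have mono: "\<eta> \<le> sin (pi * y / L)" if y: "d' \<le> y" "y \<le> L / 2" for y
      proof -
        have "pi * y / L \<le> pi * (L / 2) / L"
          using y L by (intro divide_right_mono mult_left_mono) auto
        moreover have "0 \<le> pi * d' / L" using d' L by simp
        moreover have "pi * d' / L \<le> pi * y / L"
          using y L by (intro divide_right_mono mult_left_mono) auto
        ultimately show ?thesis
          unfolding \<eta>_def using L pi_gt_zero
          by (intro sin_monotone_2pi_le) (linarith, simp, simp)
      qed
      have half: "\<eta> \<le> sin (pi * (s - r) / L)"
      proof (cases "s - r \<le> L / 2")
        case True
        then show ?thesis using mono 3 by simp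
      next
        case False
        have "\<eta> \<le> sin (pi * (L - (s - r)) / L)"
          using mono[of "L - (s - r)"] 3 False by simp
        also have "pi * (L - (s - r)) / L = pi - pi * (s - r) / L"
          using L by (simp add: field_simps)
        finally show ?thesis by simp
      qed
      have "\<eta>\<^sup>2 \<le> (sin (pi * (s - r) / L))\<^sup>2"
        using half \<eta> by (intro power_mono) auto
      also have "\<dots> \<le> (2 * sin (2 * pi * (s - r) / L / 2))\<^sup>2"
        by (simp add: power_mult_distrib)
      finally show ?thesis unfolding chord by simp
    qed
    moreover have "(norm (F s - F r))\<^sup>2 \<le> (2 * B)\<^sup>2"
      using norm_triangle_ineq4[of "F s" "F r"] B[OF s] B[OF r] by (intro power_mono) auto
    moreover have "(2 * B)\<^sup>2 = C * \<eta>\<^sup>2" using \<eta> by (simp add: C_def)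
    moreover have "C \<ge> 0" by (simp add: C_def)
    ultimately show ?thesis
      using e mult_left_mono[of "\<eta>\<^sup>2" "(cmod (cis (2 * pi * (s - r) / L) - 1))\<^sup>2" C]
      by (smt (verit) mult_nonneg_nonneg zero_le_power2)
  qed
  show ?thesis
  proof (rule that[of C])
    fix s r assume sr: "s \<in> {0..L}" "r \<in> {0..L}"
    have neg: "2 * pi * (s - r) / L = - (2 * pi * (r - s) / L)"
      by (simp add: algebra_simps diff_divide_distrib)
    have "cmod (cis (2 * pi * (s - r) / L) - 1) = cmod (cis (2 * pi * (r - s) / L) - 1)"
      unfolding neg cis_cnj[symmetric] by (metis complex_cnj_diff complex_cnj_one complex_mod_cnj)
    then show "(norm (F s - F r))\<^sup>2 \<le> e + C * (cmod (cis (2 * pi * (s - r) / L) - 1))\<^sup>2"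
      using main[of s r] main[of r s] sr by (cases "r \<le> s") (auto simp: norm_minus_commute)
  qed (simp add: C_def)
qed

text \<open>
  For \<open>G\<close> the defect is dropped because of its sign, for \<open>F\<close> it tends to zero; hence only \<open>F\<close> needs to
  be periodic.
\<close>
lemma L2_norm_le_of_fourier_coeff_le:
  fixes F G :: "real \<Rightarrow> 'h::complex_hilbert_space"
  assumes F: "continuous_on {0..L} F" and G: "continuous_on {0..L} G"
    and F0: "F 0 = F L" and L: "L > 0"
    and le: "\<And>k. norm (fourier_coeff L F k) \<le> norm (fourier_coeff L G k)"
  shows "integral {0..L} (\<lambda>s. (norm (F s))\<^sup>2) \<le> integral {0..L} (\<lambda>s. (norm (G s))\<^sup>2)"
proof (rule field_le_epsilon)
  fix e :: real assume e: "e > 0"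
  let ?I = "integral {0..L}"
  obtain C where C: "C \<ge> 0" "\<And>s r. s \<in> {0..L} \<Longrightarrow> r \<in> {0..L} \<Longrightarrow>
       (norm (F s - F r))\<^sup>2 \<le> e / L + C * (cmod (cis (2 * pi * (s - r) / L) - 1))\<^sup>2"
    using periodic_modulus[OF F F0 L, of "e / L"] e L by auto
  obtain n where n: "4 * C * L / e < real n" using reals_Archimedean2 by blast
  define K where "K s r = fejer n (2 * pi * (s - r) / L)" for s r
  define DF where "DF = ?I (\<lambda>s. ?I (\<lambda>r. K s r * (norm (F s - F r))\<^sup>2))"
  define DG where "DG = ?I (\<lambda>s. ?I (\<lambda>r. K s r * (norm (G s - G r))\<^sup>2))"
  have inner_le: "?I (\<lambda>r. K s r * (norm (F s - F r))\<^sup>2) \<le> e * real (Suc n) + 4 * C * L"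
    if s: "s \<in> {0..L}" for s
  proof -
    have Kint: "K s integrable_on {0..L}"
      unfolding K_def using L by (intro integrable_continuous_interval continuous_intros) simp
    have "?I (\<lambda>r. K s r * (norm (F s - F r))\<^sup>2) \<le> ?I (\<lambda>r. K s r * (e / L) + 4 * C)"
    proof (rule integral_le)
      show "(\<lambda>r. K s r * (norm (F s - F r))\<^sup>2) integrable_on {0..L}"
        unfolding K_def using L by (intro integrable_continuous_interval continuous_intros F) simp
      show "(\<lambda>r. K s r * (e / L) + 4 * C) integrable_on {0..L}"
        unfolding K_def using L by (intro integrable_continuous_interval continuous_intros) simp_all
      fix r assume r: "r \<in> {0..L}"
      have "K s r * (norm (F s - F r))\<^sup>2
          \<le> K s r * (e / L + C * (cmod (cis (2 * pi * (s - r) / L) - 1))\<^sup>2)"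
        unfolding K_def by (intro mult_left_mono C(2) s r fejer_nonneg)
      also have "\<dots> = K s r * (e / L) + C * (K s r * (cmod (cis (2 * pi * (s - r) / L) - 1))\<^sup>2)"
        by (simp add: algebra_simps)
      also have "\<dots> \<le> K s r * (e / L) + C * 4"
        unfolding K_def by (intro add_left_mono mult_left_mono fejer_mult_chord_le C)
      finally show "K s r * (norm (F s - F r))\<^sup>2 \<le> K s r * (e / L) + 4 * C" by simp
    qed
    also have "\<dots> = ?I (K s) * (e / L) + 4 * C * L"
    proof -
      have "(\<lambda>r. K s r * (e / L)) integrable_on {0..L}"
        using integrable_on_mult_left[OF Kint, of "e / L"] by simp
      then show ?thesis
        using L by (subst integral_add) (auto intro: integrable_const_ivl)
    qed
    also have "?I (K s) = real (Suc n) * L"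
      unfolding K_def by (rule integral_fejer[OF L])
    finally show ?thesis using L by (simp add: mult.commute)
  qed
  have DF: "DF \<le> (e * real (Suc n) + 4 * C * L) * L"
  proof -
    have "norm DF \<le> (e * real (Suc n) + 4 * C * L) * (L - 0)"
      unfolding DF_def
    proof (rule integral_bound)
      show "continuous_on {0..L} (\<lambda>s. ?I (\<lambda>r. K s r * (norm (F s - F r))\<^sup>2))"
      proof -
        have "continuous_on ({0..L} \<times> {0..L}) (\<lambda>(s, r). K s r * (norm (F s - F r))\<^sup>2)"
          unfolding case_prod_beta K_def using L
          by (intro continuous_intros continuous_on_compose2[OF F]) auto
        then show ?thesis
          using integral_continuous_on_param[of "{0..L}" 0 L] by auto
      qed
      fix s assume s: "s \<in> {0..L}"
      have "?I (\<lambda>r. K s r * (norm (F s - F r))\<^sup>2) \<ge> 0"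
        by (cases "(\<lambda>r. K s r * (norm (F s - F r))\<^sup>2) integrable_on {0..L}")
           (auto intro!: integral_nonneg simp: K_def fejer_nonneg not_integrable_integral)
      then show "norm (?I (\<lambda>r. K s r * (norm (F s - F r))\<^sup>2)) \<le> e * real (Suc n) + 4 * C * L"
        using inner_le[OF s] by simp
    qed (use L in simp)
    then show ?thesis by simp
  qed
  have DG: "DG \<ge> 0"
  proof -
    have nn: "?I (\<lambda>r. K s r * (norm (G s - G r))\<^sup>2) \<ge> 0" for s
      by (cases "(\<lambda>r. K s r * (norm (G s - G r))\<^sup>2) integrable_on {0..L}")
         (auto intro!: integral_nonneg simp: K_def fejer_nonneg not_integrable_integral)
    show ?thesis unfolding DG_def
      by (cases "(\<lambda>s. ?I (\<lambda>r. K s r * (norm (G s - G r))\<^sup>2)) integrable_on {0..L}")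
         (auto intro!: integral_nonneg nn simp: not_integrable_integral)
  qed
  have "real (Suc n) * L * ?I (\<lambda>s. (norm (F s))\<^sup>2) - DF / 2
      = (\<Sum>j\<le>n. \<Sum>l\<le>n. (norm (fourier_coeff L F (int j - int l)))\<^sup>2)"
    unfolding DF_def K_def by (rule sum_norm_fourier_coeff_defect[OF F L, symmetric])
  also have "\<dots> \<le> (\<Sum>j\<le>n. \<Sum>l\<le>n. (norm (fourier_coeff L G (int j - int l)))\<^sup>2)"
    by (intro sum_mono power_mono le) simp
  also have "\<dots> = real (Suc n) * L * ?I (\<lambda>s. (norm (G s))\<^sup>2) - DG / 2"
    unfolding DG_def K_def by (rule sum_norm_fourier_coeff_defect[OF G L])
  finally have "real (Suc n) * L * ?I (\<lambda>s. (norm (F s))\<^sup>2)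
     \<le> real (Suc n) * L * ?I (\<lambda>s. (norm (G s))\<^sup>2) + (e * real (Suc n) + 4 * C * L) * L / 2"
    using DF DG by linarith
  also have "(e * real (Suc n) + 4 * C * L) * L / 2 \<le> real (Suc n) * L * e"
  proof -
    have "4 * C * L \<le> e * real (Suc n)" using n e by (simp add: field_simps)
    then have "(e * real (Suc n) + 4 * C * L) * L \<le> (e * real (Suc n) + e * real (Suc n)) * L"
      using L by (intro mult_right_mono) auto
    then show ?thesis by (simp add: algebra_simps)
  qed
  finally have "(real (Suc n) * L) * ?I (\<lambda>s. (norm (F s))\<^sup>2)
     \<le> (real (Suc n) * L) * (?I (\<lambda>s. (norm (G s))\<^sup>2) + e)"
    by (simp only: distrib_left)
  then show "?I (\<lambda>s. (norm (F s))\<^sup>2) \<le> ?I (\<lambda>s. (norm (G s))\<^sup>2) + e"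
    using L by (subst (asm) mult_le_cancel_left_pos) auto
qed

section \<open>The energy inequality\<close>

text \<open>
  Applying \<open>S(h)\<close> to a smoothed orbit translates the weight, so that the difference quotient falls on
  the weight.
\<close>

lemma semigroup_smoothing_in_generator:
  fixes S :: "real \<Rightarrow> 'h::complex_hilbert_space \<Rightarrow>\<^sub>L 'h" and g g' :: "real \<Rightarrow> complex"
  assumes S: "C0_semigroup S"
    and g: "\<And>s. (g has_vector_derivative g' s) (at s)" and g': "continuous_on UNIV g'"
    and supp: "\<And>s. s \<le> 0 \<or> l \<le> s \<Longrightarrow> g s = 0" and l: "0 < l" "l < L"
  shows "(integral {0..L} (\<lambda>s. g s *\<^sub>C S s x), - integral {0..L} (\<lambda>s. g' s *\<^sub>C S s x)) \<in> generator S"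
proof -
  have Sx: "continuous_on A (\<lambda>s. S s x)" if "A \<subseteq> {0..}" for A
    by (rule C0_semigroup_orbit_continuous[OF S that])
  have cg: "continuous_on A g" for A
    by (meson g continuous_at_imp_continuous_on has_vector_derivative_continuous)
  have cg'': "continuous_on A g'" for A
    using g' continuous_on_subset by blast
  have cgh: "continuous_on A (\<lambda>s. g (s + c))" for A c
    by (intro continuous_on_compose2[OF cg[of UNIV]] continuous_intros) auto
  define Y where "Y = integral {0..L} (\<lambda>s. g s *\<^sub>C S s x)"
  have gS: "(\<lambda>s. g (s + c) *\<^sub>C S s x) integrable_on {a..b}" if "0 \<le> a" for a b c
    by (intro integrable_continuous_interval scaleC.continuous_on cgh Sx) (use that in auto)
  have gS0: "(\<lambda>s. g s *\<^sub>C S s x) integrable_on {a..b}" if "0 \<le> a" for a b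
    using gS[OF that, of 0] by simp
  have g'S: "(\<lambda>s. g' s *\<^sub>C S s x) integrable_on {0..L}"
    by (intro integrable_continuous_interval scaleC.continuous_on cg'' Sx) auto
  have shift: "S h Y = integral {0..L} (\<lambda>s. g (s - h) *\<^sub>C S s x)" if h: "0 < h" "h < L - l" for h
  proof -
    have "S h Y = integral {0..L} (\<lambda>s. S h (g s *\<^sub>C S s x))"
      unfolding Y_def using gS0[of 0 L]
      by (subst integral_linear[OF _ blinfun.bounded_linear_right, symmetric]) (auto simp: o_def)
    also have "\<dots> = integral {0..L} (\<lambda>s. g (s + h - h) *\<^sub>C S (s + h) x)"
    proof (rule integral_cong)
      fix s assume s: "s \<in> {0..L}"
      then have "S (s + h) = S h o\<^sub>L S s"
        using S h unfolding C0_semigroup_def by (metis add.commute atLeastAtMost_iff less_imp_le)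
      then show "S h (g s *\<^sub>C S s x) = g (s + h - h) *\<^sub>C S (s + h) x"
        using S h s unfolding C0_semigroup_def by auto
    qed
    also have "\<dots> = integral {h..L + h} (\<lambda>s. g (s - h) *\<^sub>C S s x)"
      using integral_shift_real_ivl[of h h "L + h" "\<lambda>s. g (s - h) *\<^sub>C S s x"] by simp
    also have "\<dots> = integral {0..h} (\<lambda>s. g (s - h) *\<^sub>C S s x) + integral {h..L + h} (\<lambda>s. g (s - h) *\<^sub>C S s x)"
    proof -
      have "integral {0..h} (\<lambda>s. g (s - h) *\<^sub>C S s x) = integral {0..h} (\<lambda>s. 0)"
        by (intro integral_cong) (simp add: supp scaleC.zero_left)
      then show ?thesis by simp
    qed
    also have "\<dots> = integral {0..L + h} (\<lambda>s. g (s - h) *\<^sub>C S s x)"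
      by (rule Henstock_Kurzweil_Integration.integral_combine)
         (use h l gS[of 0 "-h" "L + h"] in auto)
    also have "\<dots> = integral {0..L} (\<lambda>s. g (s - h) *\<^sub>C S s x) + integral {L..L + h} (\<lambda>s. g (s - h) *\<^sub>C S s x)"
      by (rule Henstock_Kurzweil_Integration.integral_combine[symmetric])
         (use h l gS[of 0 "-h" "L + h"] in auto)
    also have "integral {L..L + h} (\<lambda>s. g (s - h) *\<^sub>C S s x) = integral {L..L + h} (\<lambda>s. 0)"
      using h by (intro integral_cong) (simp add: supp scaleC.zero_left)
    finally show ?thesis by simp
  qed
  have "continuous_on {0..L} (\<lambda>s. S s x)" by (rule Sx) auto
  then obtain M where M0: "M > 0" and M: "\<And>s. s \<in> {0..L} \<Longrightarrow> norm (S s x) \<le> M"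
    by (rule continuous_Icc_bounded) (rule that, assumption+)
  have "((\<lambda>h. (1 / h) *\<^sub>R (S h Y - Y)) \<longlongrightarrow> - integral {0..L} (\<lambda>s. g' s *\<^sub>C S s x)) (at_right 0)"
  proof (rule tendstoI)
    fix e :: real assume e: "e > 0"
    define \<eta> where "\<eta> = e / (2 * M * L)"
    have \<eta>: "\<eta> > 0" using e M0 l by (simp add: \<eta>_def)
    have "uniformly_continuous_on {-1..L} g'"
      by (intro compact_uniformly_continuous cg'') auto
    then obtain d where d: "d > 0"
      and ud: "\<And>s r. s \<in> {-1..L} \<Longrightarrow> r \<in> {-1..L} \<Longrightarrow> dist r s < d \<Longrightarrow> dist (g' r) (g' s) < \<eta>"
      unfolding uniformly_continuous_on_def using \<eta> by metis
    define h0 where "h0 = Min {d, 1, L - l}"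
    have h0: "h0 > 0" using d l by (simp add: h0_def)
    have "dist ((1 / h) *\<^sub>R (S h Y - Y)) (- integral {0..L} (\<lambda>s. g' s *\<^sub>C S s x)) < e"
      if h: "0 < h" "h < h0" for h
    proof -
      have hh: "h < d" "h < 1" "h < L - l" using h by (auto simp: h0_def)
      define q where "q s = (1 / h) *\<^sub>R (g (s - h) - g s) + g' s" for s
      have q: "norm (q s) \<le> \<eta>" if s: "s \<in> {0..L}" for s
      proof -
        have "norm (g (s - h) - g s - (s - h - s) *\<^sub>R g' s) \<le> norm (s - h - s) * \<eta>"
        proof (rule vector_differentiable_bound_linearization[where S = "{s - h..s}"])
          show "(g has_vector_derivative g' r) (at r within {s - h..s})" for r
            using g has_vector_derivative_at_within by blast
          fix r assume r: "r \<in> {s - h..s}"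
          have "dist (g' r) (g' s) < \<eta>"
            using r s h hh by (intro ud) (auto simp: dist_real_def)
          then show "norm (g' r - g' s) \<le> \<eta>" by (simp add: dist_norm)
        qed (use h in \<open>auto simp: closed_segment_eq_real_ivl\<close>)
        then have "norm (g (s - h) - g s + h *\<^sub>R g' s) \<le> h * \<eta>"
          using h by simp
        moreover have "g (s - h) - g s + h *\<^sub>R g' s = h *\<^sub>R q s"
          using h by (simp add: q_def scaleR_add_right)
        ultimately have "h * norm (q s) \<le> h * \<eta>"
          using h by simp
        then show ?thesis using h by simp
      qed
      have qint: "continuous_on {0..L} (\<lambda>s. q s *\<^sub>C S s x)"
        unfolding q_def using cgh[of _ "-h"] by (intro scaleC.continuous_on continuous_intros cg cg'' Sx) auto
      have "(1 / h) *\<^sub>R (S h Y - Y) + integral {0..L} (\<lambda>s. g' s *\<^sub>C S s x) = integral {0..L} (\<lambda>s. q s *\<^sub>C S s x)"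
      proof -
        have "integral {0..L} (\<lambda>s. q s *\<^sub>C S s x)
          = integral {0..L} (\<lambda>s. (1 / h) *\<^sub>R (g (s - h) *\<^sub>C S s x - g s *\<^sub>C S s x) + g' s *\<^sub>C S s x)"
          by (simp add: q_def scaleC.add_left scaleC.diff_left scaleC.scaleR_left)
        also have "\<dots> = (1 / h) *\<^sub>R (integral {0..L} (\<lambda>s. g (s - h) *\<^sub>C S s x) - integral {0..L} (\<lambda>s. g s *\<^sub>C S s x))
           + integral {0..L} (\<lambda>s. g' s *\<^sub>C S s x)"
          using gS[of 0 "-h" L] gS0[of 0 L] g'S
          by (simp add: integral_add integral_diff integrable_diff integrable_cmul)
        finally show ?thesis using shift[OF h(1) hh(3)] by (simp add: Y_def)
      qed
      then have "dist ((1 / h) *\<^sub>R (S h Y - Y)) (- integral {0..L} (\<lambda>s. g' s *\<^sub>C S s x))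
          = norm (integral {0..L} (\<lambda>s. q s *\<^sub>C S s x))"
        by (simp add: dist_norm)
      also have "\<dots> \<le> (\<eta> * M) * (L - 0)"
        using l by (intro integral_bound qint)
          (auto simp: norm_scaleC intro!: mult_mono q M order.trans[OF norm_ge_zero q])
      also have "\<dots> < e" using e M0 l by (simp add: \<eta>_def)
      finally show ?thesis .
    qed
    then show "\<forall>\<^sub>F h in at_right 0. dist ((1 / h) *\<^sub>R (S h Y - Y)) (- integral {0..L} (\<lambda>s. g' s *\<^sub>C S s x)) < e"
      unfolding eventually_at_right_field using h0 by blast
  qed
  then show ?thesis by (simp add: generator_def Y_def)
qed

text \<open>
  With \<open>g(s) = e^(-zs) \<phi>(s)\<close> the smoothed orbit \<open>Y\<close> satisfies \<open>(z - A) Y = \<integral> e^(-zs) \<phi>' u\<close>. For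
  \<open>z = \<omega> + 2 \<pi> i k / L\<close> both sides are Fourier coefficients, of \<open>e^(-\<omega>s) \<phi> u\<close> and
  \<open>e^(-\<omega>s) \<phi>' u\<close>.
\<close>
lemma energy_inequality_C1:
  fixes S :: "real \<Rightarrow> 'h::complex_hilbert_space \<Rightarrow>\<^sub>L 'h" and \<phi> \<phi>' :: "real \<Rightarrow> real"
  assumes S: "C0_semigroup S"
    and R: "\<And>z. Re z = \<omega> \<Longrightarrow> \<exists>R. is_resolvent (generator S) z R \<and> norm R \<le> 1"
    and \<phi>: "\<And>s. (\<phi> has_real_derivative \<phi>' s) (at s)" and \<phi>': "continuous_on UNIV \<phi>'"
    and supp: "\<And>s. s \<le> 0 \<or> l \<le> s \<Longrightarrow> \<phi> s = 0" and l: "0 < l" "l < L"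
  shows "integral {0..L} (\<lambda>s. ((\<phi>' s)\<^sup>2 - (\<phi> s)\<^sup>2) * exp (- 2 * \<omega> * s) * (norm (S s x))\<^sup>2) \<ge> 0"
proof -
  have Sx: "continuous_on {0..L} (\<lambda>s. S s x)"
    by (rule C0_semigroup_orbit_continuous[OF S]) auto
  have c\<phi>: "continuous_on A \<phi>" for A
    by (meson \<phi> DERIV_continuous continuous_at_imp_continuous_on)
  have c\<phi>': "continuous_on A \<phi>'" for A
    using \<phi>' continuous_on_subset by blast
  define F where "F s = exp (- \<omega> * s) *\<^sub>R (\<phi> s *\<^sub>R S s x)" for s
  define G where "G s = exp (- \<omega> * s) *\<^sub>R (\<phi>' s *\<^sub>R S s x)" for s
  have cF: "continuous_on {0..L} F" and cG: "continuous_on {0..L} G"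
    unfolding F_def G_def by (intro continuous_intros Sx c\<phi> c\<phi>')+
  have le: "norm (fourier_coeff L F k) \<le> norm (fourier_coeff L G k)" for k
  proof -
    define z where "z = Complex \<omega> (2 * pi * real_of_int k / L)"
    obtain R where Rz: "is_resolvent (generator S) z R" and R1: "norm R \<le> 1"
      using R[of z] by (auto simp: z_def)
    define g where "g s = exp (- z * complex_of_real s) * complex_of_real (\<phi> s)" for s
    define k' where "k' s = exp (- z * complex_of_real s) * complex_of_real (\<phi>' s)" for s
    have ex: "exp (- z * complex_of_real s) = complex_of_real (exp (- \<omega> * s)) * cis (- (2 * pi * real_of_int k * s / L))" for s
      by (simp add: z_def exp_eq_polar)
    have Feq: "cis (- (2 * pi * real_of_int k * s / L)) *\<^sub>C F s = g s *\<^sub>C S s x"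
      and Geq: "cis (- (2 * pi * real_of_int k * s / L)) *\<^sub>C G s = k' s *\<^sub>C S s x" for s
      unfolding F_def G_def g_def k'_def ex
      by (simp_all add: scaleC_scaleC mult_ac flip: scaleC_of_real)
    have dg: "(g has_vector_derivative (k' s - z * g s)) (at s)" for s
    proof -
      have a: "((\<lambda>s. complex_of_real (\<phi> s)) has_vector_derivative complex_of_real (\<phi>' s)) (at s)"
        using \<phi>[of s] by (intro has_vector_derivative_of_real) (simp add: has_real_derivative_iff_has_vector_derivative)
      have b: "((\<lambda>s. exp (- z * complex_of_real s)) has_vector_derivative (- z * exp (- z * complex_of_real s))) (at s)"
      proof -
        have "((\<lambda>w. exp (- z * w)) has_field_derivative (- z * exp (- z * complex_of_real s))) (at (complex_of_real s))"
          by (auto intro!: derivative_eq_intros)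
        from has_vector_derivative_real_field[OF this] show ?thesis by (simp add: o_def)
      qed
      show ?thesis
        unfolding g_def k'_def
        by (rule has_vector_derivative_eq_rhs[OF has_vector_derivative_mult[OF b a]]) (simp add: algebra_simps)
    qed
    have ck: "continuous_on A k'" and cg: "continuous_on A g" for A
      unfolding k'_def g_def by (intro continuous_intros c\<phi> c\<phi>')+
    have ig: "(\<lambda>s. g s *\<^sub>C S s x) integrable_on {0..L}" and ik: "(\<lambda>s. k' s *\<^sub>C S s x) integrable_on {0..L}"
      by (intro integrable_continuous_interval scaleC.continuous_on cg ck Sx)+
    have "(integral {0..L} (\<lambda>s. g s *\<^sub>C S s x), - integral {0..L} (\<lambda>s. (k' s - z * g s) *\<^sub>C S s x)) \<in> generator S"
      by (rule semigroup_smoothing_in_generator[OF S dg _ _ l])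
         (auto intro!: continuous_intros ck cg c\<phi> simp: g_def supp)
    moreover have "integral {0..L} (\<lambda>s. (k' s - z * g s) *\<^sub>C S s x)
        = integral {0..L} (\<lambda>s. k' s *\<^sub>C S s x) - z *\<^sub>C integral {0..L} (\<lambda>s. g s *\<^sub>C S s x)"
    proof -
      have "z *\<^sub>C integral {0..L} (\<lambda>s. g s *\<^sub>C S s x) = integral {0..L} (\<lambda>s. z *\<^sub>C (g s *\<^sub>C S s x))"
        using integral_linear[OF ig scaleC.bounded_linear_right] by (simp add: o_def)
      moreover have "(\<lambda>s. z *\<^sub>C (g s *\<^sub>C S s x)) integrable_on {0..L}"
        using integrable_linear[OF ig scaleC.bounded_linear_right] by (simp add: o_def)
      ultimately show ?thesis
        using integral_diff[OF ik] by (simp add: scaleC.diff_left scaleC_scaleC)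
    qed
    ultimately have "R (integral {0..L} (\<lambda>s. k' s *\<^sub>C S s x)) = integral {0..L} (\<lambda>s. g s *\<^sub>C S s x)"
      using Rz unfolding is_resolvent_def by fastforce
    then have "fourier_coeff L F k = R (fourier_coeff L G k)"
      by (simp add: fourier_coeff_def Feq Geq)
    then show ?thesis
      using norm_blinfun[of R "fourier_coeff L G k"] mult_right_mono[OF R1 norm_ge_zero[of "fourier_coeff L G k"]] by simp
  qed
  have "integral {0..L} (\<lambda>s. (norm (F s))\<^sup>2) \<le> integral {0..L} (\<lambda>s. (norm (G s))\<^sup>2)"
    by (rule L2_norm_le_of_fourier_coeff_le[OF cF cG _ _ le]) (use l supp in \<open>auto simp: F_def\<close>)
  moreover have "integral {0..L} (\<lambda>s. ((\<phi>' s)\<^sup>2 - (\<phi> s)\<^sup>2) * exp (- 2 * \<omega> * s) * (norm (S s x))\<^sup>2)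
     = integral {0..L} (\<lambda>s. (norm (G s))\<^sup>2 - (norm (F s))\<^sup>2)"
  proof (rule integral_cong)
    fix s
    have "exp (- 2 * \<omega> * s) = (exp (- \<omega> * s))\<^sup>2" by (simp add: power2_eq_square flip: exp_add)
    then show "((\<phi>' s)\<^sup>2 - (\<phi> s)\<^sup>2) * exp (- 2 * \<omega> * s) * (norm (S s x))\<^sup>2 = (norm (G s))\<^sup>2 - (norm (F s))\<^sup>2"
      by (simp add: F_def G_def power_mult_distrib algebra_simps)
  qed
  moreover have "integral {0..L} (\<lambda>s. (norm (G s))\<^sup>2 - (norm (F s))\<^sup>2)
     = integral {0..L} (\<lambda>s. (norm (G s))\<^sup>2) - integral {0..L} (\<lambda>s. (norm (F s))\<^sup>2)"
    by (intro integral_diff integrable_continuous_interval continuous_intros cF cG)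
  ultimately show ?thesis by simp
qed

lemma antiderivative_vanishing_left:
  fixes \<phi> :: "real \<Rightarrow> real"
  assumes c: "continuous_on UNIV \<phi>" and z: "\<And>s. s \<le> 0 \<Longrightarrow> \<phi> s = 0"
  shows "((\<lambda>s. integral {-1..s} \<phi>) has_real_derivative \<phi> s) (at s)"
    and "s \<le> 0 \<Longrightarrow> integral {-1..s} \<phi> = 0"
proof -
  have zero: "integral {-1..r} \<phi> = 0" if "r \<le> 0" for r
  proof -
    have "integral {-1..r} \<phi> = integral {-1..r} (\<lambda>_. 0)"
      by (intro integral_cong) (use that z in auto)
    then show ?thesis by simp
  qed
  then show "s \<le> 0 \<Longrightarrow> integral {-1..s} \<phi> = 0" .
  show "((\<lambda>s. integral {-1..s} \<phi>) has_real_derivative \<phi> s) (at s)"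
  proof (cases "s > - 1")
    case True
    have "((\<lambda>s. integral {-1..s} \<phi>) has_real_derivative \<phi> s) (at s within {-1..s+1})"
      using True by (intro integral_has_real_derivative continuous_on_subset[OF c]) auto
    then have "((\<lambda>s. integral {-1..s} \<phi>) has_real_derivative \<phi> s) (at s within {-1<..<s+1})"
      by (rule DERIV_subset) auto
    then show ?thesis using True by (simp add: at_within_open[of s "{-1<..<s+1}"])
  next
    case False
    have "((\<lambda>_. 0) has_real_derivative \<phi> s) (at s)" using z False by simp
    then show ?thesis
      by (rule has_field_derivative_transform_within_open[where S = "{..<0}"]) (use zero False in auto)
  qed
qed

lemma lipschitz_of_bounded_derivative:
  fixes \<phi> \<phi>' :: "real \<Rightarrow> real"
  assumes K: "finite K" and c: "continuous_on {a..b} \<phi>" and ab: "a \<le> b"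
    and d: "\<And>s. s \<in> {a<..<b} - K \<Longrightarrow> (\<phi> has_real_derivative \<phi>' s) (at s)"
    and C: "\<And>s. \<bar>\<phi>' s\<bar> \<le> C"
  shows "\<bar>\<phi> b - \<phi> a\<bar> \<le> C * (b - a)"
proof -
  have "(\<phi>' has_integral (\<phi> b - \<phi> a)) {a..b}"
    by (rule fundamental_theorem_of_calculus_interior_strong[OF K ab])
       (use d c in \<open>auto simp flip: has_real_derivative_iff_has_vector_derivative\<close>)
  moreover have "C \<ge> 0" using C[of 0] by linarith
  ultimately have "norm (\<phi> b - \<phi> a) \<le> C * measure lborel {a..b}"
    using has_integral_bound_real[of C "{}" \<phi>' "\<phi> b - \<phi> a" a b] C by simp
  then show ?thesis using ab by simp
qed

text \<open>
  The passage from \<open>C\<^sup>1\<close> weights to Lipschitz ones, and from \<open>\<omega> > 0\<close> to \<open>\<omega> \<ge> 0\<close>, by one dominated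
  convergence. Vector-valued functions do not enter here: only \<open>|S(s)x|\<^sup>2\<close> matters.
\<close>
lemma energy_inequality_lipschitz:
  fixes S :: "real \<Rightarrow> 'h::complex_hilbert_space \<Rightarrow>\<^sub>L 'h" and \<phi> \<phi>' :: "real \<Rightarrow> real" and x :: 'h
  assumes S: "C0_semigroup S"
    and R: "\<And>z. Re z > 0 \<Longrightarrow> \<exists>R. is_resolvent (generator S) z R \<and> norm R \<le> 1"
    and c: "continuous_on UNIV \<phi>" and K: "finite K"
    and d: "\<And>s. s \<notin> K \<Longrightarrow> (\<phi> has_real_derivative \<phi>' s) (at s)"
    and C: "\<And>s. \<bar>\<phi>' s\<bar> \<le> C"
    and supp: "\<And>s. s \<le> 0 \<or> l \<le> s \<Longrightarrow> \<phi> s = 0" and l: "0 < l" "l < L" and \<omega>: "\<omega> \<ge> 0"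
  defines "f \<equiv> \<lambda>s. ((\<phi>' s)\<^sup>2 - (\<phi> s)\<^sup>2) * exp (- 2 * \<omega> * s) * (norm (S s x))\<^sup>2"
  shows "f integrable_on {0..L}" "integral {0..L} f \<ge> 0"
proof -
  have C0: "C \<ge> 0" using C[of 0] by linarith
  have cA: "continuous_on A \<phi>" for A using c continuous_on_subset by blast
  have lip: "\<bar>\<phi> b - \<phi> a\<bar> \<le> C * (b - a)" if "a \<le> b" for a b
    by (rule lipschitz_of_bounded_derivative[OF K cA that _ C]) (use d in auto)
  have bd: "\<bar>\<phi> s\<bar> \<le> C * L" if "s \<le> L" for s
  proof (cases "s \<le> 0")
    case False
    then have "\<bar>\<phi> s - \<phi> 0\<bar> \<le> C * (s - 0)" by (intro lip) simp
    also have "\<dots> \<le> C * L" using that C0 by (intro mult_left_mono) auto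
    finally show ?thesis using supp[of 0] by simp
  qed (use supp C0 l in auto)
  have Sx: "continuous_on {0..L} (\<lambda>s. S s x)"
    by (rule C0_semigroup_orbit_continuous[OF S]) auto
  obtain M where "M > 0" and M: "\<And>s. s \<in> {0..L} \<Longrightarrow> norm (S s x) \<le> M"
    by (rule continuous_Icc_bounded[OF Sx]) (rule that, assumption+)
  define \<Phi> where "\<Phi> s = integral {-1..s} \<phi>" for s
  have d\<Phi>: "(\<Phi> has_real_derivative \<phi> s) (at s)" for s
    unfolding \<Phi>_def by (rule antiderivative_vanishing_left(1)[OF c]) (simp add: supp)
  define \<epsilon> where "\<epsilon> n = (L - l) / 2 * inverse (real (Suc n))" for n
  have \<epsilon>: "\<epsilon> n > 0" "l + \<epsilon> n < L" for n
  proof -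
    have "\<epsilon> n \<le> (L - l) / 2"
      unfolding \<epsilon>_def using l by (intro mult_left_le inverse_le_1_iff[THEN iffD2]) auto
    then show "l + \<epsilon> n < L" using l by simp
  qed (use l in \<open>simp add: \<epsilon>_def\<close>)
  have \<epsilon>0: "\<epsilon> \<longlonglongrightarrow> 0" unfolding \<epsilon>_def by (rule tendsto_mult_right_zero[OF LIMSEQ_inverse_real_of_nat])
  \<comment> \<open>Steklov averages \<open>p n\<close>: their derivatives are difference quotients of \<open>\<phi>\<close>, hence bounded by the
    Lipschitz constant and convergent wherever \<open>\<phi>\<close> is differentiable.\<close>
  define p where "p n s = (\<Phi> s - \<Phi> (s - \<epsilon> n)) / \<epsilon> n" for n s
  define p' where "p' n s = (\<phi> s - \<phi> (s - \<epsilon> n)) / \<epsilon> n" for n s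
  have mean: "\<exists>\<xi>. s - \<epsilon> n < \<xi> \<and> \<xi> < s \<and> p n s = \<phi> \<xi>" for n s
  proof -
    have "\<exists>\<xi>>s - \<epsilon> n. \<xi> < s \<and> \<Phi> s - \<Phi> (s - \<epsilon> n) = (s - (s - \<epsilon> n)) * \<phi> \<xi>"
      using \<epsilon>(1)[of n] d\<Phi> by (intro MVT2) auto
    then show ?thesis using \<epsilon>(1)[of n] unfolding p_def by (auto simp: field_simps)
  qed
  have dp: "(p n has_real_derivative p' n s) (at s)" for n s
  proof -
    have "((\<lambda>s. \<Phi> (s - \<epsilon> n)) has_real_derivative \<phi> (s - \<epsilon> n) * 1) (at s)"
      by (rule DERIV_chain2[OF d\<Phi>]) (auto intro!: derivative_eq_intros)
    then show ?thesis unfolding p_def p'_def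
      using \<epsilon>(1)[of n] by (auto intro!: derivative_eq_intros d\<Phi>)
  qed
  have cp: "continuous_on A (p n)" for A n
    by (meson dp DERIV_continuous continuous_at_imp_continuous_on)
  have cp': "continuous_on A (p' n)" for A n
    unfolding p'_def using \<epsilon>(1)[of n]
    by (intro continuous_intros cA continuous_on_compose2[OF cA[of UNIV]]) auto
  define \<omega>n where "\<omega>n n = \<omega> + inverse (real (Suc n))" for n
  have \<omega>n: "\<omega>n n > 0" for n using \<omega> by (simp add: \<omega>n_def add_nonneg_pos)
  define F where "F n s = ((p' n s)\<^sup>2 - (p n s)\<^sup>2) * exp (- 2 * \<omega>n n * s) * (norm (S s x))\<^sup>2" for n s
  have Fnn: "integral {0..L} (F n) \<ge> 0" for n
    unfolding F_def
  proof (rule energy_inequality_C1[OF S _ dp cp'])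
    show "\<And>z. Re z = \<omega>n n \<Longrightarrow> \<exists>R. is_resolvent (generator S) z R \<and> norm R \<le> 1"
      using R \<omega>n by simp
    show "p n s = 0" if "s \<le> 0 \<or> l + \<epsilon> n \<le> s" for s
      using mean[where n=n and s=s] supp that by force
    show "0 < l + \<epsilon> n" "l + \<epsilon> n < L" using \<epsilon>[of n] l by auto
  qed
  have Fint: "F n integrable_on {0..L}" for n
    unfolding F_def by (intro integrable_continuous_interval continuous_intros cp cp' Sx)
  have negK: "negligible K" using K by (rule negligible_finite)
  define F0 where "F0 n s = (if s \<in> K then 0 else F n s)" for n s
  define f0 where "f0 s = (if s \<in> K then 0 else f s)" for s
  have F0int: "F0 n integrable_on {0..L}" for n
    by (rule integrable_spike[OF Fint negK]) (auto simp: F0_def)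
  have F0: "integral {0..L} (F0 n) = integral {0..L} (F n)" for n
    by (rule integral_spike[OF negK]) (auto simp: F0_def)
  define B where "B = (C\<^sup>2 + (C * L)\<^sup>2) * 1 * M\<^sup>2"
  have bound: "norm (F0 n s) \<le> B" if s: "s \<in> {0..L}" for n s
  proof -
    have "\<bar>\<phi> s - \<phi> (s - \<epsilon> n)\<bar> \<le> C * (s - (s - \<epsilon> n))"
      using \<epsilon>(1)[of n] by (intro lip) auto
    then have "\<bar>p' n s\<bar> \<le> C" using \<epsilon>(1)[of n] by (simp add: p'_def field_simps)
    then have 1: "(p' n s)\<^sup>2 \<le> C\<^sup>2" by (rule abs_le_square_iff[THEN iffD1, OF order_trans]) (use C0 in simp)
    obtain \<xi> where "\<xi> < s" "p n s = \<phi> \<xi>" using mean by blast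
    then have "\<bar>p n s\<bar> \<le> C * L" using bd[of \<xi>] s by auto
    then have 2: "(p n s)\<^sup>2 \<le> (C * L)\<^sup>2" by (rule abs_le_square_iff[THEN iffD1, OF order_trans]) (use C0 l in simp)
    have 3: "\<bar>(p' n s)\<^sup>2 - (p n s)\<^sup>2\<bar> \<le> C\<^sup>2 + (C * L)\<^sup>2"
      using 1 2 zero_le_power2[of "p' n s"] zero_le_power2[of "p n s"] by linarith
    have "norm (F n s) \<le> B"
      unfolding F_def B_def norm_mult
      by (intro mult_mono) (use 3 \<omega>n[of n] s M[OF s] in \<open>auto intro!: power_mono\<close>)
    moreover have "B \<ge> 0" unfolding B_def by simp
    ultimately show ?thesis by (simp add: F0_def)
  qed
  have lim: "(\<lambda>n. F0 n s) \<longlonglongrightarrow> f0 s" if s: "s \<in> {0..L}" for s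
  proof (cases "s \<in> K")
    case False
    have "(\<lambda>n. p' n s) \<longlonglongrightarrow> \<phi>' s"
    proof -
      have "(\<lambda>h. (\<phi> (s + h) - \<phi> s) / h) \<midarrow>0\<rightarrow> \<phi>' s"
        using d[OF False] by (simp add: DERIV_def)
      moreover have "filterlim (\<lambda>n. - \<epsilon> n) (at 0) sequentially"
        using tendsto_minus[OF \<epsilon>0] \<epsilon>(1) by (auto simp: filterlim_at intro!: always_eventually) (metis less_irrefl)
      ultimately have "(\<lambda>n. (\<phi> (s + - \<epsilon> n) - \<phi> s) / - \<epsilon> n) \<longlonglongrightarrow> \<phi>' s"
        by (rule filterlim_compose)
      moreover have "(\<phi> (s + - \<epsilon> n) - \<phi> s) / - \<epsilon> n = p' n s" for n
        unfolding p'_def using \<epsilon>(1)[of n] by (simp add: field_simps)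
      ultimately show ?thesis by simp
    qed
    moreover have "(\<lambda>n. p n s) \<longlonglongrightarrow> \<phi> s"
    proof (rule Lim_transform2[OF tendsto_const[of "\<phi> s"]], rule Lim_null_comparison)
      show "\<forall>\<^sub>F n in sequentially. norm (\<phi> s - p n s) \<le> C * \<epsilon> n"
      proof (rule always_eventually, rule allI)
        fix n
        obtain \<xi> where \<xi>: "s - \<epsilon> n < \<xi>" "\<xi> < s" "p n s = \<phi> \<xi>" using mean by blast
        have "\<bar>\<phi> s - \<phi> \<xi>\<bar> \<le> C * (s - \<xi>)" using \<xi> by (intro lip) auto
        also have "\<dots> \<le> C * \<epsilon> n" using \<xi> C0 by (intro mult_left_mono) auto
        finally show "norm (\<phi> s - p n s) \<le> C * \<epsilon> n" using \<xi> by simp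
      qed
      show "(\<lambda>n. C * \<epsilon> n) \<longlonglongrightarrow> 0" using tendsto_mult_right_zero[OF \<epsilon>0] by simp
    qed
    moreover have "\<omega>n \<longlonglongrightarrow> \<omega>" unfolding \<omega>n_def by (rule LIMSEQ_inverse_real_of_nat_add)
    ultimately have "(\<lambda>n. F n s) \<longlonglongrightarrow> f s"
      unfolding F_def f_def by (intro tendsto_intros)
    then show ?thesis using False by (simp add: F0_def f0_def)
  qed (simp add: F0_def f0_def)
  have dc: "f0 integrable_on {0..L}" "(\<lambda>n. integral {0..L} (F0 n)) \<longlonglongrightarrow> integral {0..L} f0"
    by (rule dominated_convergence[OF F0int _ _ lim, of "\<lambda>_. B"]; use bound in auto)+
  show "f integrable_on {0..L}"
    by (rule integrable_spike[OF dc(1) negK]) (auto simp: f0_def)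
  have "integral {0..L} f0 \<ge> 0"
    by (rule LIMSEQ_le_const[OF dc(2)]) (use Fnn F0 in auto)
  also have "integral {0..L} f0 = integral {0..L} f"
    by (rule integral_spike[OF negK]) (auto simp: f0_def)
  finally show "integral {0..L} f \<ge> 0" .
qed

text \<open>
  The weight is continued beyond \<open>T\<close> by \<open>e^(-(s-T)/2)\<close>, for which \<open>\<phi>'\<^sup>2 - \<phi>\<^sup>2 \<le> 0\<close>, and brought to
  zero linearly on \<open>[T+n, T+n+1]\<close>. The cost of that last piece is a tail of the bounded integral.
\<close>
lemma energy_inequality_tail:
  fixes S :: "real \<Rightarrow> 'h::complex_hilbert_space \<Rightarrow>\<^sub>L 'h" and \<phi> \<phi>' :: "real \<Rightarrow> real" and x :: 'h
  assumes S: "C0_semigroup S"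
    and R: "\<And>z. Re z > 0 \<Longrightarrow> \<exists>R. is_resolvent (generator S) z R \<and> norm R \<le> 1"
    and \<omega>: "\<omega> \<ge> 0"
    and B: "\<And>t. integral {0..t} (\<lambda>s. exp (- (2 * \<omega> + 1) * s) * (norm (S s x))\<^sup>2) \<le> B"
    and T: "T > 0" and c: "continuous_on {0..T} \<phi>" and \<phi>0: "\<phi> 0 = 0" and K: "finite K"
    and d: "\<And>s. s \<in> {0<..<T} - K \<Longrightarrow> (\<phi> has_real_derivative \<phi>' s) (at s)"
    and C: "\<And>s. \<bar>\<phi>' s\<bar> \<le> C"
  defines "f \<equiv> \<lambda>s. ((\<phi>' s)\<^sup>2 - (\<phi> s)\<^sup>2) * exp (- 2 * \<omega> * s) * (norm (S s x))\<^sup>2"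
  shows "f integrable_on {0..T}" "integral {0..T} f \<ge> 0"
proof -
  define N where "N s = (norm (S s x))\<^sup>2" for s
  have cN: "continuous_on {a..b} N" if "a \<ge> 0" for a b
  proof -
    have "continuous_on {a..b} (\<lambda>s. S s x)"
      by (rule C0_semigroup_orbit_continuous[OF S]) (use that in auto)
    then show ?thesis unfolding N_def by (intro continuous_on_power continuous_on_norm)
  qed
  have N0: "N s \<ge> 0" for s by (simp add: N_def)
  define E where "E s = exp (- (2 * \<omega> + 1) * s) * N s" for s
  have Eint: "E integrable_on {a..b}" if "a \<ge> 0" for a b
    unfolding E_def by (intro integrable_continuous_interval continuous_intros cN that)
  have E0: "E s \<ge> 0" for s by (simp add: E_def N0)
  define J where "J t = integral {0..t} E" for t
  have JB: "J t \<le> B" for t using B[of t] by (simp add: J_def E_def[abs_def] N_def)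
  have Jmono: "J s \<le> J t" if "s \<le> t" for s t
    unfolding J_def using that by (intro integral_subset_le Eint) (auto simp: E0)
  define c1 where "c1 = \<phi> T"
  \<comment> \<open>Each factor is constant outside the piece that it describes.\<close>
  define \<Psi> where "\<Psi> n s = \<phi> (max 0 (min s T)) * exp (- max 0 (min (s - T) (real n)) / 2)
      * max 0 (min 1 (T + real n + 1 - s))" for n s
  define \<Psi>' where "\<Psi>' n s = (if 0 < s \<and> s < T then \<phi>' s
      else if T < s \<and> s < T + real n then - c1 / 2 * exp (- (s - T) / 2)
      else if T + real n < s \<and> s < T + real n + 1 then - c1 * exp (- real n / 2) else 0)" for n s
  define F where "F n s = ((\<Psi>' n s)\<^sup>2 - (\<Psi> n s)\<^sup>2) * exp (- 2 * \<omega> * s) * N s" for n s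
  have F: "F n integrable_on {0..T + real n + 2}" "integral {0..T + real n + 2} (F n) \<ge> 0" for n
  proof -
    have c\<Psi>: "continuous_on UNIV (\<Psi> n)"
      unfolding \<Psi>_def using T
      by (intro continuous_intros continuous_on_compose2[OF c]) auto
    have K': "finite (insert 0 (insert T (insert (T + real n) (insert (T + real n + 1) K))))"
      using K by simp
    have d\<Psi>: "(\<Psi> n has_real_derivative \<Psi>' n s) (at s)"
      if s: "s \<notin> insert 0 (insert T (insert (T + real n) (insert (T + real n + 1) K)))" for s
    proof -
      consider "s < 0" | "0 < s" "s < T" | "T < s" "s < T + real n"
        | "T + real n < s" "s < T + real n + 1" | "s > T + real n + 1"
        using s by fastforce
      then show ?thesis
      proof cases
        case 1
        have "((\<lambda>_. 0) has_real_derivative \<Psi>' n s) (at s)" using 1 T by (simp add: \<Psi>'_def)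
        then show ?thesis
          by (rule has_field_derivative_transform_within_open[where S = "{..<0}"])
             (use 1 T in \<open>auto simp: \<Psi>_def \<phi>0\<close>)
      next
        case 2
        have "(\<phi> has_real_derivative \<Psi>' n s) (at s)" using 2 d s by (simp add: \<Psi>'_def)
        then show ?thesis
          by (rule has_field_derivative_transform_within_open[where S = "{0<..<T}"])
             (use 2 T in \<open>auto simp: \<Psi>_def\<close>)
      next
        case 3
        have "((\<lambda>s. c1 * exp (- (s - T) / 2)) has_real_derivative \<Psi>' n s) (at s)"
          using 3 T by (auto simp: \<Psi>'_def intro!: derivative_eq_intros)
        then show ?thesis
          by (rule has_field_derivative_transform_within_open[where S = "{T<..<T + real n}"])
             (use 3 T in \<open>auto simp: \<Psi>_def c1_def\<close>)
      next
        case 4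
        have "((\<lambda>s. c1 * exp (- real n / 2) * (T + real n + 1 - s)) has_real_derivative \<Psi>' n s) (at s)"
          using 4 T by (auto simp: \<Psi>'_def intro!: derivative_eq_intros)
        then show ?thesis
          by (rule has_field_derivative_transform_within_open[where S = "{T + real n<..<T + real n + 1}"])
             (use 4 T in \<open>auto simp: \<Psi>_def c1_def\<close>)
      next
        case 5
        have "((\<lambda>_. 0) has_real_derivative \<Psi>' n s) (at s)" using 5 T by (simp add: \<Psi>'_def)
        then show ?thesis
          by (rule has_field_derivative_transform_within_open[where S = "{T + real n + 1<..}"])
             (use 5 T in \<open>auto simp: \<Psi>_def\<close>)
      qed
    qed
    have bd: "\<bar>\<Psi>' n s\<bar> \<le> C + \<bar>c1\<bar>" for s
    proof -
      have "C \<ge> 0" using C[of 0] by linarith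
      moreover have "\<bar>c1\<bar> / 2 * exp (- (s - T) / 2) \<le> \<bar>c1\<bar> * 1" if "T < s"
        using that by (intro mult_mono) auto
      moreover have "\<bar>c1\<bar> * exp (- real n / 2) \<le> \<bar>c1\<bar> * 1"
        by (intro mult_left_mono) auto
      ultimately show ?thesis using C[of s]
        by (auto simp: \<Psi>'_def abs_mult)
    qed
    have supp: "\<Psi> n s = 0" if "s \<le> 0 \<or> T + real n + 1 \<le> s" for s
      using that T \<phi>0 by (auto simp: \<Psi>_def)
    show "F n integrable_on {0..T + real n + 2}" "integral {0..T + real n + 2} (F n) \<ge> 0"
      using energy_inequality_lipschitz[where L = "T + real n + 2" and x = x, OF S R c\<Psi> K' d\<Psi> bd supp _ _ \<omega>] T
      unfolding F_def N_def by auto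
  qed
  have Fsub: "F n integrable_on {a..b}" if "0 \<le> a" "b \<le> T + real n + 2" for n a b
    using integrable_on_subinterval[OF F(1)] that by auto
  have fF: "F 0 s = f s" if "s \<in> {0..T} - {0, T}" for s
    using that by (auto simp: F_def f_def N_def \<Psi>_def \<Psi>'_def)
  show "f integrable_on {0..T}"
    by (rule integrable_spike_finite[of "{0,T}", OF _ _ Fsub[of 0 T 0]]) (use fF in auto)
  have main: "0 \<le> integral {0..T} f + c1\<^sup>2 * exp (T + 2) * (J (T + real (n + 2)) - J (T + real n))" for n
  proof -
    have "integral {0..T + real n + 2} (F n)
      = integral {0..T} (F n) + (integral {T..T + real n} (F n) + integral {T + real n..T + real n + 2} (F n))"
      using T Fsub by (simp add: Henstock_Kurzweil_Integration.integral_combine)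
    moreover have "integral {0..T} (F n) = integral {0..T} f"
      by (rule integral_spike[of "{0,T}"]) (auto simp: F_def f_def N_def \<Psi>_def \<Psi>'_def)
    moreover have "integral {T..T + real n} (F n) \<le> integral {T..T + real n} (\<lambda>_. 0)"
    proof (rule integral_le)
      fix s assume s: "s \<in> {T..T + real n}"
      have "(\<Psi>' n s)\<^sup>2 \<le> (\<Psi> n s)\<^sup>2"
      proof (cases "T < s \<and> s < T + real n")
        case True
        then have "\<Psi>' n s = - \<Psi> n s / 2" using T by (simp add: \<Psi>'_def \<Psi>_def c1_def)
        then show ?thesis by (simp add: power_divide)
      next
        case False
        then have "\<Psi>' n s = 0" using s by (auto simp: \<Psi>'_def)
        then show ?thesis by simp
      qed
      then show "F n s \<le> 0"
        unfolding F_def by (intro mult_nonpos_nonneg N0) auto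
    qed (use T Fsub in auto)
    moreover have "integral {T + real n..T + real n + 2} (F n)
       \<le> integral {T + real n..T + real n + 2} (\<lambda>s. c1\<^sup>2 * exp (T + 2) * E s)"
    proof (rule integral_le)
      fix s assume s: "s \<in> {T + real n..T + real n + 2}"
      have "(\<Psi>' n s)\<^sup>2 \<le> (c1 * exp (- real n / 2))\<^sup>2"
        using s by (auto simp: \<Psi>'_def power_mult_distrib)
      also have "\<dots> = c1\<^sup>2 * exp (- real n)"
        by (simp add: power_mult_distrib flip: exp_double)
      also have "\<dots> \<le> c1\<^sup>2 * exp (T + 2 - s)"
        using s by (intro mult_left_mono) auto
      finally have "(\<Psi>' n s)\<^sup>2 - (\<Psi> n s)\<^sup>2 \<le> c1\<^sup>2 * exp (T + 2 - s)"
        using zero_le_power2[of "\<Psi> n s"] by linarith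
      then have "F n s \<le> c1\<^sup>2 * exp (T + 2 - s) * exp (- 2 * \<omega> * s) * N s"
        unfolding F_def by (intro mult_right_mono N0) auto
      also have "exp (T + 2 - s) * exp (- 2 * \<omega> * s) = exp (T + 2) * exp (- (2 * \<omega> + 1) * s)"
        by (simp add: algebra_simps flip: exp_add)
      then have "c1\<^sup>2 * exp (T + 2 - s) * exp (- 2 * \<omega> * s) * N s = c1\<^sup>2 * exp (T + 2) * E s"
        by (simp add: E_def mult.assoc)
      finally show "F n s \<le> c1\<^sup>2 * exp (T + 2) * E s" .
    qed (use T Fsub integrable_on_mult_right[OF Eint] in auto)
    moreover have "integral {T + real n..T + real n + 2} E = J (T + real (n + 2)) - J (T + real n)"
    proof -
      have "J (T + real n) + integral {T + real n..T + real n + 2} E = J (T + real n + 2)"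
        unfolding J_def using T by (intro Henstock_Kurzweil_Integration.integral_combine Eint) auto
      then show ?thesis by (simp add: add_ac)
    qed
    ultimately show ?thesis using F(2)[of n] by simp
  qed
  have "(\<lambda>n. J (T + real (n + 2)) - J (T + real n)) \<longlonglongrightarrow> 0"
  proof -
    have "incseq (\<lambda>n. J (T + real n))" by (intro incseq_SucI Jmono) simp
    then obtain l where l: "(\<lambda>n. J (T + real n)) \<longlonglongrightarrow> l"
      using incseq_convergent[of "\<lambda>n. J (T + real n)" B] JB by blast
    from tendsto_diff[OF LIMSEQ_ignore_initial_segment[OF l, of 2] l] show ?thesis by simp
  qed
  then have "(\<lambda>n. integral {0..T} f + c1\<^sup>2 * exp (T + 2) * (J (T + real (n + 2)) - J (T + real n)))
     \<longlonglongrightarrow> integral {0..T} f + c1\<^sup>2 * exp (T + 2) * 0"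
    by (intro tendsto_intros)
  from LIMSEQ_le_const[OF this, of 0] main show "integral {0..T} f \<ge> 0"
    by simp
qed

text \<open>
  With \<open>\<phi>(s) = min s 1\<close> the energy inequality bounds the integral over \<open>[1,t]\<close> by the one over
  \<open>[0,1]\<close>, uniformly in \<open>t\<close>.
\<close>
lemma weighted_energy_descent:
  fixes S :: "real \<Rightarrow> 'h::complex_hilbert_space \<Rightarrow>\<^sub>L 'h" and x :: 'h
  assumes S: "C0_semigroup S"
    and R: "\<And>z. Re z > 0 \<Longrightarrow> \<exists>R. is_resolvent (generator S) z R \<and> norm R \<le> 1"
    and \<omega>: "\<omega> \<ge> 0"
    and B: "\<And>t. integral {0..t} (\<lambda>s. exp (- (2 * \<omega> + 1) * s) * (norm (S s x))\<^sup>2) \<le> B"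
  shows "\<exists>B. \<forall>t. integral {0..t} (\<lambda>s. exp (- (2 * \<omega>) * s) * (norm (S s x))\<^sup>2) \<le> B"
proof -
  define E where "E s = exp (- (2 * \<omega>) * s) * (norm (S s x))\<^sup>2" for s
  have Eint: "E integrable_on {a..b}" if "a \<ge> 0" for a b
  proof -
    have cS: "continuous_on {a..b} (\<lambda>s. S s x)"
      by (rule C0_semigroup_orbit_continuous[OF S]) (use that in auto)
    show ?thesis
      unfolding E_def by (intro integrable_continuous_interval continuous_intros cS)
  qed
  have E0: "E s \<ge> 0" for s by (simp add: E_def)
  define \<phi> :: "real \<Rightarrow> real" where "\<phi> s = min s 1" for s
  define \<phi>' :: "real \<Rightarrow> real" where "\<phi>' s = (if s < 1 then 1 else 0)" for s
  define f where "f s = ((\<phi>' s)\<^sup>2 - (\<phi> s)\<^sup>2) * exp (- 2 * \<omega> * s) * (norm (S s x))\<^sup>2" for s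
  have big: "integral {0..t} E \<le> 2 * integral {0..1} E" if t: "t \<ge> 1" for t
  proof -
    have "f integrable_on {0..t}" "integral {0..t} f \<ge> 0"
    proof -
      have dd: "(\<phi> has_real_derivative \<phi>' s) (at s)" if s: "s \<in> {0<..<t} - {1}" for s
      proof (cases "s < 1")
        case True
        have "((\<lambda>s. s) has_real_derivative \<phi>' s) (at s)" using True by (simp add: \<phi>'_def)
        then show ?thesis
          by (rule has_field_derivative_transform_within_open[where S = "{..<1}"])
             (use True in \<open>auto simp: \<phi>_def\<close>)
      next
        case False
        have "((\<lambda>s. 1) has_real_derivative \<phi>' s) (at s)" using False by (simp add: \<phi>'_def)
        then show ?thesis
          by (rule has_field_derivative_transform_within_open[where S = "{1<..}"])
             (use False s in \<open>auto simp: \<phi>_def\<close>)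
      qed
      have c: "continuous_on {0..t} \<phi>" unfolding \<phi>_def by (intro continuous_intros)
      have fin: "finite {1::real}" by simp
      have bd: "\<bar>\<phi>' s\<bar> \<le> 1" for s by (simp add: \<phi>'_def)
      show "f integrable_on {0..t}" "integral {0..t} f \<ge> 0"
        using energy_inequality_tail[OF S R \<omega> B _ c _ fin dd bd] t
        unfolding f_def by (simp_all add: \<phi>_def)
    qed
    moreover have "integral {0..t} f = integral {0..1} f + integral {1..t} f"
      using calculation t by (intro Henstock_Kurzweil_Integration.integral_combine[symmetric]) auto
    moreover have "integral {1..t} f = integral {1..t} (\<lambda>s. - E s)"
      by (intro integral_cong) (simp add: f_def E_def \<phi>_def \<phi>'_def)
    moreover have "integral {0..1} f \<le> integral {0..1} E"
    proof (rule integral_le)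
      show "f integrable_on {0..1}"
        by (rule integrable_on_subinterval[OF calculation(1)]) (use t in auto)
      fix s :: real assume "s \<in> {0..1}"
      have "(\<phi>' s)\<^sup>2 \<le> 1" by (simp add: \<phi>'_def)
      then have "(\<phi>' s)\<^sup>2 - (\<phi> s)\<^sup>2 \<le> 1"
        using zero_le_power2[of "\<phi> s"] by linarith
      from mult_right_mono[OF this E0[of s]] show "f s \<le> E s"
        by (simp add: f_def E_def mult.assoc)
    qed (use Eint in auto)
    moreover have "integral {0..t} E = integral {0..1} E + integral {1..t} E"
      using t by (intro Henstock_Kurzweil_Integration.integral_combine[symmetric] Eint) auto
    ultimately show ?thesis by simp
  qed
  have "integral {0..t} E \<le> 2 * integral {0..1} E" for t
  proof -
    have "integral {0..t} E \<le> integral {0..max t 1} E"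
      by (intro integral_subset_le Eint) (auto simp: E0)
    then show ?thesis using big[of "max t 1"] by simp
  qed
  then show ?thesis unfolding E_def by blast
qed

text \<open>
  The exponential growth bound, which starts the descent.
\<close>
lemma weighted_energy_bounded:
  fixes S :: "real \<Rightarrow> 'h::complex_hilbert_space \<Rightarrow>\<^sub>L 'h" and x :: 'h
  assumes S: "C0_semigroup S"
    and M: "\<And>t. t \<in> {0..1} \<Longrightarrow> norm (S t) \<le> M"
  shows "\<exists>k\<ge>1. \<exists>B. \<forall>t. integral {0..t} (\<lambda>s. exp (- real k * s) * (norm (S s x))\<^sup>2) \<le> B"
proof -
  define M1 where "M1 = max M 1"
  have M1: "M1 \<ge> 1" "\<And>t. t \<in> {0..1} \<Longrightarrow> norm (S t) \<le> M1"
    using M by (auto simp: M1_def intro: max.coboundedI1)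
  have pow: "norm (S t) \<le> M1 ^ Suc n" if "0 \<le> t" "t \<le> real (Suc n)" for t n
    using that
  proof (induction n arbitrary: t)
    case (Suc n)
    show ?case
    proof (cases "t \<le> 1")
      case True
      then have "norm (S t) \<le> M1" using M1 Suc.prems by auto
      also have "\<dots> \<le> M1 ^ Suc (Suc n)" using M1 by (intro self_le_power) auto
      finally show ?thesis .
    next
      case False
      have "S (1 + (t - 1)) = S 1 o\<^sub>L S (t - 1)"
        using S False unfolding C0_semigroup_def by (metis diff_ge_0_iff_ge less_eq_real_def linorder_not_less zero_le_one)
      then have "norm (S t) \<le> norm (S 1) * norm (S (t - 1))"
        by (metis add_diff_cancel_left' diff_add_cancel norm_blinfun_compose add.commute)
      also have "\<dots> \<le> M1 * M1 ^ Suc n"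
        using M1 False Suc.prems by (intro mult_mono Suc.IH) auto
      finally show ?thesis by simp
    qed
  qed (use M1 in auto)
  \<comment> \<open>Then \<open>M1\<^sup>2 \<le> e^(k-1)\<close>, and \<open>e^(-ks) |S(s)x|\<^sup>2\<close> decays like \<open>e^(-s)\<close>.\<close>
  obtain k :: nat where k: "real k \<ge> M1\<^sup>2 + 1" using real_arch_simple by blast
  have k1: "k \<ge> 1" using k M1 by (smt (verit) of_nat_1 of_nat_le_iff zero_le_power2)
  have Me: "M1\<^sup>2 \<le> exp (real k - 1)"
    using exp_ge_add_one_self[of "real k - 1"] k by linarith
  define D where "D = exp (real k - 1) * (norm x)\<^sup>2"
  have pt: "exp (- real k * s) * (norm (S s x))\<^sup>2 \<le> D * exp (- s)" if s: "s \<ge> 0" for s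
  proof -
    define n where "n = nat \<lfloor>s\<rfloor>"
    have n: "real n \<le> s" "s \<le> real (Suc n)" using s by (auto simp: n_def) linarith
    have "norm (S s x) \<le> M1 ^ Suc n * norm x"
      using norm_blinfun[of "S s" x] mult_right_mono[OF pow[OF s n(2)] norm_ge_zero[of x]] by linarith
    then have "(norm (S s x))\<^sup>2 \<le> (M1 ^ Suc n * norm x)\<^sup>2" by (intro power_mono) auto
    also have "\<dots> = (M1\<^sup>2) ^ Suc n * (norm x)\<^sup>2"
      by (simp only: power_mult_distrib power_mult[symmetric] mult.commute)
    also have "\<dots> \<le> exp (real k - 1) ^ Suc n * (norm x)\<^sup>2"
      by (intro mult_right_mono power_mono Me) auto
    also have "exp (real k - 1) ^ Suc n = exp (real (Suc n) * (real k - 1))"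
      by (rule exp_of_nat_mult[symmetric])
    also have "\<dots> * (norm x)\<^sup>2 \<le> exp ((s + 1) * (real k - 1)) * (norm x)\<^sup>2"
      using n k1 by (intro mult_right_mono iffD2[OF exp_le_cancel_iff]) auto
    finally have "exp (- real k * s) * (norm (S s x))\<^sup>2
       \<le> exp (- real k * s) * (exp ((s + 1) * (real k - 1)) * (norm x)\<^sup>2)"
      by (intro mult_left_mono) auto
    also have "\<dots> = D * exp (- s)"
    proof -
      have "exp (- real k * s) * exp ((s + 1) * (real k - 1)) = exp (real k - 1) * exp (- s)"
        by (simp add: algebra_simps flip: exp_add)
      then show ?thesis by (simp add: D_def mult_ac)
    qed
    finally show ?thesis .
  qed
  have "integral {0..t} (\<lambda>s. exp (- real k * s) * (norm (S s x))\<^sup>2) \<le> D" for t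
  proof (cases "t \<ge> 0")
    case True
    have cS: "continuous_on {0..t} (\<lambda>s. S s x)"
      by (rule C0_semigroup_orbit_continuous[OF S]) auto
    have hi: "((\<lambda>s. D * exp (- s)) has_integral (- D * exp (- t) - (- D * exp (- 0)))) {0..t}"
      using True by (intro fundamental_theorem_of_calculus)
        (auto intro!: derivative_eq_intros simp flip: has_real_derivative_iff_has_vector_derivative)
    have "integral {0..t} (\<lambda>s. exp (- real k * s) * (norm (S s x))\<^sup>2) \<le> integral {0..t} (\<lambda>s. D * exp (- s))"
      using hi pt
      by (intro integral_le integrable_continuous_interval continuous_intros cS) auto
    also have "\<dots> = D - D * exp (- t)" using integral_unique[OF hi] by simp
    also have "\<dots> \<le> D" by (simp add: D_def)
    finally show ?thesis .
  qed (simp add: D_def)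
  with k1 show ?thesis by blast
qed

lemma energy_inequality:
  fixes S :: "real \<Rightarrow> 'h::complex_hilbert_space \<Rightarrow>\<^sub>L 'h" and \<phi> \<phi>' :: "real \<Rightarrow> real" and x :: 'h
  assumes S: "C0_semigroup S"
    and R: "\<And>z. Re z > 0 \<Longrightarrow> \<exists>R. is_resolvent (generator S) z R \<and> norm R \<le> 1"
    and M: "\<And>t. t \<in> {0..1} \<Longrightarrow> norm (S t) \<le> M"
    and T: "T > 0" and c: "continuous_on {0..T} \<phi>" and \<phi>0: "\<phi> 0 = 0" and K: "finite K"
    and d: "\<And>s. s \<in> {0<..<T} - K \<Longrightarrow> (\<phi> has_real_derivative \<phi>' s) (at s)"
    and C: "\<And>s. \<bar>\<phi>' s\<bar> \<le> C"
  defines "f \<equiv> \<lambda>s. ((\<phi>' s)\<^sup>2 - (\<phi> s)\<^sup>2) * (norm (S s x))\<^sup>2"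
  shows "f integrable_on {0..T}" "integral {0..T} f \<ge> 0"
proof -
  define P where "P k \<longleftrightarrow> (\<exists>B. \<forall>t. integral {0..t} (\<lambda>s. exp (- real k * s) * (norm (S s x))\<^sup>2) \<le> B)" for k
  obtain k where "k \<ge> 1" "P k" using weighted_energy_bounded[OF S M] unfolding P_def by blast
  then have "P 1"
  proof (induction rule: inc_induct)
    case (step n)
    then obtain B where "\<And>t. integral {0..t} (\<lambda>s. exp (- (2 * (real n / 2) + 1) * s) * (norm (S s x))\<^sup>2) \<le> B"
      unfolding P_def by (auto simp: add.commute)
    from weighted_energy_descent[OF S R _ this] show ?case unfolding P_def by simp
  qed
  then obtain B where B: "\<And>t. integral {0..t} (\<lambda>s. exp (- (2 * 0 + 1) * s) * (norm (S s x))\<^sup>2) \<le> B"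
    unfolding P_def by auto
  from energy_inequality_tail[OF S R order_refl B T c \<phi>0 K d C]
  show "f integrable_on {0..T}" "integral {0..T} f \<ge> 0" unfolding f_def by simp_all
qed

section \<open>The semigroup bound from a solution with u' \<ge> u > 0\<close>

text \<open>
  Here \<open>P = m\<^sup>2 u'\<close> and \<open>q = P u\<close>, with \<open>q' = m\<^sup>2 (u'\<^sup>2 - u\<^sup>2)\<close>. The weights on \<open>[0,a]\<close> and on
  \<open>[t-b,t]\<close> solve the Euler equations of \<open>\<integral> (\<phi>'\<^sup>2 - \<phi>\<^sup>2) m\<^sup>2\<close> and of
  \<open>\<integral> (\<phi>\<^sup>2 - \<phi>'\<^sup>2) / m(t-s)\<^sup>2\<close>: the flux of a solution of the first equation solves the second.
  Since \<open>P\<close> has derivative \<open>0\<close> at \<open>0\<close>, the second weight has the natural boundary condition at \<open>s = t\<close>.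
\<close>

lemma semigroup_bound_of_robin_solution:
  fixes S :: "real \<Rightarrow> 'h::complex_hilbert_space \<Rightarrow>\<^sub>L 'h" and m u u' :: "real \<Rightarrow> real"
  assumes S: "C0_semigroup S"
    and R: "\<And>z. Re z > 0 \<Longrightarrow> \<exists>R. is_resolvent (generator S) z R \<and> norm R \<le> 1"
    and m: "continuous_on {0..} m" "\<And>s. s \<ge> 0 \<Longrightarrow> m s > 0" "\<And>s. s \<ge> 0 \<Longrightarrow> norm (S s) \<le> m s"
    and u: "\<And>s. s \<ge> 0 \<Longrightarrow> (u has_real_derivative u' s) (at s within {0..})"
    and p: "\<And>s. s \<ge> 0 \<Longrightarrow> ((\<lambda>r. (m r)\<^sup>2 * u' r) has_real_derivative - ((m s)\<^sup>2 * u s)) (at s within {0..})"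
    and u0: "u 0 = 0"
    and a: "a > 0" "\<And>s. 0 < s \<Longrightarrow> s \<le> a \<Longrightarrow> 0 < u s \<and> u s \<le> u' s"
    and b: "b > 0" "\<And>s. 0 < s \<Longrightarrow> s \<le> b \<Longrightarrow> 0 < u s \<and> u s \<le> u' s"
    and t: "t > a + b"
  shows "norm (exp t *\<^sub>R S t) \<le> exp (a + b) * m a * m b * sqrt (u' a / u a) * sqrt (u' b / u b)"
proof -
  define P where "P s = (m s)\<^sup>2 * u' s" for s
  define q where "q s = P s * u s" for s
  have dP: "(P has_real_derivative - ((m s)\<^sup>2 * u s)) (at s within {0..})" if "s \<ge> 0" for s
    using p[OF that] by (simp add: P_def[abs_def])
  have cP: "continuous_on {0..} P" and cu: "continuous_on {0..} u"
    using dP u by (auto intro!: DERIV_continuous simp: continuous_on_eq_continuous_within)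
  have "continuous_on {0..} (\<lambda>s. P s / (m s)\<^sup>2)"
    by (intro continuous_intros cP m(1)) (use m(2) in force)
  then have cu': "continuous_on {0..} u'"
    by (rule continuous_on_eq) (use m(2) in \<open>force simp: P_def\<close>)
  have cc: "continuous_on A (\<lambda>x. f (g x))"
    if "continuous_on {0..} f" "continuous_on A g" "\<And>x. x \<in> A \<Longrightarrow> g x \<ge> 0"
    for A and f g :: "real \<Rightarrow> real"
    by (rule continuous_on_compose2[OF that(1,2)]) (use that(3) in auto)
  have ab: "(u has_real_derivative u' s) (at s)" "(P has_real_derivative - ((m s)\<^sup>2 * u s)) (at s)"
    if "s > 0" for s
    using u[of s] dP[of s] that at_within_interior[of s "{0..}"] by auto
  have dq: "(q has_real_derivative (m s)\<^sup>2 * ((u' s)\<^sup>2 - (u s)\<^sup>2)) (at s)" if "s > 0" for s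
    unfolding q_def
    by (rule DERIV_cong[OF DERIV_mult[OF ab(2,1)[OF that]]]) (simp add: P_def power2_eq_square algebra_simps)
  have cq: "continuous_on {0..} q" unfolding q_def by (intro continuous_intros cP cu)
  have q0: "q 0 = 0" by (simp add: q_def u0)
  have ua: "u a > 0" "u' a > 0" and ub: "u b > 0" "u' b > 0"
    using a(2)[of a] b(2)[of b] a(1) b(1) by auto
  have ua0: "u a \<noteq> 0" using ua by simp
  have Pb: "P b > 0" using ub m(2)[of b] b(1) by (simp add: P_def)
  define c where "c = t - b"
  define E where "E = exp (c - a)"
  have ac: "a < c" "c < t" "c > 0" using t a b by (auto simp: c_def)
  \<comment> \<open>The three pieces in one product of clamped factors, which makes continuity immediate; on each piece
    two of the factors are constant.\<close>
  define \<phi> where "\<phi> s = u (max 0 (min s a)) / u a * exp (max 0 (min (s - a) (c - a)))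
     * (P (max 0 (min b (t - s))) / P b)" for s
  define \<phi>' where "\<phi>' s = (if 0 < s \<and> s < a then u' s / u a
     else if a < s \<and> s < c then exp (s - a)
     else if c < s \<and> s < t then E * ((m (t - s))\<^sup>2 * u (t - s)) / P b else 0)" for s
  have \<phi>1: "\<phi> s = u s / u a" if "0 \<le> s" "s \<le> a" for s
    using that ac Pb b(1) by (simp add: \<phi>_def c_def)
  have \<phi>2: "\<phi> s = exp (s - a)" if "a \<le> s" "s \<le> c" for s
    using that ac Pb a(1) ua0 b(1) by (simp add: \<phi>_def c_def)
  have \<phi>3: "\<phi> s = E * P (t - s) / P b" if "c \<le> s" "s \<le> t" for s
    using that ac Pb a(1) ua0 by (simp add: \<phi>_def c_def E_def)
  define K where "K = {a, c}"
  have finK: "finite K" by (simp add: K_def)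
  have d: "(\<phi> has_real_derivative \<phi>' s) (at s)" if s: "s \<in> {0<..<t} - K" for s
  proof -
    consider "0 < s" "s < a" | "a < s" "s < c" | "c < s" "s < t" using s by (force simp: K_def)
    then show ?thesis
    proof cases
      case 1
      have "((\<lambda>s. u s / u a) has_real_derivative \<phi>' s) (at s)"
        using DERIV_cdivide[OF ab(1)[OF 1(1)], of "u a"] 1 by (simp add: \<phi>'_def)
      then show ?thesis
        by (rule has_field_derivative_transform_within_open[where S = "{0<..<a}"])
           (use 1 \<phi>1 in auto)
    next
      case 2
      have "((\<lambda>s. exp (s - a)) has_real_derivative \<phi>' s) (at s)"
        using 2 a by (auto simp: \<phi>'_def intro!: derivative_eq_intros)
      then show ?thesis
        by (rule has_field_derivative_transform_within_open[where S = "{a<..<c}"])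
           (use 2 \<phi>2 in auto)
    next
      case 3
      have "((\<lambda>s. P (t - s)) has_real_derivative (- ((m (t - s))\<^sup>2 * u (t - s)) * (- 1))) (at s)"
        by (rule DERIV_chain2[OF ab(2)]) (use 3 in \<open>auto intro!: derivative_eq_intros\<close>)
      then have "((\<lambda>s. E * P (t - s) / P b) has_real_derivative \<phi>' s) (at s)"
        using 3 ac Pb by (auto simp: \<phi>'_def intro!: derivative_eq_intros)
      then show ?thesis
        by (rule has_field_derivative_transform_within_open[where S = "{c<..<t}"])
           (use 3 \<phi>3 in auto)
    qed
  qed
  have c\<phi>: "continuous_on {0..t} \<phi>"
    unfolding \<phi>_def using ua Pb
    by (intro continuous_intros cc[OF cu] cc[OF cP]) auto
  obtain C where C: "\<And>s. \<bar>\<phi>' s\<bar> \<le> C"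
  proof -
    have "continuous_on {0..a} (\<lambda>s. u' s / u a)"
      by (intro continuous_intros continuous_on_subset[OF cu']) (use ua in auto)
    then obtain B1 where B1: "\<And>s. s \<in> {0..a} \<Longrightarrow> norm (u' s / u a) \<le> B1"
      by (rule continuous_Icc_bounded) (rule that, assumption+)
    have "continuous_on {0..b} (\<lambda>s. E * ((m s)\<^sup>2 * u s) / P b)"
      by (intro continuous_intros continuous_on_subset[OF m(1)] continuous_on_subset[OF cu]) (use Pb in auto)
    then obtain B2 where B2: "\<And>s. s \<in> {0..b} \<Longrightarrow> norm (E * ((m s)\<^sup>2 * u s) / P b) \<le> B2"
      by (rule continuous_Icc_bounded) (rule that, assumption+)
    have "\<bar>\<phi>' s\<bar> \<le> \<bar>B1\<bar> + E + \<bar>B2\<bar>" for s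
    proof -
      have "E > 0" by (simp add: E_def)
      consider "0 < s" "s < a" | "a < s" "s < c" | "c < s" "s < t" | "\<phi>' s = 0"
        unfolding \<phi>'_def by metis
      then show ?thesis
      proof cases
        case 1 then show ?thesis using B1[of s] \<open>E > 0\<close> by (simp add: \<phi>'_def)
      next
        case 2
        then have "\<phi>' s = exp (s - a)" using a by (simp add: \<phi>'_def)
        moreover have "exp (s - a) \<le> E" using 2 by (simp add: E_def)
        ultimately show ?thesis by simp
      next
        case 3 then show ?thesis using B2[of "t - s"] ac \<open>E > 0\<close> by (simp add: \<phi>'_def c_def)
      next
        case 4 then show ?thesis using \<open>E > 0\<close> by simp
      qed
    qed
    then show ?thesis using that by blast
  qed
  obtain M where M: "\<And>t. t \<in> {0..1} \<Longrightarrow> norm (S t) \<le> M"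
  proof -
    have "continuous_on {0..1} m" using m(1) by (rule continuous_on_subset) auto
    then obtain M where "\<And>r. r \<in> {0..1} \<Longrightarrow> norm (m r) \<le> M"
      by (rule continuous_Icc_bounded) (rule that, assumption+)
    then have "norm (S r) \<le> M" if "r \<in> {0..1}" for r using m(2,3)[of r] that by force
    then show ?thesis using that by blast
  qed
  have key: "norm (S t x) \<le> exp (a + b - t) * m a * m b * sqrt (u' a / u a) * sqrt (u' b / u b) * norm x" for x
  proof -
    define N where "N s = (norm (S s x))\<^sup>2" for s
    have N0: "N s \<ge> 0" for s by (simp add: N_def)
    define f where "f s = ((\<phi>' s)\<^sup>2 - (\<phi> s)\<^sup>2) * N s" for s
    have f: "f integrable_on {0..t}" "integral {0..t} f \<ge> 0"
      using energy_inequality[OF S R M _ c\<phi> _ finK d C, where x = x] ac \<phi>1[of 0] a(1)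
      unfolding f_def N_def by (auto simp: u0)
    have fs: "f integrable_on {r..r'}" if "0 \<le> r" "r' \<le> t" for r r'
      using integrable_on_subinterval[OF f(1)] that by auto
    have hq: "((\<lambda>s. (m s)\<^sup>2 * ((u' s)\<^sup>2 - (u s)\<^sup>2)) has_integral q a - q 0) {0..a}"
      by (rule fundamental_theorem_of_calculus_interior)
         (use a dq continuous_on_subset[OF cq] in \<open>auto simp flip: has_real_derivative_iff_has_vector_derivative\<close>)
    define k where "k = (norm x)\<^sup>2 / (u a)\<^sup>2"
    have I1: "integral {0..a} f \<le> integral {0..a} (\<lambda>s. (m s)\<^sup>2 * ((u' s)\<^sup>2 - (u s)\<^sup>2) * k)"
    proof (rule integral_le)
      fix s assume s: "s \<in> {0..a}"
      have Nm: "N s \<le> (m s)\<^sup>2 * (norm x)\<^sup>2"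
      proof -
        have "norm (S s x) \<le> m s * norm x"
          using norm_blinfun[of "S s" x] mult_right_mono[OF m(3)[of s] norm_ge_zero[of x]] s by auto
        then show ?thesis unfolding N_def by (metis norm_ge_zero power_mono power_mult_distrib)
      qed
      have u'u: "(u s)\<^sup>2 \<le> (u' s)\<^sup>2"
      proof (cases "s = 0")
        case False
        then show ?thesis using a(2)[of s] s by (intro power_mono) auto
      qed (simp add: u0)
      have "(\<phi>' s)\<^sup>2 \<le> (u' s)\<^sup>2 / (u a)\<^sup>2"
        using s ac by (auto simp: \<phi>'_def power_divide)
      then have "(\<phi>' s)\<^sup>2 - (\<phi> s)\<^sup>2 \<le> ((u' s)\<^sup>2 - (u s)\<^sup>2) / (u a)\<^sup>2"
        using \<phi>1[of s] s by (simp add: power_divide diff_divide_distrib)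
      then have "f s \<le> ((u' s)\<^sup>2 - (u s)\<^sup>2) / (u a)\<^sup>2 * N s"
        unfolding f_def by (rule mult_right_mono[OF _ N0])
      also have "\<dots> \<le> ((u' s)\<^sup>2 - (u s)\<^sup>2) / (u a)\<^sup>2 * ((m s)\<^sup>2 * (norm x)\<^sup>2)"
        using u'u by (intro mult_left_mono Nm) auto
      finally show "f s \<le> (m s)\<^sup>2 * ((u' s)\<^sup>2 - (u s)\<^sup>2) * k" by (simp add: k_def mult_ac)
    qed (use ac fs has_integral_mult_left[OF hq] in \<open>auto simp: has_integral_integrable\<close>)
    also have "\<dots> = q a * k"
      using integral_unique[OF has_integral_mult_left[OF hq, of k]] q0 by simp
    finally have I1: "integral {0..a} f \<le> q a * k" .
    have I2: "integral {a..c} f \<le> integral {a..c} (\<lambda>_. 0)"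
    proof (rule integral_le)
      fix s assume s: "s \<in> {a..c}"
      have "(\<phi>' s)\<^sup>2 \<le> (\<phi> s)\<^sup>2"
        using s \<phi>2[of s] a ac by (auto simp: \<phi>'_def)
      then show "f s \<le> 0" unfolding f_def by (intro mult_nonpos_nonneg N0) auto
    qed (use a ac fs in auto)
    define k' where "k' = (E / P b)\<^sup>2 * N t"
    have dq': "((\<lambda>s. q (t - s)) has_real_derivative - ((m (t - s))\<^sup>2 * ((u' (t - s))\<^sup>2 - (u (t - s))\<^sup>2))) (at s)"
      if "s < t" for s
    proof -
      have "((\<lambda>s. q (t - s)) has_real_derivative
          (m (t - s))\<^sup>2 * ((u' (t - s))\<^sup>2 - (u (t - s))\<^sup>2) * (- 1)) (at s)"
        by (rule DERIV_chain2[where f = q and g = "\<lambda>s. t - s", OF dq])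
           (use that in \<open>auto intro!: derivative_eq_intros\<close>)
      then show ?thesis by simp
    qed
    have hq': "((\<lambda>s. - ((m (t - s))\<^sup>2 * ((u' (t - s))\<^sup>2 - (u (t - s))\<^sup>2))) has_integral q (t - t) - q (t - c)) {c..t}"
      using ac
      by (intro fundamental_theorem_of_calculus_interior cc[OF cq] continuous_intros)
         (auto simp flip: has_real_derivative_iff_has_vector_derivative intro: dq')
    have I3: "integral {c..t} f \<le> integral {c..t} (\<lambda>s. - ((m (t - s))\<^sup>2 * ((u' (t - s))\<^sup>2 - (u (t - s))\<^sup>2)) * k')"
    proof (rule integral_le)
      fix s assume s: "s \<in> {c..t}"
      define \<sigma> where "\<sigma> = t - s"
      have \<sigma>: "0 \<le> \<sigma>" "\<sigma> \<le> b" using s by (auto simp: \<sigma>_def c_def)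
      have Nt: "N t \<le> (m \<sigma>)\<^sup>2 * N s"
      proof -
        have "S (\<sigma> + s) = S \<sigma> o\<^sub>L S s"
          using S \<sigma> s ac unfolding C0_semigroup_def by auto
        then have "S t x = S \<sigma> (S s x)" by (simp add: \<sigma>_def)
        then have "norm (S t x) \<le> m \<sigma> * norm (S s x)"
          using norm_blinfun[of "S \<sigma>" "S s x"] mult_right_mono[OF m(3)[OF \<sigma>(1)] norm_ge_zero[of "S s x"]] by simp
        then show ?thesis unfolding N_def by (metis norm_ge_zero power_mono power_mult_distrib)
      qed
      have u'u: "(u \<sigma>)\<^sup>2 \<le> (u' \<sigma>)\<^sup>2"
      proof (cases "\<sigma> = 0")
        case False
        then show ?thesis using b(2)[of \<sigma>] \<sigma> by (intro power_mono) auto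
      qed (simp add: u0)
      have "(\<phi>' s)\<^sup>2 \<le> (E / P b)\<^sup>2 * ((m \<sigma>)\<^sup>2 * u \<sigma>)\<^sup>2"
        using s ac a by (auto simp: \<phi>'_def \<sigma>_def power_divide power_mult_distrib)
      moreover have "(\<phi> s)\<^sup>2 = (E / P b)\<^sup>2 * (P \<sigma>)\<^sup>2"
        using s \<phi>3[of s] by (simp add: \<sigma>_def power_divide power_mult_distrib)
      ultimately have "(\<phi>' s)\<^sup>2 - (\<phi> s)\<^sup>2 \<le> (E / P b)\<^sup>2 * (((m \<sigma>)\<^sup>2 * u \<sigma>)\<^sup>2 - (P \<sigma>)\<^sup>2)"
        by (simp add: right_diff_distrib)
      also have "\<dots> = - ((E / P b)\<^sup>2 * (m \<sigma>)\<^sup>2 * ((u' \<sigma>)\<^sup>2 - (u \<sigma>)\<^sup>2)) * (m \<sigma>)\<^sup>2"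
        unfolding P_def[of \<sigma>] power_mult_distrib[of "(m \<sigma>)\<^sup>2"]
        by (simp only: power2_eq_square[of "(m \<sigma>)\<^sup>2"]) (simp add: algebra_simps)
      finally have "f s \<le> - ((E / P b)\<^sup>2 * (m \<sigma>)\<^sup>2 * ((u' \<sigma>)\<^sup>2 - (u \<sigma>)\<^sup>2)) * (m \<sigma>)\<^sup>2 * N s"
        unfolding f_def by (rule mult_right_mono[OF _ N0])
      also have "\<dots> = - ((E / P b)\<^sup>2 * (m \<sigma>)\<^sup>2 * ((u' \<sigma>)\<^sup>2 - (u \<sigma>)\<^sup>2) * ((m \<sigma>)\<^sup>2 * N s))"
        by simp
      also have "\<dots> \<le> - ((E / P b)\<^sup>2 * (m \<sigma>)\<^sup>2 * ((u' \<sigma>)\<^sup>2 - (u \<sigma>)\<^sup>2) * N t)"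
        using u'u by (intro le_imp_neg_le mult_left_mono Nt) auto
      finally show "f s \<le> - ((m (t - s))\<^sup>2 * ((u' (t - s))\<^sup>2 - (u (t - s))\<^sup>2)) * k'"
        by (simp add: k'_def \<sigma>_def mult_ac)
    qed (use ac fs has_integral_mult_left[OF hq'] in \<open>auto simp: has_integral_integrable\<close>)
    also have "\<dots> = - q b * k'"
      using integral_unique[OF has_integral_mult_left[OF hq', of k']] q0 by (simp add: c_def)
    finally have I3: "integral {c..t} f \<le> - q b * k'" .
    have "integral {0..t} f = integral {0..a} f + (integral {a..c} f + integral {c..t} f)"
      using a ac fs by (simp add: Henstock_Kurzweil_Integration.integral_combine)
    then have "q b * k' \<le> q a * k" using f(2) I1 I2 I3 by simp
    then have "N t * ((E / P b)\<^sup>2 * q b) \<le> q a * k" by (simp add: k'_def mult_ac)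
    moreover have "(E / P b)\<^sup>2 * q b = E\<^sup>2 / ((m b)\<^sup>2 * (u' b / u b))"
      using ub Pb m(2)[of b] b(1) by (simp add: q_def P_def power2_eq_square field_simps)
    moreover have "q a * k = (m a)\<^sup>2 * (u' a / u a) * (norm x)\<^sup>2"
      using ua by (simp add: q_def P_def k_def power2_eq_square field_simps)
    ultimately have "N t * (E\<^sup>2 / ((m b)\<^sup>2 * (u' b / u b))) \<le> (m a)\<^sup>2 * (u' a / u a) * (norm x)\<^sup>2"
      by simp
    moreover define B where "B = (m b)\<^sup>2 * (u' b / u b)"
    ultimately have "N t * E\<^sup>2 / B \<le> (m a)\<^sup>2 * (u' a / u a) * (norm x)\<^sup>2" by simp
    moreover have "B > 0" using ub m(2)[of b] b(1) by (simp add: B_def)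
    moreover have "E\<^sup>2 > 0" by (simp add: E_def)
    ultimately have "N t \<le> (m a)\<^sup>2 * (u' a / u a) * (norm x)\<^sup>2 * B / E\<^sup>2"
      by (simp only: pos_divide_le_eq pos_le_divide_eq)
    then have Nt: "N t \<le> (m a)\<^sup>2 * (u' a / u a) * (norm x)\<^sup>2 * ((m b)\<^sup>2 * (u' b / u b)) / E\<^sup>2"
      by (simp only: B_def)
    have "norm (S t x) = sqrt (N t)" by (simp add: N_def)
    also have "\<dots> \<le> sqrt ((m a)\<^sup>2 * (u' a / u a) * (norm x)\<^sup>2 * ((m b)\<^sup>2 * (u' b / u b)) / E\<^sup>2)"
      by (rule real_sqrt_le_mono[OF Nt])
    also have "\<dots> = m a * sqrt (u' a / u a) * norm x * (m b * sqrt (u' b / u b)) / E"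
      using m(2)[of a] m(2)[of b] a(1) b(1)
      by (simp add: real_sqrt_mult real_sqrt_divide E_def)
    also have "\<dots> = m a * sqrt (u' a / u a) * norm x * (m b * sqrt (u' b / u b)) * (1 / E)" by simp
    also have "1 / E = exp (a + b - t)"
      by (simp add: E_def c_def flip: exp_minus inverse_eq_divide)
    also have "m a * sqrt (u' a / u a) * norm x * (m b * sqrt (u' b / u b)) * exp (a + b - t)
       = exp (a + b - t) * m a * m b * sqrt (u' a / u a) * sqrt (u' b / u b) * norm x"
      by (simp only: mult_ac)
    finally show ?thesis .
  qed
  have "norm (S t) \<le> exp (a + b - t) * m a * m b * sqrt (u' a / u a) * sqrt (u' b / u b)"
    by (rule norm_blinfun_bound[OF _ key])
       (use m(2)[of a] m(2)[of b] a(1) b(1) ua ub in simp)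
  then have "exp t * norm (S t) \<le> exp t * (exp (a + b - t) * m a * m b * sqrt (u' a / u a) * sqrt (u' b / u b))"
    by (intro mult_left_mono) auto
  also have "\<dots> = (exp t * exp (a + b - t)) * m a * m b * sqrt (u' a / u a) * sqrt (u' b / u b)"
    by simp
  also have "exp t * exp (a + b - t) = exp (a + b)" by (simp flip: exp_add)
  finally show ?thesis by simp
qed

section \<open>The Sturm--Liouville equation and its parameter\<close>

text \<open>
  The initial value problem \<open>-(m\<^sup>2 u')' = \<mu> m\<^sup>2 u\<close>, \<open>u(0) = 0\<close>, \<open>u'(0) > 0\<close> as a first-order system for \<open>u\<close>
  and the flux \<open>p = m\<^sup>2 u'\<close>. No derivative of \<open>m\<close> appears in this form. The parameter \<open>\<mu>\<close> is \<open>1 + \<lambda>\<close> for the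
  spectral parameter \<open>\<lambda>\<close> of \<open>K\<^sub>m\<close>; \<open>\<mu> = 1\<close> is the equation of \<open>u\<^sub>0\<close>.
\<close>

definition robin_flow :: "(real \<Rightarrow> real) \<Rightarrow> real \<Rightarrow> (real \<Rightarrow> real) \<Rightarrow> (real \<Rightarrow> real) \<Rightarrow> bool" where
  "robin_flow m \<mu> u p \<longleftrightarrow>
     (\<forall>s\<ge>0. (u has_real_derivative p s / (m s)\<^sup>2) (at s within {0..})) \<and>
     (\<forall>s\<ge>0. (p has_real_derivative - (\<mu> * ((m s)\<^sup>2 * u s))) (at s within {0..})) \<and>
     u 0 = 0 \<and> p 0 > 0"

lemma has_real_derivative_transform:
  fixes f g :: "real \<Rightarrow> real"
  assumes "s \<in> A" "\<And>x. x \<in> A \<Longrightarrow> g x = f x" "(f has_real_derivative D) (at s within A)"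
  shows "(g has_real_derivative D) (at s within A)"
  using assms has_derivative_transform unfolding has_field_derivative_def by blast

lemma robin_flowD:
  assumes "robin_flow m \<mu> u p"
  shows "s \<ge> 0 \<Longrightarrow> (u has_real_derivative p s / (m s)\<^sup>2) (at s within {0..})"
    and "s \<ge> 0 \<Longrightarrow> (p has_real_derivative - (\<mu> * ((m s)\<^sup>2 * u s))) (at s within {0..})"
    and "u 0 = 0" "p 0 > 0"
    and "s > 0 \<Longrightarrow> (u has_real_derivative p s / (m s)\<^sup>2) (at s)"
    and "s > 0 \<Longrightarrow> (p has_real_derivative - (\<mu> * ((m s)\<^sup>2 * u s))) (at s)"
    and "A \<subseteq> {0..} \<Longrightarrow> continuous_on A u" "A \<subseteq> {0..} \<Longrightarrow> continuous_on A p"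
proof -
  show 1: "s \<ge> 0 \<Longrightarrow> (u has_real_derivative p s / (m s)\<^sup>2) (at s within {0..})"
    and 2: "s \<ge> 0 \<Longrightarrow> (p has_real_derivative - (\<mu> * ((m s)\<^sup>2 * u s))) (at s within {0..})" for s
    using assms unfolding robin_flow_def by auto
  show "u 0 = 0" "p 0 > 0" using assms unfolding robin_flow_def by auto
  show "s > 0 \<Longrightarrow> (u has_real_derivative p s / (m s)\<^sup>2) (at s)"
    "s > 0 \<Longrightarrow> (p has_real_derivative - (\<mu> * ((m s)\<^sup>2 * u s))) (at s)"
    using 1[of s] 2[of s] at_within_interior[of s "{0..}"] by auto
  have "continuous_on {0..} u" "continuous_on {0..} p"
    using 1 2 by (auto intro!: DERIV_continuous simp: continuous_on_eq_continuous_within)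
  then show "A \<subseteq> {0..} \<Longrightarrow> continuous_on A u" "A \<subseteq> {0..} \<Longrightarrow> continuous_on A p"
    by (auto intro: continuous_on_subset)
qed

text \<open>
  Iterated integrals of the constant \<open>1\<close> against the alternating weights \<open>1/m\<^sup>2\<close> and \<open>m\<^sup>2\<close>.
\<close>
primrec iterated_integral :: "(real \<Rightarrow> real) \<Rightarrow> nat \<Rightarrow> real \<Rightarrow> real" where
  "iterated_integral m 0 = (\<lambda>s. 1)"
| "iterated_integral m (Suc k) =
     (\<lambda>s. integral {0..s} (\<lambda>r. (if even k then 1 / (m r)\<^sup>2 else (m r)\<^sup>2) * iterated_integral m k r))"

declare iterated_integral.simps(2) [simp del]

context
  fixes m :: "real \<Rightarrow> real"
  assumes cm: "continuous_on {0..} m" and pos: "\<And>s. s \<ge> 0 \<Longrightarrow> m s > 0"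
begin

definition wt :: "nat \<Rightarrow> real \<Rightarrow> real" where
  "wt k r = (if even k then 1 / (m r)\<^sup>2 else (m r)\<^sup>2)"

lemma iterated_integral_Suc: "iterated_integral m (Suc k) = (\<lambda>s. integral {0..s} (\<lambda>r. wt k r * iterated_integral m k r))"
  by (simp only: iterated_integral.simps wt_def)

lemma continuous_on_wt: "A \<subseteq> {0..} \<Longrightarrow> continuous_on A (wt k)"
  using continuous_on_subset[OF cm, of A] pos
  unfolding wt_def by (cases "even k") (force intro!: continuous_intros)+

lemma continuous_on_iter_term: "continuous_on {0..a} (iterated_integral m k)"
proof (induction k)
  case (Suc k)
  have "continuous_on {0..a} (\<lambda>r. wt k r * iterated_integral m k r)"
    by (intro continuous_on_mult continuous_on_wt Suc) auto
  then show ?case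
    unfolding iterated_integral_Suc
    by (intro indefinite_integral_continuous_1 integrable_continuous_interval)
qed simp

lemma iterated_integral_deriv:
  assumes "s \<in> {0..a}"
  shows "(iterated_integral m (Suc k) has_real_derivative wt k s * iterated_integral m k s) (at s within {0..a})"
  unfolding iterated_integral_Suc
  by (rule integral_has_real_derivative[OF _ assms])
     (intro continuous_on_mult continuous_on_wt continuous_on_iter_term; auto)

lemma wt_bound:
  obtains K where "K > 0" "\<And>k s. s \<in> {0..a} \<Longrightarrow> wt k s \<le> K"
proof -
  have ex: "\<exists>B. \<forall>s\<in>{0..a}. wt k s \<le> B" for k
  proof -
    have "continuous_on {0..a} (wt k)" by (rule continuous_on_wt) auto
    then obtain B where B: "\<And>s. s \<in> {0..a} \<Longrightarrow> norm (wt k s) \<le> B"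
      by (rule continuous_Icc_bounded) (rule that, assumption+)
    have "wt k s \<le> B" if "s \<in> {0..a}" for s using B[OF that] by simp
    then show ?thesis by blast
  qed
  obtain B0 B1 where B: "\<forall>s\<in>{0..a}. wt 0 s \<le> B0" "\<forall>s\<in>{0..a}. wt 1 s \<le> B1"
    using ex by metis
  have par: "wt k s = wt 0 s \<or> wt k s = wt 1 s" for k s by (simp add: wt_def)
  have "wt k s \<le> max 1 (max B0 B1)" if "s \<in> {0..a}" for k s
    using par[of k s] B that by (auto simp: le_max_iff_disj)
  then show ?thesis by (intro that[of "max 1 (max B0 B1)"]) auto
qed

lemma iterated_integral_bounds:
  assumes K: "K > 0" "\<And>k s. s \<in> {0..a} \<Longrightarrow> wt k s \<le> K"
  shows "s \<in> {0..a} \<Longrightarrow> 0 \<le> iterated_integral m k s \<and> iterated_integral m k s \<le> (K * s) ^ k / fact k"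
proof (induction k arbitrary: s)
  case (Suc k)
  have sub: "r \<in> {0..a}" if "r \<in> {0..s}" for r using Suc.prems that by auto
  have ii: "(\<lambda>r. wt k r * iterated_integral m k r) integrable_on {0..s}"
    by (intro integrable_continuous_interval continuous_on_mult continuous_on_wt continuous_on_iter_term) auto
  have w0: "0 \<le> wt k r" for r by (simp add: wt_def)
  have "0 \<le> iterated_integral m (Suc k) s"
    unfolding iterated_integral_Suc
    by (rule integral_nonneg[OF ii]) (intro mult_nonneg_nonneg w0 Suc.IH[THEN conjunct1] sub)
  moreover have "iterated_integral m (Suc k) s \<le> (K * s) ^ Suc k / fact (Suc k)"
  proof -
    have hi: "((\<lambda>r. K * ((K * r) ^ k / fact k)) has_integral
        ((K * s) ^ Suc k / fact (Suc k) - (K * 0) ^ Suc k / fact (Suc k))) {0..s}"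
    proof (rule fundamental_theorem_of_calculus)
      fix r
      have "((\<lambda>r. (K * r) ^ Suc k / fact (Suc k)) has_real_derivative
          (real (Suc k) * ((K * r) ^ k * K)) / fact (Suc k)) (at r within {0..s})"
        by (rule DERIV_cong[OF DERIV_cdivide[OF DERIV_power_Suc[OF DERIV_cmult_Id]]]) simp
      also have "(real (Suc k) * ((K * r) ^ k * K)) / fact (Suc k) = K * ((K * r) ^ k / fact k)"
        by (simp only: fact_Suc of_nat_mult) (simp add: field_simps del: of_nat_Suc)
      finally show "((\<lambda>r. (K * r) ^ Suc k / fact (Suc k)) has_vector_derivative K * ((K * r) ^ k / fact k)) (at r within {0..s})"
        by (simp add: has_real_derivative_iff_has_vector_derivative)
    qed (use Suc.prems in auto)
    have "iterated_integral m (Suc k) s \<le> integral {0..s} (\<lambda>r. K * ((K * r) ^ k / fact k))"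
      unfolding iterated_integral_Suc
    proof (rule integral_le[OF ii])
      fix r assume r: "r \<in> {0..s}"
      show "wt k r * iterated_integral m k r \<le> K * ((K * r) ^ k / fact k)"
        by (rule mult_mono[OF K(2)[OF sub[OF r]]]) (use Suc.IH[OF sub[OF r]] K(1) in auto)
    qed (rule has_integral_integrable[OF hi])
    also have "\<dots> = (K * s) ^ Suc k / fact (Suc k)"
      using integral_unique[OF hi] by simp
    finally show ?thesis .
  qed
  ultimately show ?case ..
qed auto

text \<open>
  Picard iteration gives power series in \<open>-\<mu>\<close>: \<open>robin_series 1 \<mu>\<close> is the solution \<open>u\<close> with flux
  \<open>robin_series 0 \<mu>\<close>. Higher \<open>e\<close> only serve the recursion of the derivatives.
\<close>
definition robin_series :: "nat \<Rightarrow> real \<Rightarrow> real \<Rightarrow> real" where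
  "robin_series e \<mu> s = (\<Sum>n. (- \<mu>) ^ n * iterated_integral m (2 * n + e) s)"

text \<open>
  A bound uniform in \<open>\<mu>\<close> and \<open>s\<close>, so that the Weierstrass test yields joint continuity.
\<close>
lemma robin_series_majorant:
  assumes R: "R \<ge> 0" and a: "a \<ge> 0"
  obtains M where "summable M"
    "\<And>n \<mu> s. \<bar>\<mu>\<bar> \<le> R \<Longrightarrow> s \<in> {0..a} \<Longrightarrow> norm ((- \<mu>) ^ n * iterated_integral m (2 * n + e) s) \<le> M n"
proof -
  obtain K where K: "K > 0" "\<And>k s. s \<in> {0..a} \<Longrightarrow> wt k s \<le> K" using wt_bound[of a] by metis
  define q where "q = K * a"
  define M where "M n = q ^ e * ((R * q\<^sup>2) ^ n /\<^sub>R fact n)" for n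
  show ?thesis
  proof (rule that[of M])
    show "summable M" unfolding M_def by (intro summable_mult summable_exp_generic)
    fix n \<mu> s assume \<mu>: "\<bar>\<mu>\<bar> \<le> R" and s: "s \<in> {0..a}"
    define h where "h = iterated_integral m (2 * n + e) s"
    have h: "0 \<le> h" "h \<le> (K * s) ^ (2 * n + e) / fact (2 * n + e)"
      using iterated_integral_bounds[OF K s] by (auto simp: h_def)
    note h(2)
    also have "\<dots> \<le> q ^ (2 * n + e) / fact n"
      unfolding q_def using s K by (intro frac_le power_mono mult_left_mono fact_mono) auto
    finally have "\<bar>\<mu>\<bar> ^ n * h \<le> R ^ n * (q ^ (2 * n + e) / fact n)"
      using \<mu> h(1) R by (intro mult_mono power_mono) auto
    also have "q ^ (2 * n + e) = q ^ e * (q\<^sup>2) ^ n"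
      by (simp add: power_add power_mult)
    also have "R ^ n * (q ^ e * (q\<^sup>2) ^ n / fact n) = M n"
      unfolding M_def power_mult_distrib[of R] by (simp add: divide_inverse mult_ac)
    finally show "norm ((- \<mu>) ^ n * iterated_integral m (2 * n + e) s) \<le> M n"
      using h(1) by (simp add: abs_mult power_abs h_def)
  qed
qed

lemma robin_series_uniform_limit:
  assumes "R \<ge> 0" "a \<ge> 0"
  shows "uniform_limit ({-R..R} \<times> {0..a}) (\<lambda>n (\<mu>, s). \<Sum>i<n. (- \<mu>) ^ i * iterated_integral m (2 * i + e) s)
           (\<lambda>(\<mu>, s). robin_series e \<mu> s) sequentially"
proof -
  obtain M where M: "summable M"
    "\<And>n \<mu> s. \<bar>\<mu>\<bar> \<le> R \<Longrightarrow> s \<in> {0..a} \<Longrightarrow> norm ((- \<mu>) ^ n * iterated_integral m (2 * n + e) s) \<le> M n"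
    using robin_series_majorant[OF assms] by metis
  show ?thesis
    unfolding robin_series_def case_prod_beta
    by (rule Weierstrass_m_test[OF _ M(1)]) (rule M(2); auto)
qed

lemma robin_series_continuous: "continuous_on ({-R..R} \<times> {0..a}) (\<lambda>(\<mu>, s). robin_series e \<mu> s)"
proof (cases "R \<ge> 0 \<and> a \<ge> 0")
  case True
  have "continuous_on ({-R..R} \<times> {0..a}) (\<lambda>(\<mu>, s). \<Sum>i<n. (- \<mu>) ^ i * iterated_integral m (2 * i + e) s)" for n
    unfolding case_prod_beta
    by (intro continuous_intros continuous_on_compose2[OF continuous_on_iter_term[of a]]) auto
  then show ?thesis
    using True by (intro uniform_limit_theorem[OF _ robin_series_uniform_limit]) (auto intro: always_eventually)
next
  case False
  then have "{-R..R} \<times> {0..a} = {}" by auto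
  then show ?thesis by (simp only: continuous_on_empty)
qed

lemma robin_series_slice:
  assumes "a \<ge> 0"
  shows "uniform_limit {0..a} (\<lambda>n s. \<Sum>i<n. (- \<mu>) ^ i * iterated_integral m (2 * i + e) s) (robin_series e \<mu>) sequentially"
proof -
  have "uniform_limit {0..a} (\<lambda>n s. (\<lambda>(\<mu>, s). \<Sum>i<n. (- \<mu>) ^ i * iterated_integral m (2 * i + e) s) (\<mu>, s))
     (\<lambda>s. (\<lambda>(\<mu>, s). robin_series e \<mu> s) (\<mu>, s)) sequentially"
    by (rule uniform_limit_compose'[OF robin_series_uniform_limit[of "\<bar>\<mu>\<bar>" a]]) (use assms in auto)
  then show ?thesis by simp
qed

lemma robin_series_sums:
  assumes "s \<ge> 0"
  shows "(\<lambda>n. (- \<mu>) ^ n * iterated_integral m (2 * n + e) s) sums robin_series e \<mu> s"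
  using tendsto_uniform_limitI[OF robin_series_slice[OF assms, of \<mu> e], of s] assms by (simp add: sums_def)

lemma robin_series_deriv:
  assumes s: "s \<ge> 0"
  shows "(robin_series (Suc e) \<mu> has_real_derivative wt e s * robin_series e \<mu> s) (at s within {0..})"
proof -
  let ?S = "{0..s+1}"
  have ul: "uniform_limit ?S (\<lambda>n s. wt e s * (\<Sum>i<n. (- \<mu>) ^ i * iterated_integral m (2 * i + e) s)) (\<lambda>s. wt e s * robin_series e \<mu> s) sequentially"
  proof (rule uniform_lim_mult)
    show "uniform_limit ?S (\<lambda>n. wt e) (wt e) sequentially" by (rule uniform_limit_const)
    show "uniform_limit ?S (\<lambda>n s. \<Sum>i<n. (- \<mu>) ^ i * iterated_integral m (2 * i + e) s) (robin_series e \<mu>) sequentially"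
      using s by (intro robin_series_slice) simp
    have "continuous_on ?S (\<lambda>s. (\<lambda>(\<mu>, s). robin_series e \<mu> s) (\<mu>, s))"
      by (rule continuous_on_compose2[OF robin_series_continuous[of "\<bar>\<mu>\<bar>" "s + 1"]])
         (auto intro!: continuous_intros)
    then show "bounded (robin_series e \<mu> ` ?S)"
      by (intro compact_imp_bounded compact_continuous_image) auto
    show "bounded (wt e ` ?S)"
      by (intro compact_imp_bounded compact_continuous_image continuous_on_wt) auto
  qed
  have "\<exists>g. \<forall>x\<in>?S. (\<lambda>n. (- \<mu>) ^ n * iterated_integral m (2 * n + Suc e) x) sums g x \<and>
        (g has_real_derivative wt e x * robin_series e \<mu> x) (at x within ?S)"
  proof (rule has_field_derivative_series)
    show "uniform_limit ?S (\<lambda>n s. \<Sum>i<n. (- \<mu>) ^ i * (wt e s * iterated_integral m (2 * i + e) s)) (\<lambda>s. wt e s * robin_series e \<mu> s) sequentially"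
      using ul by (simp add: sum_distrib_left mult_ac)
    show "((\<lambda>x. (- \<mu>) ^ n * iterated_integral m (2 * n + Suc e) x) has_real_derivative
        (- \<mu>) ^ n * (wt e x * iterated_integral m (2 * n + e) x)) (at x within ?S)" if "x \<in> ?S" for n x
      using DERIV_cmult[OF iterated_integral_deriv[OF that, of "2 * n + e"], of "(- \<mu>) ^ n"] by (simp add: wt_def)
    show "summable (\<lambda>n. (- \<mu>) ^ n * iterated_integral m (2 * n + Suc e) 0)"
      using robin_series_sums by (rule sums_summable) simp
  qed (use s in auto)
  then obtain g where g: "\<And>x. x \<in> ?S \<Longrightarrow> (\<lambda>n. (- \<mu>) ^ n * iterated_integral m (2 * n + Suc e) x) sums g x"
      "\<And>x. x \<in> ?S \<Longrightarrow> (g has_real_derivative wt e x * robin_series e \<mu> x) (at x within ?S)"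
    by blast
  have eq: "g x = robin_series (Suc e) \<mu> x" if "x \<in> ?S" for x
    using sums_unique2[OF g(1)[OF that] robin_series_sums] that by auto
  have "(robin_series (Suc e) \<mu> has_real_derivative wt e s * robin_series e \<mu> s) (at s within ?S)"
    using g(2)[of s] s eq has_real_derivative_transform[of s ?S "robin_series (Suc e) \<mu>" g] by auto
  moreover have "at s within ?S = at s within {0..}"
    by (rule at_within_nhd[of s "{..<s+1}"]) (use s in auto)
  ultimately show ?thesis by simp
qed

lemma robin_series_zero_eq: "s \<ge> 0 \<Longrightarrow> robin_series 0 \<mu> s = 1 - \<mu> * robin_series 2 \<mu> s"
proof -
  assume s: "s \<ge> 0"
  have "(\<lambda>n. - \<mu> * ((- \<mu>) ^ n * iterated_integral m (2 * n + 2) s)) sums (- \<mu> * robin_series 2 \<mu> s)"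
    by (intro sums_mult robin_series_sums s)
  then have "(\<lambda>n. (- \<mu>) ^ Suc n * iterated_integral m (2 * Suc n + 0) s) sums (- \<mu> * robin_series 2 \<mu> s)"
    by (simp add: mult.assoc)
  from sums_unique2[OF sums_Suc[OF this] robin_series_sums[OF s]] show ?thesis by simp
qed

lemma robin_flow_robin_series: "robin_flow m \<mu> (robin_series 1 \<mu>) (robin_series 0 \<mu>)"
proof -
  have init: "robin_series (Suc e) \<mu> 0 = 0" for e
    by (simp add: robin_series_def iterated_integral_Suc)
  have "(robin_series 1 \<mu> has_real_derivative robin_series 0 \<mu> s / (m s)\<^sup>2) (at s within {0..})" if "s \<ge> 0" for s
    using robin_series_deriv[OF that, of 0 \<mu>] by (simp add: wt_def)
  moreover have "(robin_series 0 \<mu> has_real_derivative - (\<mu> * ((m s)\<^sup>2 * robin_series 1 \<mu> s))) (at s within {0..})" if s: "s \<ge> 0" for s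
  proof -
    have "((\<lambda>s. 1 - \<mu> * robin_series 2 \<mu> s) has_real_derivative 0 - \<mu> * (wt 1 s * robin_series 1 \<mu> s)) (at s within {0..})"
      using robin_series_deriv[OF s, of 1 \<mu>]
      by (intro DERIV_diff DERIV_const DERIV_cmult) (simp add: numeral_2_eq_2)
    then show ?thesis
      using s robin_series_zero_eq by (intro has_real_derivative_transform[of s "{0..}" "robin_series 0 \<mu>"]) (auto simp: wt_def)
  qed
  moreover have "robin_series 1 \<mu> 0 = 0" "robin_series 0 \<mu> 0 = 1"
    using init[of 0] init[of 1] robin_series_zero_eq[of 0 \<mu>] by (simp_all add: numeral_2_eq_2)
  ultimately show ?thesis by (simp add: robin_flow_def)
qed

end

lemma MVT_interior:
  fixes f f' :: "real \<Rightarrow> real"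
  assumes "a < b" "continuous_on {a..b} f"
    and "\<And>x. a < x \<Longrightarrow> x < b \<Longrightarrow> (f has_real_derivative f' x) (at x)"
  obtains z where "a < z" "z < b" "f b - f a = (b - a) * f' z"
proof -
  obtain l z where "a < z" "z < b" "(f has_real_derivative l) (at z)" "f b - f a = (b - a) * l"
    using MVT[OF assms(1,2)] assms(3) real_differentiable_def by blast
  then show ?thesis using that assms(3) DERIV_unique by metis
qed

section \<open>Shooting for the Robin condition\<close>

lemma robin_flow_pos:
  assumes m: "\<And>s. s \<ge> 0 \<Longrightarrow> m s > 0" and f: "robin_flow m \<mu> u p"
    and p: "\<And>s. 0 \<le> s \<Longrightarrow> s \<le> a \<Longrightarrow> p s \<ge> 0" and s: "0 < s" "s \<le> a"
  shows "u s > 0"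
proof -
  note D = robin_flowD[OF f]
  have "\<exists>d>0. d \<le> s \<and> (\<forall>r\<in>{0..d}. p r > 0)"
  proof -
    have "\<forall>\<^sub>F r in at 0 within {0..}. p r > 0"
      using D(2)[of 0] D(4) by (intro order_tendstoD(1)[of p "p 0"]) (auto dest: DERIV_continuous simp: continuous_within)
    then obtain d where "d > 0" "\<And>r. 0 \<le> r \<Longrightarrow> r \<noteq> 0 \<Longrightarrow> r < d \<Longrightarrow> p r > 0"
      unfolding eventually_at by (auto simp: dist_real_def)
    then have "\<forall>r\<in>{0..min (d/2) s}. p r > 0" using D(4) by (metis atLeastAtMost_iff field_sum_of_halves less_add_same_cancel1 half_gt_zero le_less_trans min.boundedE order_less_le_trans order_le_less)
    then show ?thesis using s \<open>d > 0\<close> by (intro exI[of _ "min (d/2) s"]) auto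
  qed
  then obtain d where d: "d > 0" "d \<le> s" "\<And>r. r \<in> {0..d} \<Longrightarrow> p r > 0" by blast
  have "u 0 < u d"
  proof (rule DERIV_pos_imp_increasing_open[OF d(1)])
    fix r assume "0 < r" "r < d"
    then show "\<exists>y. (u has_real_derivative y) (at r) \<and> y > 0"
      using D(5)[of r] d(3)[of r] m[of r] by (intro exI[of _ "p r / (m r)\<^sup>2"]) auto
  qed (use D(7) in auto)
  also have "u d \<le> u s"
  proof (rule DERIV_nonneg_imp_increasing_open[OF d(2)])
    fix r assume "d < r" "r < s"
    then show "\<exists>y. (u has_real_derivative y) (at r) \<and> y \<ge> 0"
      using D(5)[of r] d(1) p[of r] s by (intro exI[of _ "p r / (m r)\<^sup>2"]) auto
  qed (use D(7) d in auto)
  finally show ?thesis using D(3) by simp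
qed

text \<open>
  The Wronskian \<open>q u - v p\<close> is constant and vanishes at \<open>0\<close>.
\<close>
lemma robin_flow_proportional:
  assumes m: "\<And>s. s \<ge> 0 \<Longrightarrow> m s > 0"
    and f: "robin_flow m \<mu> u p" and g: "robin_flow m \<mu> v q"
    and u: "\<And>s. 0 < s \<Longrightarrow> s \<le> a \<Longrightarrow> u s > 0" and a: "a > 0"
  obtains c where "c > 0" "\<And>s. 0 \<le> s \<Longrightarrow> s \<le> a \<Longrightarrow> v s = c * u s"
    "\<And>s. 0 \<le> s \<Longrightarrow> s \<le> a \<Longrightarrow> q s = c * p s"
proof -
  note D = robin_flowD[OF f] and E = robin_flowD[OF g]
  have W: "q s * u s - v s * p s = 0" if s: "s \<ge> 0" for s
  proof (cases "s = 0")
    case False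
    have "q s * u s - v s * p s = q 0 * u 0 - v 0 * p 0"
    proof (rule DERIV_isconst_end[of 0 s])
      show "continuous_on {0..s} (\<lambda>s. q s * u s - v s * p s)"
        by (intro continuous_intros D E) auto
      fix r assume r: "0 < r" "r < s"
      show "((\<lambda>s. q s * u s - v s * p s) has_real_derivative 0) (at r)"
        by (rule DERIV_cong[OF DERIV_diff[OF DERIV_mult[OF E(6) D(5)] DERIV_mult[OF E(5) D(6)]]])
           (use r m[of r] in \<open>auto simp: field_simps\<close>)
    qed (use s False in auto)
    then show ?thesis using D(3) E(3) by simp
  qed (use D(3) E(3) in simp)
  define c where "c = v a / u a"
  have v: "v s = c * u s" if s: "0 < s" "s \<le> a" for s
  proof (cases "s = a")
    case False
    have "v a / u a = v s / u s"
    proof (rule DERIV_isconst_end[of s a])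
      show "continuous_on {s..a} (\<lambda>s. v s / u s)"
      proof (intro continuous_intros D E ballI)
        show "u r \<noteq> 0" if "r \<in> {s..a}" for r using u[of r] s that by auto
      qed (use s in auto)
      fix r assume r: "s < r" "r < a"
      have "u r > 0" using u[of r] r s by auto
      show "((\<lambda>s. v s / u s) has_real_derivative 0) (at r)"
        by (rule DERIV_cong[OF DERIV_divide[OF E(5) D(5)]])
           (use r s \<open>u r > 0\<close> W[of r] m[of r] in \<open>auto simp: field_simps\<close>)
    qed (use s False in auto)
    then show ?thesis using u[of s] s by (simp add: c_def)
  qed (use u[of a] a in \<open>simp add: c_def\<close>)
  have q: "q s = c * p s" if s: "0 < s" "s \<le> a" for s
    using W[of s] v[OF s] u[OF s] s by (auto simp: algebra_simps)
  have q0: "q 0 = c * p 0"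
  proof -
    have c: "continuous_on {0..a} (\<lambda>s. q s - c * p s)" by (intro continuous_intros D E) auto
    then have "((\<lambda>s. q s - c * p s) \<longlongrightarrow> q 0 - c * p 0) (at 0 within {0..a})"
      using a by (auto simp: continuous_on_def)
    moreover have "((\<lambda>s. q s - c * p s) \<longlongrightarrow> 0) (at 0 within {0..a})"
      by (rule tendsto_eventually) (auto simp: eventually_at_filter q)
    moreover have "at 0 within {0..a} \<noteq> bot"
      using a by (simp add: trivial_limit_within)
    ultimately show ?thesis using tendsto_unique by fastforce
  qed
  moreover have "c > 0" using q0 D(4) E(4) zero_less_mult_pos2 by (metis)
  ultimately show ?thesis using that[of c] v q D(3) E(3)
    by (metis less_eq_real_def mult_zero_right)
qed

text \<open>
  If the flux stays nonnegative, then \<open>u\<close> increases and \<open>p\<close> decreases. On the two halves of \<open>[0,a]\<close> the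
  mean value theorem gives \<open>u(a/2) \<ge> c\<^sub>1 p(a/2)\<close> and \<open>p(a/2) \<ge> \<mu> c\<^sub>2 u(a/2)\<close> with constants that do not depend
  on \<open>\<mu>\<close>.
\<close>
lemma robin_flow_eigenvalue_bound:
  assumes cm: "continuous_on {0..} m" and m: "\<And>s. s \<ge> 0 \<Longrightarrow> m s > 0" and a: "a > 0"
  obtains L where "\<And>\<mu> u p. robin_flow m \<mu> u p \<Longrightarrow> \<mu> \<ge> 0 \<Longrightarrow>
      (\<And>s. 0 \<le> s \<Longrightarrow> s \<le> a \<Longrightarrow> p s \<ge> 0) \<Longrightarrow> \<mu> \<le> L"
proof -
  have cm': "continuous_on {0..a} m" using cm by (rule continuous_on_subset) auto
  obtain s1 where s1: "s1 \<in> {0..a}" "\<And>s. s \<in> {0..a} \<Longrightarrow> m s1 \<le> m s"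
    using continuous_attains_inf[OF _ _ cm'] a by auto
  obtain s2 where s2: "s2 \<in> {0..a}" "\<And>s. s \<in> {0..a} \<Longrightarrow> m s \<le> m s2"
    using continuous_attains_sup[OF _ _ cm'] a by auto
  define k1 k2 where "k1 = (m s1)\<^sup>2" and "k2 = (m s2)\<^sup>2"
  have k0: "k1 > 0" "k2 > 0" using m[of s1] m[of s2] s1 s2 by (auto simp: k1_def k2_def)
  have k: "k1 \<le> (m s)\<^sup>2" "(m s)\<^sup>2 \<le> k2" if "s \<in> {0..a}" for s
    using s1(2)[OF that] s2(2)[OF that] m[of s1] m[of s] s1(1) that by (auto simp: k1_def k2_def intro!: power_mono)
  show ?thesis
  proof (rule that[of "4 * k2 / (k1 * a\<^sup>2)"])
    fix \<mu> u p assume f: "robin_flow m \<mu> u p" and \<mu>: "\<mu> \<ge> 0"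
      and p: "\<And>s. 0 \<le> s \<Longrightarrow> s \<le> a \<Longrightarrow> p s \<ge> 0"
    note D = robin_flowD[OF f]
    have up: "u s > 0" if "0 < s" "s \<le> a" for s
      using robin_flow_pos[OF m f, of a s] p that by blast
    let ?h = "a / 2"
    have h: "0 < ?h" "?h < a" using a by auto
    have anti: "p s \<le> p r" if "0 \<le> r" "r \<le> s" "s \<le> a" for r s
    proof (rule DERIV_nonpos_imp_decreasing_open[OF that(2)])
      fix x assume x: "r < x" "x < s"
      then have "0 \<le> \<mu> * ((m x)\<^sup>2 * u x)"
        using up[of x] \<mu> that by (intro mult_nonneg_nonneg) auto
      then show "\<exists>y. (p has_real_derivative y) (at x) \<and> y \<le> 0"
        using D(6)[of x] x that by (intro exI[of _ "- (\<mu> * ((m x)\<^sup>2 * u x))"]) auto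
    qed (use D(8) that in auto)
    have mono: "u r \<le> u s" if "0 \<le> r" "r \<le> s" "s \<le> a" for r s
    proof (rule DERIV_nonneg_imp_increasing_open[OF that(2)])
      fix x assume x: "r < x" "x < s"
      then show "\<exists>y. (u has_real_derivative y) (at x) \<and> y \<ge> 0"
        using D(5)[of x] p[of x] that by (intro exI[of _ "p x / (m x)\<^sup>2"]) auto
    qed (use D(7) that in auto)
    obtain x where x: "0 < x" "x < ?h" "u ?h - u 0 = (?h - 0) * (p x / (m x)\<^sup>2)"
      by (rule MVT_interior[of 0 ?h u "\<lambda>x. p x / (m x)\<^sup>2"]) (use h D(5,7) in auto)
    have 1: "u ?h \<ge> ?h * (p ?h / k2)"
    proof -
      have "p ?h / k2 \<le> p x / (m x)\<^sup>2"
        using anti[of x ?h] p[of ?h] p[of x] k[of x] m[of x] x h k0 by (intro frac_le) auto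
      then have "?h * (p ?h / k2) \<le> ?h * (p x / (m x)\<^sup>2)" using h by (intro mult_left_mono) auto
      also have "\<dots> = u ?h" using x(3) D(3) by (simp only: diff_zero)
      finally show ?thesis .
    qed
    obtain y where y: "?h < y" "y < a" "p a - p ?h = (a - ?h) * (- (\<mu> * ((m y)\<^sup>2 * u y)))"
      by (rule MVT_interior[of ?h a p "\<lambda>x. - (\<mu> * ((m x)\<^sup>2 * u x))"]) (use h D(6,8) in auto)
    have 2: "p ?h \<ge> ?h * (\<mu> * (k1 * u ?h))"
    proof -
      have "k1 * u ?h \<le> (m y)\<^sup>2 * u y"
        using mono[of ?h y] up[of ?h] y h k[of y] k0 by (intro mult_mono) auto
      then have "\<mu> * (k1 * u ?h) \<le> \<mu> * ((m y)\<^sup>2 * u y)" using \<mu> by (rule mult_left_mono)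
      then have "?h * (\<mu> * (k1 * u ?h)) \<le> ?h * (\<mu> * ((m y)\<^sup>2 * u y))" using h by (intro mult_left_mono[of _ _ ?h]) auto
      moreover have "p ?h = p a + ?h * (\<mu> * ((m y)\<^sup>2 * u y))" using y(3) by (simp add: field_simps)
      ultimately show ?thesis using p[of a] a by linarith
    qed
    have "?h * (?h * (\<mu> * (k1 * u ?h)) / k2) \<le> ?h * (p ?h / k2)"
      using 2 h k0 by (intro mult_left_mono divide_right_mono) auto
    then have "(?h * ?h * \<mu> * k1 / k2) * u ?h \<le> 1 * u ?h" using 1 by (simp add: mult_ac)
    then have "?h * ?h * \<mu> * k1 / k2 \<le> 1"
      using up[of ?h] h by (subst (asm) mult_le_cancel_right_pos) auto
    then show "\<mu> \<le> 4 * k2 / (k1 * a\<^sup>2)"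
      using k0 a by (simp add: field_simps power2_eq_square)
  qed
qed

text \<open>
  Let \<open>\<sigma>\<close> be the largest parameter up to which the flux is nonnegative on \<open>[0,a]\<close>. It is finite, and since the flux
  is decreasing in \<open>s\<close> it can only be lost at \<open>s = a\<close>; so \<open>P \<sigma> a = 0\<close>, and
  \<open>F(\<mu>) = u'(a) - u(a)\<close> is negative at \<open>\<sigma>\<close>. It is positive at \<open>1\<close>. Following the flux rather than \<open>u\<close>
  avoids the zero of \<open>u\<close> at \<open>s = 0\<close>.
\<close>
lemma robin_shooting:
  assumes cm: "continuous_on {0..} m" and m: "\<And>s. s \<ge> 0 \<Longrightarrow> m s > 0" and a: "a > 0"
    and f: "robin_flow m 1 u p" and up: "\<And>s. 0 < s \<Longrightarrow> s \<le> a \<Longrightarrow> 0 < u s \<and> u s < p s / (m s)\<^sup>2"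
  obtains \<mu> v q where "\<mu> > 1" "robin_flow m \<mu> v q"
    "\<And>s. 0 < s \<Longrightarrow> s \<le> a \<Longrightarrow> v s > 0" "q a / (m a)\<^sup>2 = v a"
proof -
  define U P where "U = robin_series m 1" and "P = robin_series m 0"
  have rf: "robin_flow m \<mu> (U \<mu>) (P \<mu>)" for \<mu>
    unfolding U_def P_def using robin_flow_robin_series[OF cm m] by simp
  have jU: "continuous_on ({-R..R} \<times> {0..a}) (\<lambda>(\<mu>, s). U \<mu> s)"
    and jP: "continuous_on ({-R..R} \<times> {0..a}) (\<lambda>(\<mu>, s). P \<mu> s)" for R
    unfolding U_def P_def using robin_series_continuous[OF cm m] by simp_all
  have c\<mu>: "continuous_on {-R..R} (\<lambda>\<mu>. U \<mu> s)" "continuous_on {-R..R} (\<lambda>\<mu>. P \<mu> s)" if "s \<in> {0..a}" for R s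
  proof -
    have c: "continuous_on {-R..R} (\<lambda>\<mu>. (\<mu>, s))" by (intro continuous_intros)
    have i: "(\<lambda>\<mu>. (\<mu>, s)) ` {-R..R} \<subseteq> {-R..R} \<times> {0..a}" using that by auto
    show "continuous_on {-R..R} (\<lambda>\<mu>. U \<mu> s)" "continuous_on {-R..R} (\<lambda>\<mu>. P \<mu> s)"
      using continuous_on_compose2[OF jU c i] continuous_on_compose2[OF jP c i] by simp_all
  qed
  define F where "F \<mu> = P \<mu> a / (m a)\<^sup>2 - U \<mu> a" for \<mu>
  have ma: "m a > 0" using m a by simp
  obtain c where c: "c > 0" "\<And>s. 0 \<le> s \<Longrightarrow> s \<le> a \<Longrightarrow> U 1 s = c * u s"
    "\<And>s. 0 \<le> s \<Longrightarrow> s \<le> a \<Longrightarrow> P 1 s = c * p s"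
    using robin_flow_proportional[OF m f rf _ a] up by metis
  have pp: "p s > 0" if "0 \<le> s" "s \<le> a" for s
  proof (cases "s = 0")
    case False
    then have "0 < p s / (m s)\<^sup>2" using up[of s] that by auto
    then show ?thesis using m[of s] that by (simp add: zero_less_divide_iff)
  qed (use robin_flowD(4)[OF f] in simp)
  have F1: "F 1 > 0"
  proof -
    have "F 1 = c * (p a / (m a)\<^sup>2 - u a)" using c(2,3)[of a] a by (simp add: F_def right_diff_distrib)
    then show ?thesis using up[of a] a c(1) by simp
  qed
  define M where "M = {\<mu>. \<mu> \<ge> 1 \<and> (\<forall>\<nu>\<in>{1..\<mu>}. \<forall>s\<in>{0..a}. P \<nu> s \<ge> 0)}"
  have M1: "1 \<in> M"
    unfolding M_def using c(1,3) pp by (auto intro!: mult_nonneg_nonneg less_imp_le)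
  obtain L where L: "\<And>\<mu> u p. robin_flow m \<mu> u p \<Longrightarrow> \<mu> \<ge> 0 \<Longrightarrow>
      (\<And>s. 0 \<le> s \<Longrightarrow> s \<le> a \<Longrightarrow> p s \<ge> 0) \<Longrightarrow> \<mu> \<le> L"
    using robin_flow_eigenvalue_bound[OF cm m a] by blast
  have M_le: "\<mu> \<le> L" if "\<mu> \<in> M" for \<mu>
    using that by (intro L[OF rf]) (auto simp: M_def)
  have bdd: "bdd_above M" using M_le by (rule bdd_aboveI)
  define \<sigma> where "\<sigma> = Sup M"
  have \<sigma>1: "\<sigma> \<ge> 1" unfolding \<sigma>_def by (rule cSup_upper[OF M1 bdd])
  have below: "P \<nu> s \<ge> 0" if \<nu>: "1 \<le> \<nu>" "\<nu> < \<sigma>" and s: "s \<in> {0..a}" for \<nu> s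
  proof -
    obtain \<mu> where "\<mu> \<in> M" "\<nu> < \<mu>"
      using less_cSupD[of M \<nu>] M1 \<nu>(2) by (auto simp: \<sigma>_def)
    then show ?thesis using \<nu> s by (auto simp: M_def)
  qed
  \<comment> \<open>The parameter \<open>\<sigma>\<close> itself is reached by continuity in \<open>\<mu>\<close> at fixed \<open>s\<close>.\<close>
  have at\<sigma>: "P \<sigma> s \<ge> 0" if s: "s \<in> {0..a}" for s
  proof (cases "\<sigma> = 1")
    case True
    have "\<forall>\<nu>\<in>{1..1}. \<forall>s\<in>{0..a}. P \<nu> s \<ge> 0" using M1 unfolding M_def by blast
    then show ?thesis using s True by simp
  next
    case False
    let ?A = "{-\<sigma>..\<sigma>} \<inter> (\<lambda>\<nu>. P \<nu> s) -` {0..}"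
    have "closed ?A"
      by (rule continuous_closed_preimage[OF c\<mu>(2)[OF s]]) auto
    moreover have "{1..<\<sigma>} \<subseteq> ?A" using below s by auto
    ultimately have "closure {1..<\<sigma>} \<subseteq> ?A" by (rule closure_minimal[rotated])
    moreover have "\<sigma> \<in> closure {1..<\<sigma>}" using False \<sigma>1 by simp
    ultimately show ?thesis by blast
  qed
  have P\<nu>: "P \<nu> s \<ge> 0" if "1 \<le> \<nu>" "\<nu> \<le> \<sigma>" "s \<in> {0..a}" for \<nu> s
    using below[of \<nu> s] at\<sigma>[of s] that by (cases "\<nu> = \<sigma>") auto
  have U\<nu>: "U \<nu> s > 0" if "1 \<le> \<nu>" "\<nu> \<le> \<sigma>" "0 < s" "s \<le> a" for \<nu> s
    by (rule robin_flow_pos[where a = a, OF m rf]) (use P\<nu> that in auto)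
  \<comment> \<open>Otherwise the flux is bounded below on \<open>[0,a]\<close> and stays positive a little beyond \<open>\<sigma>\<close>.\<close>
  have Pa: "P \<sigma> a = 0"
  proof (rule ccontr)
    assume "P \<sigma> a \<noteq> 0"
    then have pos: "P \<sigma> a > 0" using at\<sigma>[of a] a by auto
    note D = robin_flowD[OF rf[of \<sigma>]]
    have ge: "P \<sigma> s \<ge> P \<sigma> a" if "s \<in> {0..a}" for s
    proof (rule DERIV_nonpos_imp_decreasing_open[where f = "P \<sigma>" and a = s and b = a])
      fix x assume x: "s < x" "x < a"
      then have "0 \<le> \<sigma> * ((m x)\<^sup>2 * U \<sigma> x)"
        using U\<nu>[of \<sigma> x] \<sigma>1 that by (intro mult_nonneg_nonneg) auto
      then show "\<exists>y. (P \<sigma> has_real_derivative y) (at x) \<and> y \<le> 0"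
        using D(6)[of x] x that by (intro exI[of _ "- (\<sigma> * ((m x)\<^sup>2 * U \<sigma> x))"]) auto
    qed (use D(8) that in auto)
    have "uniformly_continuous_on ({-(\<sigma>+1)..\<sigma>+1} \<times> {0..a}) (\<lambda>(\<mu>, s). P \<mu> s)"
      by (rule compact_uniformly_continuous[OF jP]) (intro compact_Times compact_Icc)
    then obtain d where d: "d > 0" and ud: "\<And>x y. x \<in> {-(\<sigma>+1)..\<sigma>+1} \<times> {0..a} \<Longrightarrow>
        y \<in> {-(\<sigma>+1)..\<sigma>+1} \<times> {0..a} \<Longrightarrow> dist y x < d \<Longrightarrow>
        dist ((\<lambda>(\<mu>, s). P \<mu> s) y) ((\<lambda>(\<mu>, s). P \<mu> s) x) < P \<sigma> a"
      unfolding uniformly_continuous_on_def using pos by metis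
    define e where "e = min (d / 2) 1"
    have e: "e > 0" "e < d" "e \<le> 1" using d by (auto simp: e_def min_def)
    have "\<sigma> + e \<in> M"
      unfolding M_def
    proof (intro CollectI conjI ballI)
      fix \<nu> s assume \<nu>: "\<nu> \<in> {1..\<sigma> + e}" and s: "s \<in> {0..a}"
      show "P \<nu> s \<ge> 0"
      proof (cases "\<nu> \<le> \<sigma>")
        case False
        have "dist (P \<nu> s) (P \<sigma> s) < P \<sigma> a"
          using ud[of "(\<sigma>, s)" "(\<nu>, s)"] \<nu> s e \<sigma>1 False by (auto simp: dist_Pair_Pair dist_real_def)
        then show ?thesis using ge[OF s] by (auto simp: dist_real_def)
      qed (use P\<nu> \<nu> s in auto)
    qed (use \<sigma>1 e in auto)
    then have "\<sigma> + e \<le> \<sigma>" unfolding \<sigma>_def using bdd by (intro cSup_upper)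
    then show False using e by simp
  qed
  have F\<sigma>: "F \<sigma> < 0" using Pa U\<nu>[of \<sigma> a] \<sigma>1 a by (simp add: F_def)
  have "continuous_on {-\<sigma>..\<sigma>} F"
    unfolding F_def using c\<mu>[of a \<sigma>] a ma by (intro continuous_intros) auto
  then have "continuous_on {1..\<sigma>} F" by (rule continuous_on_subset) auto
  then obtain \<mu> where \<mu>: "1 \<le> \<mu>" "\<mu> \<le> \<sigma>" "F \<mu> = 0"
    using IVT2'[of F \<sigma> 0 1] F1 F\<sigma> \<sigma>1 by auto
  show ?thesis
  proof (rule that[of \<mu> "U \<mu>" "P \<mu>"])
    show "\<mu> > 1" using \<mu> F1 by (cases "\<mu> = 1") auto
    show "P \<mu> a / (m a)\<^sup>2 = U \<mu> a" using \<mu>(3) by (simp add: F_def)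
  qed (use rf U\<nu> \<mu> in auto)
qed

section \<open>Test functions and weak derivatives on an interval\<close>

definition flat_exp :: "nat \<Rightarrow> real \<Rightarrow> real" where
  "flat_exp i y = (if y > 0 then (1 / y) ^ i * exp (- (1 / y)) else 0)"

lemma flat_exp_tendsto_0: "((flat_exp i) \<longlongrightarrow> 0) (at_right 0)"
proof -
  have "((\<lambda>y. (inverse y) ^ i / exp (inverse y)) \<longlongrightarrow> 0) (at_right (0::real))"
    by (rule filterlim_compose[OF tendsto_power_div_exp_0 filterlim_inverse_at_top_right])
  moreover have "\<forall>\<^sub>F y in at_right 0. (inverse y) ^ i / exp (inverse y) = flat_exp i y"
    by (auto simp: eventually_at_filter flat_exp_def exp_minus field_simps intro!: always_eventually)
  ultimately show ?thesis by (rule Lim_transform_eventually)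
qed

lemma flat_exp_deriv:
  "(flat_exp i has_real_derivative flat_exp (i + 2) y - real i * flat_exp (i + 1) y) (at y)"
proof -
  consider "y > 0" | "y < 0" | "y = 0" by linarith
  then show ?thesis
  proof cases
    case 1
    have "((\<lambda>y. (1 / y) ^ i * exp (- (1 / y))) has_real_derivative
        flat_exp (i + 2) y - real i * flat_exp (i + 1) y) (at y)"
    proof -
      have d1: "((\<lambda>y. 1 / y) has_real_derivative - (1 / y * (1 / y))) (at y)"
        using 1 by (auto intro!: derivative_eq_intros simp: power2_eq_square)
      have d2: "((\<lambda>y. exp (- (1 / y))) has_real_derivative exp (- (1 / y)) * (1 / y * (1 / y))) (at y)"
        by (rule DERIV_cong[OF DERIV_fun_exp[OF DERIV_minus[OF d1]]]) simp
      show ?thesis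
      proof (cases i)
        case 0
        then show ?thesis using d2 1 by (simp add: flat_exp_def power2_eq_square mult.commute)
      next
        case (Suc j)
        show ?thesis unfolding Suc
          by (rule DERIV_cong[OF DERIV_mult[OF DERIV_power_Suc[OF d1] d2]])
             (use 1 in \<open>simp add: flat_exp_def algebra_simps\<close>)
      qed
    qed
    then show ?thesis
      by (rule has_field_derivative_transform_within_open[where S = "{0<..}"])
         (use 1 in \<open>auto simp: flat_exp_def\<close>)
  next
    case 2
    have "((\<lambda>_. 0) has_real_derivative flat_exp (i + 2) y - real i * flat_exp (i + 1) y) (at y)"
      using 2 by (simp add: flat_exp_def)
    then show ?thesis
      by (rule has_field_derivative_transform_within_open[where S = "{..<0}"])
         (use 2 in \<open>auto simp: flat_exp_def\<close>)
  next
    case 3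
    have "((\<lambda>h. (flat_exp i (0 + h) - flat_exp i 0) / h) \<longlongrightarrow> 0) (at_right 0)"
      by (rule Lim_transform_eventually[OF flat_exp_tendsto_0[of "i + 1"]])
         (auto simp: eventually_at_filter flat_exp_def intro!: always_eventually)
    moreover have "((\<lambda>h. (flat_exp i (0 + h) - flat_exp i 0) / h) \<longlongrightarrow> 0) (at_left 0)"
      by (rule tendsto_eventually) (auto simp: eventually_at_filter flat_exp_def)
    ultimately have "(flat_exp i has_real_derivative 0) (at 0)"
      unfolding DERIV_def using filterlim_split_at by blast
    then show ?thesis using 3 by (simp add: flat_exp_def)
  qed
qed

text \<open>
  An algebra of functions that is closed under differentiation, so that its members are smooth.
  It contains polynomials and bumps, which is enough for all test functions below.
\<close>
inductive smooth_alg :: "(real \<Rightarrow> real) \<Rightarrow> bool" where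
  const: "smooth_alg (\<lambda>x. c)"
| ident: "smooth_alg (\<lambda>x. x)"
| flat: "smooth_alg (\<lambda>x. flat_exp i (\<alpha> * x + \<beta>))"
| add: "smooth_alg f \<Longrightarrow> smooth_alg g \<Longrightarrow> smooth_alg (\<lambda>x. f x + g x)"
| mult: "smooth_alg f \<Longrightarrow> smooth_alg g \<Longrightarrow> smooth_alg (\<lambda>x. f x * g x)"

lemma smooth_alg_deriv:
  "smooth_alg f \<Longrightarrow> \<exists>g. smooth_alg g \<and> (\<forall>x. (f has_real_derivative g x) (at x))"
proof (induction rule: smooth_alg.induct)
  case (const c)
  show ?case by (intro exI[of _ "\<lambda>_. 0"]) (auto intro: smooth_alg.const)
next
  case ident
  show ?case by (intro exI[of _ "\<lambda>_. 1"]) (auto intro: smooth_alg.const)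
next
  case (flat i \<alpha> \<beta>)
  let ?g = "\<lambda>x. \<alpha> * (flat_exp (i + 2) (\<alpha> * x + \<beta>) + (- real i) * flat_exp (i + 1) (\<alpha> * x + \<beta>))"
  have "smooth_alg ?g" by (intro smooth_alg.intros)
  moreover have "((\<lambda>x. flat_exp i (\<alpha> * x + \<beta>)) has_real_derivative ?g x) (at x)" for x
    by (rule DERIV_cong[OF DERIV_chain2[OF flat_exp_deriv]])
       (auto intro!: derivative_eq_intros simp: algebra_simps)
  ultimately show ?case by blast
next
  case (add f g)
  then obtain f' g' where *: "smooth_alg f'" "smooth_alg g'"
    "\<And>x. (f has_real_derivative f' x) (at x)" "\<And>x. (g has_real_derivative g' x) (at x)" by blast
  show ?case
    by (intro exI[of _ "\<lambda>x. f' x + g' x"] conjI allI smooth_alg.add DERIV_add *)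
next
  case (mult f g)
  then obtain f' g' where *: "smooth_alg f'" "smooth_alg g'"
    "\<And>x. (f has_real_derivative f' x) (at x)" "\<And>x. (g has_real_derivative g' x) (at x)" by blast
  have "smooth_alg (\<lambda>x. f' x * g x + g' x * f x)" by (intro smooth_alg.intros * mult.hyps)
  then show ?case using DERIV_mult[OF *(3,4)] by blast
qed

lemma smooth_alg_iterated_deriv:
  "smooth_alg f \<Longrightarrow> (deriv ^^ n) f field_differentiable (at x)"
proof (induction n arbitrary: f)
  case 0
  then show ?case using smooth_alg_deriv[OF 0] by (auto simp: field_differentiable_def)
next
  case (Suc n)
  obtain g where g: "smooth_alg g" "\<And>x. (f has_real_derivative g x) (at x)"
    using smooth_alg_deriv[OF Suc.prems] by blast
  then have "deriv f = g" by (auto intro: DERIV_imp_deriv)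
  then show ?case using Suc.IH[OF g(1)] by (simp add: funpow_Suc_right del: funpow.simps)
qed

lemma smooth_alg_continuous: "smooth_alg f \<Longrightarrow> continuous_on A f"
  by (metis DERIV_continuous continuous_at_imp_continuous_on smooth_alg_deriv)

lemma smooth_alg_test_function:
  assumes "smooth_alg f" "\<And>x. x \<notin> {c..d} \<Longrightarrow> f x = 0" "{c..d} \<subseteq> I"
  shows "test_function I f"
  unfolding test_function_def using assms smooth_alg_iterated_deriv by (auto intro!: exI[of _ "{c..d}"])

lemma smooth_alg_polynomial: "real_polynomial_function p \<Longrightarrow> smooth_alg p"
proof (induction rule: real_polynomial_function.induct)
  case (linear f)
  then obtain c where "f = (\<lambda>x. x * c)" unfolding real_bounded_linear by blast
  then show ?case by (simp add: smooth_alg.intros)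
qed (auto intro: smooth_alg.intros)

text \<open>
  Up to the argument \<open>n\<close> this is \<open>exp (-1/(x-c) - 1/(d-x))\<close> on \<open>(c,d)\<close>; the dilation by \<open>n\<close> makes the
  bumps converge pointwise to the indicator function of \<open>(c,d)\<close>.
\<close>
definition bump :: "real \<Rightarrow> real \<Rightarrow> nat \<Rightarrow> real \<Rightarrow> real" where
  "bump c d n x = flat_exp 0 (real n * x + (- real n * c)) * flat_exp 0 ((- real n) * x + real n * d)"

lemma smooth_alg_bump: "smooth_alg (bump c d n)"
  unfolding bump_def by (intro smooth_alg.intros)

lemma bump_outside: "x \<notin> {c<..<d} \<Longrightarrow> bump c d n x = 0"
proof -
  assume "x \<notin> {c<..<d}"
  then have "real n * (x - c) \<le> 0 \<or> real n * (d - x) \<le> 0" by (auto simp: mult_nonneg_nonpos)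
  then show ?thesis by (auto simp: bump_def flat_exp_def algebra_simps)
qed

lemma bump_bounds: "0 \<le> bump c d n x" "bump c d n x \<le> 1"
proof -
  have "0 \<le> flat_exp 0 y" "flat_exp 0 y \<le> 1" for y by (auto simp: flat_exp_def)
  then show "0 \<le> bump c d n x" "bump c d n x \<le> 1" by (auto simp: bump_def intro: mult_le_one)
qed

lemma bump_tendsto_1:
  assumes "x \<in> {c<..<d}"
  shows "(\<lambda>n. bump c d n x) \<longlonglongrightarrow> 1"
proof -
  have *: "(\<lambda>n. flat_exp 0 (real n * y)) \<longlonglongrightarrow> 1" if "y > 0" for y
  proof -
    have "(\<lambda>n. exp (- (1 / y * (1 / real n)))) \<longlonglongrightarrow> exp (- (1 / y * 0))"
      by (intro tendsto_intros lim_1_over_n)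
    moreover have "\<forall>\<^sub>F n in sequentially. exp (- (1 / y * (1 / real n))) = flat_exp 0 (real n * y)"
      using eventually_gt_at_top[of "0::nat"]
      by eventually_elim (use that in \<open>auto simp: flat_exp_def mult.commute\<close>)
    ultimately show ?thesis by (simp add: Lim_transform_eventually)
  qed
  have "(\<lambda>n. flat_exp 0 (real n * (x - c)) * flat_exp 0 (real n * (d - x))) \<longlonglongrightarrow> 1 * 1"
    using assms by (intro tendsto_mult *) auto
  then show ?thesis by (simp add: bump_def algebra_simps)
qed

lemma AE_lebesgue_on_interior: "AE x in lebesgue_on {c..d}. x \<in> {c<..<d::real}"
proof -
  have "negligible {c, d}" by simp
  then have "{c, d} \<in> null_sets lebesgue" by (simp add: negligible_iff_null_sets)
  then have "AE x in lebesgue. x \<notin> {c, d}" by (rule AE_not_in)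
  then have "AE x in lebesgue. x \<in> {c..d} \<longrightarrow> x \<in> {c<..<d}" by (rule eventually_mono) auto
  then show ?thesis by (subst AE_restrict_space_iff) auto
qed

lemma integrable_mult_continuous:
  assumes k: "integrable (lebesgue_on {c..d}) k" and \<psi>: "continuous_on {c..d::real} \<psi>"
  shows "integrable (lebesgue_on {c..d}) (\<lambda>x. k x * \<psi> x :: real)"
proof -
  obtain B where B: "\<And>s. s \<in> {c..d} \<Longrightarrow> norm (\<psi> s) \<le> B"
    by (rule continuous_Icc_bounded[OF \<psi>]) (rule that, assumption+)
  show ?thesis
  proof (rule Bochner_Integration.integrable_bound[OF integrable_mult_left[OF integrable_norm[OF k], of "\<bar>B\<bar>"]])
    have "\<psi> \<in> borel_measurable (lebesgue_on {c..d})"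
      by (rule continuous_imp_measurable_on_sets_lebesgue[OF \<psi>]) auto
    then show "(\<lambda>x. k x * \<psi> x) \<in> borel_measurable (lebesgue_on {c..d})"
      using k by (intro borel_measurable_times) auto
    have "norm (k x * \<psi> x) \<le> norm (norm (k x) * \<bar>B\<bar>)" if "x \<in> {c..d}" for x
    proof -
      have "\<bar>\<psi> x\<bar> \<le> \<bar>B\<bar>" using B that by force
      then show ?thesis by (simp add: abs_mult mult_left_mono)
    qed
    then show "AE x in lebesgue_on {c..d}. norm (k x * \<psi> x) \<le> norm (norm (k x) * \<bar>B\<bar>)"
      by (intro AE_I2) (auto simp: space_restrict_space)
  qed
qed

text \<open>
  Products of polynomials and bumps are admissible; letting the bumps tend to \<open>1\<close> leaves polynomials,
  which are dense by Weierstrass' theorem. Concluding with continuous \<open>\<psi>\<close>, rather than with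
  \<open>k = 0\<close> almost everywhere, is what the later integrations by parts consume.
\<close>
lemma fundamental_lemma_variations:
  fixes k :: "real \<Rightarrow> real"
  assumes k: "integrable (lebesgue_on {c..d}) k"
    and z: "\<And>\<beta>. smooth_alg \<beta> \<Longrightarrow> (\<And>x. x \<notin> {c..d} \<Longrightarrow> \<beta> x = 0) \<Longrightarrow>
      integral\<^sup>L (lebesgue_on {c..d}) (\<lambda>x. k x * \<beta> x) = 0"
    and \<psi>: "continuous_on {c..d} \<psi>"
  shows "integral\<^sup>L (lebesgue_on {c..d}) (\<lambda>x. k x * \<psi> x) = 0"
proof -
  let ?M = "lebesgue_on {c..d}"
  have poly: "integral\<^sup>L ?M (\<lambda>x. k x * p x) = 0" if p: "real_polynomial_function p" for p
  proof -
    have sp: "smooth_alg p" by (rule smooth_alg_polynomial[OF p])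
    have kp: "integrable ?M (\<lambda>x. k x * p x)"
      by (rule integrable_mult_continuous[OF k smooth_alg_continuous[OF sp]])
    have "(\<lambda>n. integral\<^sup>L ?M (\<lambda>x. k x * p x * bump c d n x)) \<longlonglongrightarrow> integral\<^sup>L ?M (\<lambda>x. k x * p x)"
    proof (rule integral_dominated_convergence[where w = "\<lambda>x. norm (k x * p x)"])
      show "(\<lambda>x. k x * p x * bump c d n x) \<in> borel_measurable ?M" for n
        using integrable_mult_continuous[OF kp smooth_alg_continuous[OF smooth_alg_bump]] by auto
      show "AE x in ?M. (\<lambda>n. k x * p x * bump c d n x) \<longlonglongrightarrow> k x * p x"
        by (rule eventually_mono[OF AE_lebesgue_on_interior])
           (use tendsto_mult[OF tendsto_const bump_tendsto_1] in fastforce)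
      show "AE x in ?M. norm (k x * p x * bump c d n x) \<le> norm (k x * p x)" for n
      proof (rule AE_I2)
        fix x
        show "norm (k x * p x * bump c d n x) \<le> norm (k x * p x)"
          using mult_left_le[OF bump_bounds(2)[of c d n x] norm_ge_zero[of "k x * p x"]] bump_bounds(1)[of c d n x]
          by (simp add: abs_mult)
      qed
    qed (use kp in auto)
    moreover have "integral\<^sup>L ?M (\<lambda>x. k x * p x * bump c d n x) = 0" for n
    proof -
      have "integral\<^sup>L ?M (\<lambda>x. k x * (p x * bump c d n x)) = 0"
        by (rule z[OF smooth_alg.mult[OF sp smooth_alg_bump]]) (use bump_outside[of _ c d n] in auto)
      then show ?thesis by (simp add: mult.assoc)
    qed
    ultimately show ?thesis by (simp add: LIMSEQ_const_iff)
  qed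
  have "\<bar>integral\<^sup>L ?M (\<lambda>x. k x * \<psi> x)\<bar> \<le> e * integral\<^sup>L ?M (\<lambda>x. norm (k x))" if e: "e > 0" for e
  proof -
    obtain p where p: "real_polynomial_function p" "\<And>x. x \<in> {c..d} \<Longrightarrow> \<bar>\<psi> x - p x\<bar> < e"
      using Stone_Weierstrass_real_polynomial_function[OF _ \<psi> e] by auto
    have cp: "continuous_on {c..d} p" by (rule smooth_alg_continuous[OF smooth_alg_polynomial[OF p(1)]])
    have "integral\<^sup>L ?M (\<lambda>x. k x * \<psi> x) = integral\<^sup>L ?M (\<lambda>x. k x * \<psi> x) - integral\<^sup>L ?M (\<lambda>x. k x * p x)"
      using poly[OF p(1)] by simp
    also have "\<dots> = integral\<^sup>L ?M (\<lambda>x. k x * (\<psi> x - p x))"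
      using integrable_mult_continuous[OF k \<psi>] integrable_mult_continuous[OF k cp]
      by (simp add: right_diff_distrib)
    also have "\<bar>\<dots>\<bar> \<le> integral\<^sup>L ?M (\<lambda>x. norm (k x * (\<psi> x - p x)))"
      using integral_norm_bound[of ?M] by simp
    also have "\<dots> \<le> integral\<^sup>L ?M (\<lambda>x. e * norm (k x))"
    proof (rule integral_mono_AE)
      show "integrable ?M (\<lambda>x. norm (k x * (\<psi> x - p x)))"
        by (intro integrable_norm integrable_mult_continuous[OF k] continuous_intros \<psi> cp)
      show "AE x in ?M. norm (k x * (\<psi> x - p x)) \<le> e * norm (k x)"
      proof (rule AE_I2)
        fix x assume "x \<in> space ?M"
        then have "\<bar>\<psi> x - p x\<bar> \<le> e" using p(2)[of x] by (auto simp: space_restrict_space)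
        then show "norm (k x * (\<psi> x - p x)) \<le> e * norm (k x)"
          using mult_right_mono[of "\<bar>\<psi> x - p x\<bar>" e "\<bar>k x\<bar>"] by (simp add: abs_mult mult.commute)
      qed
    qed (use k in auto)
    finally show ?thesis by simp
  qed
  note le = this
  show ?thesis
  proof (rule ccontr)
    define N where "N = integral\<^sup>L ?M (\<lambda>x. norm (k x))"
    assume "integral\<^sup>L ?M (\<lambda>x. k x * \<psi> x) \<noteq> 0"
    then have pos: "\<bar>integral\<^sup>L ?M (\<lambda>x. k x * \<psi> x)\<bar> > 0" by simp
    have "N \<ge> 0" unfolding N_def by (intro integral_nonneg_AE) auto
    define z where "z = \<bar>integral\<^sup>L ?M (\<lambda>x. k x * \<psi> x)\<bar>"
    have z: "z > 0" using pos by (simp add: z_def)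
    have "z * N < z * (2 * (N + 1))" using z \<open>N \<ge> 0\<close> by (intro mult_strict_left_mono) auto
    then have "z / (2 * (N + 1)) * N < z" using \<open>N \<ge> 0\<close> by (simp add: pos_divide_less_eq)
    then show False
      using le[of "z / (2 * (N + 1))"] z \<open>N \<ge> 0\<close> unfolding N_def[symmetric] z_def[symmetric] by simp
  qed
qed

lemma test_function_continuous:
  assumes "test_function I \<phi>"
  shows "continuous_on A \<phi>" "continuous_on A (deriv \<phi>)" "(\<phi> has_real_derivative deriv \<phi> x) (at x)"
proof -
  have d: "((deriv ^^ n) \<phi>) field_differentiable (at x)" for n x
    using assms unfolding test_function_def by blast
  have 0: "\<phi> field_differentiable (at x)" for x using d[of 0 x] by simp
  have 1: "deriv \<phi> field_differentiable (at x)" for x using d[of 1 x] by simp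
  show "continuous_on A \<phi>" "continuous_on A (deriv \<phi>)"
    using field_differentiable_imp_continuous_at[OF 0] field_differentiable_imp_continuous_at[OF 1]
    by (simp_all add: continuous_at_imp_continuous_on)
  show "(\<phi> has_real_derivative deriv \<phi> x) (at x)"
    using 0 by (simp add: field_differentiable_derivI)
qed

lemma test_function_support:
  assumes "test_function {0<..<a} \<phi>" "a > 0"
  obtains c d where "0 < c" "c < d" "d < a" "\<And>x. x \<notin> {c..d} \<Longrightarrow> \<phi> x = 0" "\<And>x. x \<notin> {c..d} \<Longrightarrow> deriv \<phi> x = 0"
proof -
  obtain K where K: "compact K" "K \<subseteq> {0<..<a}" "\<And>x. x \<notin> K \<Longrightarrow> \<phi> x = 0"
    using assms(1) unfolding test_function_def by blast
  have "\<exists>c d. 0 < c \<and> c < d \<and> d < a \<and> K \<subseteq> {c..d}"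
  proof (cases "K = {}")
    case True
    then show ?thesis using assms(2) by (intro exI[of _ "a/3"] exI[of _ "a/2"]) auto
  next
    case False
    obtain c where c: "c \<in> K" "\<And>x. x \<in> K \<Longrightarrow> c \<le> x" using compact_attains_inf[OF K(1) False] by blast
    obtain d where d: "d \<in> K" "\<And>x. x \<in> K \<Longrightarrow> x \<le> d" using compact_attains_sup[OF K(1) False] by blast
    have "0 < c" "d < a" "c \<le> d" using c d K by auto
    moreover have "x \<le> (d + a) / 2" if "x \<in> K" for x using d(2)[OF that] \<open>d < a\<close> by simp
    ultimately show ?thesis using c by (intro exI[of _ c] exI[of _ "(d + a)/2"]) auto
  qed
  then obtain c d where cd: "0 < c" "c < d" "d < a" "K \<subseteq> {c..d}" by blast
  have \<phi>0: "\<phi> x = 0" if "x \<notin> {c..d}" for x using K(3) cd(4) that by blast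
  have d\<phi>0: "deriv \<phi> x = 0" if "x \<notin> {c..d}" for x
  proof (rule DERIV_imp_deriv)
    show "(\<phi> has_real_derivative 0) (at x)"
      by (rule has_field_derivative_transform_within_open[of "\<lambda>_. 0" _ _ "- {c..d}"])
         (use that \<phi>0 in \<open>auto intro!: open_Compl closed_atLeastAtMost\<close>)
  qed
  show ?thesis by (rule that[OF cd(1-3) \<phi>0 d\<phi>0])
qed

lemma lebesgue_on_support:
  fixes f :: "real \<Rightarrow> real"
  assumes "\<And>x. x \<notin> {c..d} \<Longrightarrow> f x = 0" "{c..d} \<subseteq> {0<..<a}"
  shows "integral\<^sup>L (lebesgue_on {0<..<a}) f = integral\<^sup>L (lebesgue_on {c..d}) f"
proof -
  have f: "f = (\<lambda>x. if x \<in> {c..d} then f x else 0)" using assms(1) by auto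
  show "integral\<^sup>L (lebesgue_on {0<..<a}) f = integral\<^sup>L (lebesgue_on {c..d}) f"
    using Lebesgue_Measure.integral_restrict[OF assms(2), of f] unfolding f[symmetric] by simp
qed

lemma locally_integrable_continuous:
  "continuous_on {0..a} f \<Longrightarrow> locally_integrable {0<..<a} f"
  unfolding locally_integrable_def
proof (intro allI impI)
  fix K assume f: "continuous_on {0..a} f" and K: "compact K \<and> K \<subseteq> {0<..<a}"
  have "integrable (lebesgue_on {0..a}) f" by (rule continuous_imp_integrable_real[OF f])
  then have 1: "set_integrable lebesgue {0..a} f"
    by (simp add: set_integrable_def integrable_restrict_space)
  have 2: "K \<in> sets lebesgue" by (rule fmeasurableD[OF lmeasurable_compact]) (simp add: K)
  have "{0<..<a} \<subseteq> {0..a}" by auto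
  with K have 3: "K \<subseteq> {0..a}" by (meson subset_trans)
  have "set_integrable lebesgue K f" by (rule set_integrable_subset[OF 1 2 3])
  then show "integrable (lebesgue_on K) f"
    using 2 by (simp add: set_integrable_def integrable_restrict_space)
qed

lemma weak_deriv_of_C1:
  assumes a: "a > 0" and f: "continuous_on {0..a} f" and g: "continuous_on {0..a} g"
    and d: "\<And>s. 0 < s \<Longrightarrow> s < a \<Longrightarrow> (f has_real_derivative g s) (at s)"
  shows "weak_deriv {0<..<a} f g"
  unfolding weak_deriv_def
proof (intro conjI allI impI locally_integrable_continuous f g)
  fix \<phi> assume t: "test_function {0<..<a} \<phi>"
  obtain c b where cb: "0 < c" "c < b" "b < a" "\<And>x. x \<notin> {c..b} \<Longrightarrow> \<phi> x = 0" "\<And>x. x \<notin> {c..b} \<Longrightarrow> deriv \<phi> x = 0"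
    by (rule test_function_support[OF t a]) (rule that, assumption+)
  note tc = test_function_continuous[OF t]
  define c' b' where "c' = c / 2" and "b' = (b + a) / 2"
  have cb': "0 < c'" "c' < c" "b < b'" "b' < a" using cb by (auto simp: c'_def b'_def)
  have sub: "{c'..b'} \<subseteq> {0<..<a}" "{c'..b'} \<subseteq> {0..a}" using cb' by auto
  have z: "\<phi> x = 0" "deriv \<phi> x = 0" if "x \<notin> {c'..b'}" for x
    using cb(4,5)[of x] that cb' by auto
  have cf: "continuous_on {c'..b'} f" and cg: "continuous_on {c'..b'} g"
    by (rule continuous_on_subset[OF f sub(2)], rule continuous_on_subset[OF g sub(2)])
  have i1: "integrable (lebesgue_on {c'..b'}) (\<lambda>s. f s * deriv \<phi> s)"
    and i2: "integrable (lebesgue_on {c'..b'}) (\<lambda>s. g s * \<phi> s)"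
    by (intro continuous_imp_integrable_real continuous_on_mult cf cg tc(1,2))+
  have "((\<lambda>s. f s * deriv \<phi> s + g s * \<phi> s) has_integral (f b' * \<phi> b' - f c' * \<phi> c')) {c'..b'}"
  proof (rule fundamental_theorem_of_calculus)
    fix s assume s: "s \<in> {c'..b'}"
    then have "0 < s" "s < a" using cb' by auto
    from DERIV_mult[OF d[OF this] tc(3)]
    have "((\<lambda>s. f s * \<phi> s) has_real_derivative f s * deriv \<phi> s + g s * \<phi> s) (at s)"
      by (simp add: algebra_simps)
    then have "((\<lambda>s. f s * \<phi> s) has_real_derivative f s * deriv \<phi> s + g s * \<phi> s) (at s within {c'..b'})"
      by (rule has_field_derivative_at_within)
    then show "((\<lambda>s. f s * \<phi> s) has_vector_derivative f s * deriv \<phi> s + g s * \<phi> s) (at s within {c'..b'})"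
      by (simp add: has_real_derivative_iff_has_vector_derivative)
  qed (use cb cb' in auto)
  moreover have "\<phi> b' = 0" "\<phi> c' = 0" using cb(4)[of b'] cb(4)[of c'] cb' by auto
  ultimately have "integral {c'..b'} (\<lambda>s. f s * deriv \<phi> s + g s * \<phi> s) = 0"
    by (simp add: integral_unique)
  then have "integral\<^sup>L (lebesgue_on {c'..b'}) (\<lambda>s. f s * deriv \<phi> s + g s * \<phi> s) = 0"
    using lebesgue_integral_eq_integral[of "{c'..b'}" "\<lambda>s. f s * deriv \<phi> s + g s * \<phi> s"] i1 i2 by simp
  then have "integral\<^sup>L (lebesgue_on {c'..b'}) (\<lambda>s. f s * deriv \<phi> s) = - integral\<^sup>L (lebesgue_on {c'..b'}) (\<lambda>s. g s * \<phi> s)"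
    using Bochner_Integration.integral_add[OF i1 i2] by simp
  moreover have "integral\<^sup>L (lebesgue_on {0<..<a}) (\<lambda>s. f s * deriv \<phi> s) = integral\<^sup>L (lebesgue_on {c'..b'}) (\<lambda>s. f s * deriv \<phi> s)"
    "integral\<^sup>L (lebesgue_on {0<..<a}) (\<lambda>s. g s * \<phi> s) = integral\<^sup>L (lebesgue_on {c'..b'}) (\<lambda>s. g s * \<phi> s)"
    by (rule lebesgue_on_support[OF _ sub(1)]; simp add: z)+
  ultimately show "integral\<^sup>L (lebesgue_on {0<..<a}) (\<lambda>s. f s * deriv \<phi> s) =
      - integral\<^sup>L (lebesgue_on {0<..<a}) (\<lambda>s. g s * \<phi> s)" by simp
qed

lemma locally_integrable_Icc:
  assumes "locally_integrable {0<..<a} f" "0 < c" "d < a"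
  shows "integrable (lebesgue_on {c..d}) f"
proof -
  have "compact {c..d} \<and> {c..d} \<subseteq> {0<..<a}" using assms(2,3) by auto
  then show ?thesis using assms(1) unfolding locally_integrable_def by blast
qed

lemma AE_lebesgue_on_mono:
  assumes "AE s in lebesgue_on A. P s" "B \<subseteq> A" "A \<in> sets lebesgue" "B \<in> sets lebesgue"
  shows "AE s in lebesgue_on B. P s"
proof -
  have "AE s in lebesgue. s \<in> A \<longrightarrow> P s"
    using AE_restrict_space_iff[of A lebesgue P] assms(1,3) by simp
  then have "AE s in lebesgue. s \<in> B \<longrightarrow> P s" by (rule eventually_mono) (use assms(2) in auto)
  then show ?thesis using AE_restrict_space_iff[of B lebesgue P] assms(4) by simp
qed

lemma weak_derivD:
  assumes "weak_deriv I u v"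
  shows "locally_integrable I u" "locally_integrable I v"
    and "test_function I \<phi> \<Longrightarrow> integral\<^sup>L (lebesgue_on I) (\<lambda>s. u s * deriv \<phi> s) =
      - integral\<^sup>L (lebesgue_on I) (\<lambda>s. v s * \<phi> s)"
  using assms unfolding weak_deriv_def by simp_all

text \<open>
  The integration-by-parts formula for a weak derivative, restricted to an interval that contains the
  support of the test function; there the functions are integrable and may be changed on
  null sets.
\<close>
lemma weak_deriv_test:
  fixes u u' v v' :: "real \<Rightarrow> real"
  assumes w: "weak_deriv {0<..<a} u v" and t: "test_function {0<..<a} \<phi>"
    and supp: "\<And>x. x \<notin> {c..d} \<Longrightarrow> \<phi> x = 0" and cd: "0 < c" "d < a"
    and ae: "AE s in lebesgue_on {0<..<a}. u s = u' s" "AE s in lebesgue_on {0<..<a}. v s = v' s"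
    and i: "integrable (lebesgue_on {c..d}) u'" "integrable (lebesgue_on {c..d}) v'"
  shows "integral\<^sup>L (lebesgue_on {c..d}) (\<lambda>s. u' s * deriv \<phi> s) =
     - integral\<^sup>L (lebesgue_on {c..d}) (\<lambda>s. v' s * \<phi> s)"
proof -
  have sub: "{c..d} \<subseteq> {0<..<a}" using cd by auto
  note tc = test_function_continuous[OF t]
  have d0: "deriv \<phi> x = 0" if "x \<notin> {c..d}" for x
  proof (rule DERIV_imp_deriv)
    show "(\<phi> has_real_derivative 0) (at x)"
      by (rule has_field_derivative_transform_within_open[of "\<lambda>_. 0" _ _ "- {c..d}"])
         (use that supp in \<open>auto intro!: open_Compl closed_atLeastAtMost\<close>)
  qed
  have iu: "integrable (lebesgue_on {c..d}) u" "integrable (lebesgue_on {c..d}) v"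
    by (rule locally_integrable_Icc[OF weak_derivD(1)[OF w] cd], rule locally_integrable_Icc[OF weak_derivD(2)[OF w] cd])
  have m: "(\<lambda>s. f s * \<psi> s) \<in> borel_measurable (lebesgue_on {c..d})"
    if "integrable (lebesgue_on {c..d}) f" "continuous_on {c..d} \<psi>" for f \<psi> :: "real \<Rightarrow> real"
    by (rule borel_measurable_integrable[OF integrable_mult_continuous[OF that]])
  have ae1: "AE s in lebesgue_on {c..d}. u' s * deriv \<phi> s = u s * deriv \<phi> s"
    by (rule eventually_mono[OF AE_lebesgue_on_mono[OF ae(1) sub]]) simp_all
  have ae2: "AE s in lebesgue_on {c..d}. v s * \<phi> s = v' s * \<phi> s"
    by (rule eventually_mono[OF AE_lebesgue_on_mono[OF ae(2) sub]]) simp_all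
  have "integral\<^sup>L (lebesgue_on {c..d}) (\<lambda>s. u' s * deriv \<phi> s) = integral\<^sup>L (lebesgue_on {c..d}) (\<lambda>s. u s * deriv \<phi> s)"
    by (rule integral_cong_AE[OF m[OF i(1) tc(2)] m[OF iu(1) tc(2)] ae1])
  also have "\<dots> = integral\<^sup>L (lebesgue_on {0<..<a}) (\<lambda>s. u s * deriv \<phi> s)"
    by (rule lebesgue_on_support[OF _ sub, symmetric]) (simp add: d0)
  also have "\<dots> = - integral\<^sup>L (lebesgue_on {0<..<a}) (\<lambda>s. v s * \<phi> s)"
    by (rule weak_derivD(3)[OF w t])
  also have "integral\<^sup>L (lebesgue_on {0<..<a}) (\<lambda>s. v s * \<phi> s) = integral\<^sup>L (lebesgue_on {c..d}) (\<lambda>s. v s * \<phi> s)"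
    by (rule lebesgue_on_support[OF _ sub]) (simp add: supp)
  also have "\<dots> = integral\<^sup>L (lebesgue_on {c..d}) (\<lambda>s. v' s * \<phi> s)"
    by (rule integral_cong_AE[OF m[OF iu(2) tc(1)] m[OF i(2) tc(1)] ae2])
  finally show ?thesis .
qed

lemma weak_deriv_C1_representative:
  assumes w: "weak_deriv {0<..<a} u v" and a: "a > 0"
    and ae: "AE s in lebesgue_on {0<..<a}. u s = U s"
    and U: "continuous_on {0..a} U" "continuous_on {0..a} U'"
      "\<And>s. 0 < s \<Longrightarrow> s < a \<Longrightarrow> (U has_real_derivative U' s) (at s)"
    and cd: "0 < c" "d < a" and \<psi>: "continuous_on {c..d} \<psi>"
  shows "integral\<^sup>L (lebesgue_on {c..d}) (\<lambda>s. v s * \<psi> s) = integral\<^sup>L (lebesgue_on {c..d}) (\<lambda>s. U' s * \<psi> s)"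
proof -
  have sub: "{c..d} \<subseteq> {0..a}" "{c..d} \<subseteq> {0<..<a}" using cd by auto
  have iv: "integrable (lebesgue_on {c..d}) v"
    by (rule locally_integrable_Icc[OF weak_derivD(2)[OF w] cd])
  have iU: "integrable (lebesgue_on {c..d}) U" "integrable (lebesgue_on {c..d}) U'"
    by (rule continuous_imp_integrable_real[OF continuous_on_subset[OF U(1) sub(1)]],
        rule continuous_imp_integrable_real[OF continuous_on_subset[OF U(2) sub(1)]])
  have cU': "continuous_on {c..d} U'" using U(2) sub(1) by (rule continuous_on_subset)
  have "integral\<^sup>L (lebesgue_on {c..d}) (\<lambda>s. (v s - U' s) * \<psi> s) = 0"
  proof (rule fundamental_lemma_variations[OF _ _ \<psi>])
    show "integrable (lebesgue_on {c..d}) (\<lambda>s. v s - U' s)" using iv iU by simp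
    fix \<beta> assume \<beta>: "smooth_alg \<beta>" and supp: "\<And>x. x \<notin> {c..d} \<Longrightarrow> \<beta> x = 0"
    have t: "test_function {0<..<a} \<beta>"
      by (rule smooth_alg_test_function[OF \<beta> _ sub(2)]) (rule supp)
    have c\<beta>: "continuous_on {c..d} \<beta>" by (rule smooth_alg_continuous[OF \<beta>])
    have wU: "weak_deriv {0<..<a} U U'" by (rule weak_deriv_of_C1[OF a U(1,2)]) (rule U(3))
    have "integral\<^sup>L (lebesgue_on {c..d}) (\<lambda>s. U s * deriv \<beta> s) = - integral\<^sup>L (lebesgue_on {c..d}) (\<lambda>s. v s * \<beta> s)"
      by (rule weak_deriv_test[OF w t _ cd ae AE_I2[OF refl] iU(1) iv]) (rule supp)
    moreover have "integral\<^sup>L (lebesgue_on {c..d}) (\<lambda>s. U s * deriv \<beta> s) = - integral\<^sup>L (lebesgue_on {c..d}) (\<lambda>s. U' s * \<beta> s)"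
      by (rule weak_deriv_test[OF wU t _ cd AE_I2[OF refl] AE_I2[OF refl] iU]) (rule supp)
    ultimately have "integral\<^sup>L (lebesgue_on {c..d}) (\<lambda>s. v s * \<beta> s) = integral\<^sup>L (lebesgue_on {c..d}) (\<lambda>s. U' s * \<beta> s)"
      by (simp only: neg_equal_iff_equal)
    then show "integral\<^sup>L (lebesgue_on {c..d}) (\<lambda>s. (v s - U' s) * \<beta> s) = 0"
      using integrable_mult_continuous[OF iv c\<beta>] integrable_mult_continuous[OF iU(2) c\<beta>]
      by (simp add: left_diff_distrib)
  qed
  then show ?thesis
    using integrable_mult_continuous[OF iv \<psi>] integrable_mult_continuous[OF iU(2) \<psi>]
    by (simp add: left_diff_distrib)
qed

text \<open>
  For a smooth \<open>\<beta>\<close> supported in a small interval around \<open>x\<close>, the primitive of \<open>\<beta>(s) - \<beta>(s-\<tau>)\<close> with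
  \<open>\<tau> = y - x\<close> is a test function. Hence \<open>k(s) = e(s) - e(s+\<tau>)\<close> is orthogonal to every such \<open>\<beta>\<close>, and
  therefore to itself.
\<close>
lemma du_Bois_Reymond:
  fixes e :: "real \<Rightarrow> real"
  assumes a: "a > 0" and e: "continuous_on {0..a} e"
    and w: "weak_deriv {0<..<a} e (\<lambda>_. 0)"
    and xy: "0 < x" "x < y" "y < a"
  shows "e x = e y"
proof -
  define \<tau> where "\<tau> = y - x"
  define c where "c = x / 2"
  \<comment> \<open>The interval \<open>[c,d]\<close> contains \<open>x\<close>, and both it and its translate by \<open>\<tau>\<close> lie in \<open>(0,a)\<close>.\<close>
  define d where "d = (x + (a - \<tau>)) / 2"
  have eqs: "\<tau> = y - x" "2 * c = x" "2 * d = 2 * x + a - y"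
    by (simp_all add: \<tau>_def c_def d_def)
  have \<tau>: "\<tau> > 0" using xy eqs by linarith
  have cd: "0 < c" "c < x" "x < d" "d + \<tau> < a" using xy eqs by linarith+
  define k where "k s = e s - e (s + \<tau>)" for s
  have ce: "continuous_on A e" if "A \<subseteq> {0..a}" for A using e that by (rule continuous_on_subset)
  have ces: "continuous_on {c..d} (\<lambda>s. e (s + \<tau>))"
  proof (rule continuous_on_compose2[OF e])
    show "continuous_on {c..d} (\<lambda>s. s + \<tau>)" by (intro continuous_intros)
    show "(\<lambda>s. s + \<tau>) ` {c..d} \<subseteq> {0..a}" using cd \<tau> by auto
  qed
  have ck: "continuous_on {c..d} k"
    unfolding k_def using cd \<tau> by (intro continuous_intros ce ces) auto
  have "integral\<^sup>L (lebesgue_on {c..d}) (\<lambda>s. k s * k s) = 0"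
  proof (rule fundamental_lemma_variations[OF continuous_imp_integrable_real[OF ck] _ ck])
    fix \<beta> assume \<beta>: "smooth_alg \<beta>" and supp: "\<And>x. x \<notin> {c..d} \<Longrightarrow> \<beta> x = 0"
    have c\<beta>: "continuous_on A \<beta>" for A by (rule smooth_alg_continuous[OF \<beta>])
    have c\<beta>s: "continuous_on A (\<lambda>s. \<beta> (s - \<tau>))" for A
      by (rule continuous_on_compose2[OF c\<beta>[of UNIV]]) (auto intro!: continuous_intros)
    define B where "B s = integral {-1..s} \<beta>" for s
    have \<beta>0: "\<beta> s = 0" if "s \<le> 0" for s using supp[of s] cd that by auto
    have dB: "(B has_real_derivative \<beta> s) (at s)" for s
      unfolding B_def by (rule antiderivative_vanishing_left(1)[OF c\<beta> \<beta>0])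
    have B0: "B s = 0" if "s \<le> 0" for s
      unfolding B_def by (rule antiderivative_vanishing_left(2)[OF c\<beta> \<beta>0 that])
    have cB: "continuous_on A B" for A
      using DERIV_isCont[OF dB] by (simp add: continuous_at_imp_continuous_on)
    define \<phi> where "\<phi> s = B s - B (s - \<tau>)" for s
    have d\<phi>: "(\<phi> has_real_derivative \<beta> s - \<beta> (s - \<tau>)) (at s)" for s
    proof -
      have "((\<lambda>s. B (s - \<tau>)) has_real_derivative \<beta> (s - \<tau>) * 1) (at s)"
        by (rule DERIV_chain2[OF dB]) (auto intro!: derivative_eq_intros)
      then show ?thesis unfolding \<phi>_def using DERIV_diff[OF dB] by simp
    qed
    have deriv\<phi>: "deriv \<phi> = (\<lambda>s. \<beta> s - \<beta> (s - \<tau>))" by (rule ext) (rule DERIV_imp_deriv[OF d\<phi>])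
    have shift: "smooth_alg f \<Longrightarrow> smooth_alg (\<lambda>s. f (s - \<tau>))" for f
    proof (induction rule: smooth_alg.induct)
      case ident
      show ?case using smooth_alg.add[OF smooth_alg.ident smooth_alg.const[of "- \<tau>"]] by simp
    next
      case (flat i \<alpha> \<gamma>)
      show ?case using smooth_alg.flat[of i \<alpha> "\<gamma> - \<alpha> * \<tau>"] by (simp add: algebra_simps)
    qed (auto intro: smooth_alg.intros)
    have sd: "smooth_alg (deriv \<phi>)"
      unfolding deriv\<phi> using smooth_alg.add[OF \<beta> smooth_alg.mult[OF smooth_alg.const[of "- 1"] shift[OF \<beta>]]] by simp
    have const_left: "B s = 0" if "s \<le> c" for s
    proof (cases "s \<le> 0")
      case False
      have "B s = B 0"
      proof (rule DERIV_isconst_end[of 0 s])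
        show "(B has_real_derivative 0) (at r)" if "0 < r" "r < s" for r
          using dB[of r] supp[of r] that \<open>s \<le> c\<close> by auto
      qed (use False cB in auto)
      then show ?thesis using B0[of 0] by simp
    qed (rule B0)
    have const_right: "B s = B d" if "s \<ge> d" for s
    proof (cases "s = d")
      case False
      show ?thesis
      proof (rule DERIV_isconst_end[of d s])
        show "(B has_real_derivative 0) (at r)" if "d < r" "r < s" for r
          using dB[of r] supp[of r] that by auto
      qed (use that False cB in auto)
    qed simp
    have supp\<phi>: "\<phi> s = 0" if "s \<notin> {c..d + \<tau>}" for s
      using that const_left[of s] const_left[of "s - \<tau>"] const_right[of s] const_right[of "s - \<tau>"] \<tau> cd
      by (auto simp: \<phi>_def)
    have t: "test_function {0<..<a} \<phi>"
      unfolding test_function_def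
    proof (intro conjI allI exI[of _ "{c..d + \<tau>}"] impI)
      fix n s
      show "((deriv ^^ n) \<phi>) field_differentiable (at s)"
      proof (cases n)
        case 0 then show ?thesis using d\<phi> by (auto simp: field_differentiable_def)
      next
        case (Suc j)
        then show ?thesis using smooth_alg_iterated_deriv[OF sd, of j s] by (simp add: funpow_Suc_right del: funpow.simps)
      qed
    qed (use cd \<tau> supp\<phi> in auto)
    have ie: "integrable (lebesgue_on {c..d+\<tau>}) e"
      using cd \<tau> by (intro continuous_imp_integrable_real ce) auto
    have i0: "integrable (lebesgue_on {c..d+\<tau>}) (\<lambda>_. 0::real)" by simp
    have "integral\<^sup>L (lebesgue_on {c..d+\<tau>}) (\<lambda>s. e s * deriv \<phi> s) = - integral\<^sup>L (lebesgue_on {c..d+\<tau>}) (\<lambda>s. 0 * \<phi> s)"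
      by (rule weak_deriv_test[OF w t _ cd(1,4) AE_I2[OF refl] AE_I2[OF refl] ie i0]) (rule supp\<phi>)
    then have "integral\<^sup>L (lebesgue_on {c..d+\<tau>}) (\<lambda>s. e s * deriv \<phi> s) = 0" by simp
    moreover have "integral\<^sup>L (lebesgue_on {c..d+\<tau>}) (\<lambda>s. e s * deriv \<phi> s) = integral {c..d+\<tau>} (\<lambda>s. e s * deriv \<phi> s)"
      using cd \<tau> by (intro lebesgue_integral_eq_integral continuous_imp_integrable_real continuous_intros ce test_function_continuous[OF t]) auto
    moreover have "integral {c..d+\<tau>} (\<lambda>s. e s * deriv \<phi> s) =
        integral {c..d+\<tau>} (\<lambda>s. e s * \<beta> s) - integral {c..d+\<tau>} (\<lambda>s. e s * \<beta> (s - \<tau>))"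
      unfolding deriv\<phi> right_diff_distrib using cd \<tau>
      by (intro integral_diff integrable_continuous_interval continuous_intros ce c\<beta> c\<beta>s) auto
    moreover have "integral {c..d+\<tau>} (\<lambda>s. e s * \<beta> s) = integral {c..d} (\<lambda>s. e s * \<beta> s)"
    proof -
      have "integral {c..d} (\<lambda>s. e s * \<beta> s) + integral {d..d+\<tau>} (\<lambda>s. e s * \<beta> s) = integral {c..d+\<tau>} (\<lambda>s. e s * \<beta> s)"
        using cd \<tau> by (intro Henstock_Kurzweil_Integration.integral_combine integrable_continuous_interval continuous_intros ce c\<beta>) auto
      moreover have "integral {d..d+\<tau>} (\<lambda>s. e s * \<beta> s) = integral {d..d+\<tau>} (\<lambda>_. 0)"
        by (rule integral_spike[of "{d}"]) (use supp in auto)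
      ultimately show ?thesis by simp
    qed
    moreover have "integral {c..d+\<tau>} (\<lambda>s. e s * \<beta> (s - \<tau>)) = integral {c..d} (\<lambda>s. e (s + \<tau>) * \<beta> s)"
    proof -
      have "integral {c..c+\<tau>} (\<lambda>s. e s * \<beta> (s - \<tau>)) + integral {c+\<tau>..d+\<tau>} (\<lambda>s. e s * \<beta> (s - \<tau>)) = integral {c..d+\<tau>} (\<lambda>s. e s * \<beta> (s - \<tau>))"
        using cd \<tau> by (intro Henstock_Kurzweil_Integration.integral_combine integrable_continuous_interval continuous_intros ce c\<beta>s) auto
      moreover have "integral {c..c+\<tau>} (\<lambda>s. e s * \<beta> (s - \<tau>)) = integral {c..c+\<tau>} (\<lambda>_. 0)"
        by (rule integral_spike[of "{c+\<tau>}"]) (use supp in auto)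
      moreover have "integral {c+\<tau>..d+\<tau>} (\<lambda>s. e s * \<beta> (s - \<tau>)) = integral {c..d} (\<lambda>s. e (s + \<tau>) * \<beta> s)"
        using integral_shift_real_ivl[of "c + \<tau>" \<tau> "d + \<tau>" "\<lambda>s. e s * \<beta> (s - \<tau>)"] by simp
      ultimately show ?thesis by simp
    qed
    moreover have "integral {c..d} (\<lambda>s. k s * \<beta> s) = integral {c..d} (\<lambda>s. e s * \<beta> s) - integral {c..d} (\<lambda>s. e (s + \<tau>) * \<beta> s)"
      unfolding k_def left_diff_distrib using cd \<tau>
      by (intro integral_diff integrable_continuous_interval continuous_intros ce c\<beta> ces) auto
    moreover have "integral\<^sup>L (lebesgue_on {c..d}) (\<lambda>s. k s * \<beta> s) = integral {c..d} (\<lambda>s. k s * \<beta> s)"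
      by (intro lebesgue_integral_eq_integral continuous_imp_integrable_real continuous_intros ck c\<beta>) auto
    ultimately show "integral\<^sup>L (lebesgue_on {c..d}) (\<lambda>s. k s * \<beta> s) = 0" by simp
  qed
  moreover have "integral\<^sup>L (lebesgue_on {c..d}) (\<lambda>s. k s * k s) = integral {c..d} (\<lambda>s. k s * k s)"
    by (intro lebesgue_integral_eq_integral continuous_imp_integrable_real continuous_intros ck) auto
  ultimately have "integral (cbox c d) (\<lambda>s. k s * k s) = 0" by simp
  then have "((\<lambda>s. k s * k s) has_integral 0) (cbox c d)"
    using integrable_continuous_interval[of c d "\<lambda>s. k s * k s"] ck
    by (metis continuous_on_mult has_integral_integral interval_cbox)
  then have "k x * k x = 0"
    by (rule has_integral_0_cbox_imp_0[rotated 2]) (use ck cd in \<open>auto intro!: continuous_intros\<close>)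
  then show ?thesis by (simp add: k_def \<tau>_def)
qed

lemma AE_weighted_iff:
  assumes m: "continuous_on {0..} m" "\<And>s. s \<ge> 0 \<Longrightarrow> m s > 0"
  shows "(AE s in weighted m a. Q s) \<longleftrightarrow> (AE s in lebesgue_on {0<..<a}. Q s)"
proof -
  have c: "continuous_on {0<..<a} (\<lambda>s. (m s)\<^sup>2)"
    by (intro continuous_intros continuous_on_subset[OF m(1)]) auto
  have "(\<lambda>s. (m s)\<^sup>2) \<in> borel_measurable (lebesgue_on {0<..<a})"
    by (rule continuous_imp_measurable_on_sets_lebesgue[OF c]) simp
  then have meas: "(\<lambda>s. ennreal ((m s)\<^sup>2)) \<in> borel_measurable (lebesgue_on {0<..<a})" by simp
  have sp: "AE s in lebesgue_on {0<..<a}. s \<in> {0<..<a}"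
    by (rule AE_I2) (simp add: space_restrict_space)
  have "(AE s in weighted m a. Q s) \<longleftrightarrow> (AE s in lebesgue_on {0<..<a}. 0 < ennreal ((m s)\<^sup>2) \<longrightarrow> Q s)"
    unfolding weighted_def by (rule AE_density[OF meas])
  also have "\<dots> \<longleftrightarrow> (AE s in lebesgue_on {0<..<a}. Q s)"
  proof
    assume "AE s in lebesgue_on {0<..<a}. 0 < ennreal ((m s)\<^sup>2) \<longrightarrow> Q s"
    from this sp show "AE s in lebesgue_on {0<..<a}. Q s"
    proof eventually_elim
      case (elim s)
      then show ?case using m(2)[of s] by (simp add: ennreal_less_zero_iff)
    qed
  next
    assume "AE s in lebesgue_on {0<..<a}. Q s"
    then show "AE s in lebesgue_on {0<..<a}. 0 < ennreal ((m s)\<^sup>2) \<longrightarrow> Q s"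
      by eventually_elim simp
  qed
  finally show ?thesis .
qed

section \<open>The Dirichlet--Robin eigenvalues\<close>

text \<open>
  Regularity of weak eigenfunctions: \<open>m\<^sup>2 U'\<close> and the primitive of \<open>-(1+l) m\<^sup>2 U\<close> have the same
  weak derivative, so they differ by a constant.
\<close>

lemma DR_eigenfunction_classical:
  assumes m: "continuous_on {0..} m" "\<And>s. s \<ge> 0 \<Longrightarrow> m s > 0" and a: "a > 0"
    and ev: "DR_eigenvalue m a l"
  obtains U U' where "\<And>s. s \<in> {0..a} \<Longrightarrow> (U has_real_derivative U' s) (at s within {0..a})"
    "continuous_on {0..a} U'" "U 0 = 0" "U' a = U a"
    "\<And>s. 0 < s \<Longrightarrow> s < a \<Longrightarrow> ((\<lambda>s. (m s)\<^sup>2 * U' s) has_real_derivative - ((1 + l) * ((m s)\<^sup>2 * U s))) (at s)"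
    "\<exists>s. 0 < s \<and> s < a \<and> U s \<noteq> 0"
proof -
  obtain u where K: "K_DR m a u (\<lambda>s. l * u s)" and nz: "\<not> (AE s in weighted m a. u s = 0)"
    using ev unfolding DR_eigenvalue_def by blast
  obtain v w where wv: "weak_deriv {0<..<a} u v" and ww: "weak_deriv {0<..<a} (\<lambda>s. (m s)\<^sup>2 * v s) w"
    and eq: "AE s in weighted m a. l * u s = - (1 / (m s)\<^sup>2) * w s - u s" and dom: "u \<in> DR_domain a"
    using K unfolding K_DR_def by blast
  obtain U U' where UU: "AE s in lebesgue_on {0<..<a}. u s = U s"
    and dU: "\<forall>s\<in>{0..a}. (U has_real_derivative U' s) (at s within {0..a})"
    and cU': "continuous_on {0..a} U'" and bc: "U 0 = 0" "U' a = U a"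
    using dom unfolding DR_domain_def by blast
  have cU: "continuous_on {0..a} U"
    using dU by (auto intro!: DERIV_continuous simp: continuous_on_eq_continuous_within)
  have dU': "(U has_real_derivative U' s) (at s)" if "0 < s" "s < a" for s
    using bspec[OF dU, of s] that at_within_interior[of s "{0..a}"] by simp
  have cm: "continuous_on {0..a} m" by (rule continuous_on_subset[OF m(1)]) auto
  define q where "q s = (m s)\<^sup>2 * U' s" for s
  define r where "r s = - ((1 + l) * ((m s)\<^sup>2 * U s))" for s
  have cq: "continuous_on {0..a} q" and cr: "continuous_on {0..a} r"
    unfolding q_def r_def by (intro continuous_intros cm cU cU')+
  define P where "P s = integral {0..s} r" for s
  have cP: "continuous_on {0..a} P"
    unfolding P_def by (intro indefinite_integral_continuous_1 integrable_continuous_interval cr)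
  have dP: "(P has_real_derivative r s) (at s)" if "0 < s" "s < a" for s
  proof -
    have "(P has_real_derivative r s) (at s within {0..a})"
      unfolding P_def using that by (intro integral_has_real_derivative cr) auto
    then show ?thesis using that at_within_interior[of s "{0..a}"] by simp
  qed
  have wr: "AE s in lebesgue_on {0<..<a}. w s = r s"
  proof -
    have "AE s in lebesgue_on {0<..<a}. l * u s = - (1 / (m s)\<^sup>2) * w s - u s"
      using eq by (simp only: AE_weighted_iff[OF m])
    moreover have "AE s in lebesgue_on {0<..<a}. s \<in> {0<..<a}"
      by (rule AE_I2) (simp add: space_restrict_space)
    ultimately show ?thesis using UU
    proof eventually_elim
      case (elim s)
      then have ms: "m s > 0" using m(2)[of s] by simp
      have "(m s)\<^sup>2 * (l * u s) = - w s - (m s)\<^sup>2 * u s"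
        unfolding elim(1) using ms by (simp add: field_simps)
      then show ?case using elim(3) by (simp add: r_def algebra_simps)
    qed
  qed
  have wP: "weak_deriv {0<..<a} P r" by (rule weak_deriv_of_C1[OF a cP cr dP])
  define e where "e s = q s - P s" for s
  have ce: "continuous_on {0..a} e" unfolding e_def by (intro continuous_intros cq cP)
  have we: "weak_deriv {0<..<a} e (\<lambda>_. 0)"
    unfolding weak_deriv_def
  proof (intro conjI allI impI)
    show "locally_integrable {0<..<a} e" by (rule locally_integrable_continuous[OF ce])
    show "locally_integrable {0<..<a} (\<lambda>_. 0)" by (rule locally_integrable_continuous) simp
    fix \<phi> assume t: "test_function {0<..<a} \<phi>"
    obtain c d where cd: "0 < c" "c < d" "d < a" and \<phi>0: "\<And>x. x \<notin> {c..d} \<Longrightarrow> \<phi> x = 0"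
      and d\<phi>0: "\<And>x. x \<notin> {c..d} \<Longrightarrow> deriv \<phi> x = 0"
      by (rule test_function_support[OF t a]) (rule that, assumption+)
    have sub: "{c..d} \<subseteq> {0<..<a}" "{c..d} \<subseteq> {0..a}" using cd by auto
    note tc = test_function_continuous[OF t]
    note on = continuous_on_subset[OF _ sub(2)]
    have iq: "integrable (lebesgue_on {c..d}) q" and iP: "integrable (lebesgue_on {c..d}) P"
      and ir: "integrable (lebesgue_on {c..d}) r"
      by (rule continuous_imp_integrable_real[OF on[OF cq]], rule continuous_imp_integrable_real[OF on[OF cP]],
          rule continuous_imp_integrable_real[OF on[OF cr]])
    have imv: "integrable (lebesgue_on {c..d}) (\<lambda>s. (m s)\<^sup>2 * v s)"
      by (rule locally_integrable_Icc[OF weak_derivD(1)[OF ww] cd(1,3)])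
    have c\<psi>: "continuous_on {c..d} (\<lambda>s. (m s)\<^sup>2 * deriv \<phi> s)"
      by (intro continuous_on_mult continuous_on_power on[OF cm] tc(2))
    have "integral\<^sup>L (lebesgue_on {c..d}) (\<lambda>s. q s * deriv \<phi> s)
        = integral\<^sup>L (lebesgue_on {c..d}) (\<lambda>s. U' s * ((m s)\<^sup>2 * deriv \<phi> s))"
      by (simp add: q_def mult_ac)
    also have "\<dots> = integral\<^sup>L (lebesgue_on {c..d}) (\<lambda>s. v s * ((m s)\<^sup>2 * deriv \<phi> s))"
      by (rule weak_deriv_C1_representative[OF wv a UU cU cU' dU' cd(1,3) c\<psi>, symmetric])
    also have "\<dots> = integral\<^sup>L (lebesgue_on {c..d}) (\<lambda>s. ((m s)\<^sup>2 * v s) * deriv \<phi> s)"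
      by (simp add: mult_ac)
    also have "\<dots> = - integral\<^sup>L (lebesgue_on {c..d}) (\<lambda>s. r s * \<phi> s)"
      by (rule weak_deriv_test[OF ww t _ cd(1,3) AE_I2[OF refl] wr imv ir]) (rule \<phi>0)
    also have "\<dots> = integral\<^sup>L (lebesgue_on {c..d}) (\<lambda>s. P s * deriv \<phi> s)"
      by (rule weak_deriv_test[OF wP t _ cd(1,3) AE_I2[OF refl] AE_I2[OF refl] iP ir, symmetric]) (rule \<phi>0)
    finally have "integral\<^sup>L (lebesgue_on {c..d}) (\<lambda>s. e s * deriv \<phi> s) = 0"
      using integrable_mult_continuous[OF iq tc(2)] integrable_mult_continuous[OF iP tc(2)]
      by (simp add: e_def left_diff_distrib)
    moreover have "integral\<^sup>L (lebesgue_on {0<..<a}) (\<lambda>s. e s * deriv \<phi> s) = integral\<^sup>L (lebesgue_on {c..d}) (\<lambda>s. e s * deriv \<phi> s)"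
      by (rule lebesgue_on_support[OF _ sub(1)]) (simp add: d\<phi>0)
    ultimately show "integral\<^sup>L (lebesgue_on {0<..<a}) (\<lambda>s. e s * deriv \<phi> s)
        = - integral\<^sup>L (lebesgue_on {0<..<a}) (\<lambda>s. 0 * \<phi> s)" by simp
  qed
  have const: "e s = e (a / 2)" if "0 < s" "s < a" for s
  proof (cases s "a / 2" rule: linorder_cases)
    case less
    then show ?thesis using du_Bois_Reymond[OF a ce we that(1) less] a by simp
  next
    case greater
    have "0 < a / 2" using a by simp
    from du_Bois_Reymond[OF a ce we this greater that(2)] show ?thesis by simp
  next
    case equal
    show ?thesis by (rule arg_cong[OF equal])
  qed
  have dq: "((\<lambda>s. (m s)\<^sup>2 * U' s) has_real_derivative - ((1 + l) * ((m s)\<^sup>2 * U s))) (at s)" if s: "0 < s" "s < a" for s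
  proof -
    have "((\<lambda>s. P s + e (a / 2)) has_real_derivative r s) (at s)"
      by (rule DERIV_cong[OF DERIV_add[OF dP[OF s] DERIV_const]]) simp
    then have "((\<lambda>s. (m s)\<^sup>2 * U' s) has_real_derivative r s) (at s)"
    proof (rule has_field_derivative_transform_within_open[where S = "{0<..<a}"])
      show "P x + e (a / 2) = (m x)\<^sup>2 * U' x" if "x \<in> {0<..<a}" for x
        using const[of x] that by (auto simp: e_def q_def)
    qed (use s in auto)
    then show ?thesis by (simp add: r_def)
  qed
  have "\<exists>s. 0 < s \<and> s < a \<and> U s \<noteq> 0"
  proof (rule ccontr)
    assume *: "\<not> (\<exists>s. 0 < s \<and> s < a \<and> U s \<noteq> 0)"
    have "AE s in lebesgue_on {0<..<a}. s \<in> {0<..<a}"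
      by (rule AE_I2) (simp add: space_restrict_space)
    then have "AE s in lebesgue_on {0<..<a}. u s = 0" using UU
    proof eventually_elim
      case (elim s) then show ?case using * by auto
    qed
    then show False using nz AE_weighted_iff[OF m, of "\<lambda>s. u s = 0" a] by blast
  qed
  then show ?thesis using that[of U U'] dU cU' bc dq by simp
qed

text \<open>
  Picone's identity. With \<open>q = m\<^sup>2 U'\<close> the function \<open>H = q U - p U\<^sup>2 / u\<close> has derivative
  \<open>m\<^sup>2 ((U' - (u'/u) U)\<^sup>2 + (\<mu> - 1 - l) U\<^sup>2)\<close> and vanishes at both ends: at \<open>0\<close> because \<open>U/u\<close> stays
  bounded there, at \<open>a\<close> because \<open>u\<close> and \<open>U\<close> satisfy the same Robin condition. For \<open>l < \<mu> - 1\<close> this forces \<open>U = 0\<close>.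
\<close>
lemma DR_eigenvalue_lower_bound:
  assumes m: "continuous_on {0..} m" "\<And>s. s \<ge> 0 \<Longrightarrow> m s > 0" and a: "a > 0"
    and f: "robin_flow m \<mu> u p" and u: "\<And>s. 0 < s \<Longrightarrow> s \<le> a \<Longrightarrow> u s > 0"
    and bc: "p a / (m a)\<^sup>2 = u a" and ev: "DR_eigenvalue m a l"
  shows "\<mu> - 1 \<le> l"
proof (rule ccontr)
  assume "\<not> \<mu> - 1 \<le> l"
  then have lt: "\<mu> - (1 + l) > 0" by simp
  obtain U U' where dU: "\<And>s. s \<in> {0..a} \<Longrightarrow> (U has_real_derivative U' s) (at s within {0..a})"
    and cU': "continuous_on {0..a} U'" and U0: "U 0 = 0" and Ua: "U' a = U a"
    and dq: "\<And>s. 0 < s \<Longrightarrow> s < a \<Longrightarrow> ((\<lambda>s. (m s)\<^sup>2 * U' s) has_real_derivative - ((1 + l) * ((m s)\<^sup>2 * U s))) (at s)"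
    and nz: "\<exists>s. 0 < s \<and> s < a \<and> U s \<noteq> 0"
    by (rule DR_eigenfunction_classical[OF m(1) _ a ev]) (rule m(2), assumption, rule that, assumption+)
  note D = robin_flowD[OF f]
  have cU: "continuous_on {0..a} U"
    unfolding continuous_on_eq_continuous_within using DERIV_continuous[OF dU] by blast
  have dU': "(U has_real_derivative U' s) (at s)" if "0 < s" "s < a" for s
    using dU[of s] that at_within_interior[of s "{0..a}"] by simp
  have cm: "continuous_on {0..a} m" by (rule continuous_on_subset[OF m(1)]) auto
  have cu: "continuous_on {0..a} u" and cp: "continuous_on {0..a} p" using D(7,8) by auto
  define H where "H s = ((m s)\<^sup>2 * U' s) * U s - p s * (U s * (U s / u s))" for s
  have ratio: "((\<lambda>s. U s / u s) \<longlongrightarrow> U' 0 / (p 0 / (m 0)\<^sup>2)) (at 0 within {0..a})"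
  proof -
    have l1: "((\<lambda>s. U s / s) \<longlongrightarrow> U' 0) (at 0 within {0..a})"
      using dU[of 0] a U0 by (simp add: has_field_derivative_iff)
    have "(u has_real_derivative p 0 / (m 0)\<^sup>2) (at 0 within {0..a})"
      by (rule DERIV_subset[OF D(1)]) auto
    then have l2: "((\<lambda>s. u s / s) \<longlongrightarrow> p 0 / (m 0)\<^sup>2) (at 0 within {0..a})"
      using D(3) by (simp add: has_field_derivative_iff)
    have "p 0 / (m 0)\<^sup>2 \<noteq> 0" using D(4) m(2)[of 0] by simp
    from tendsto_divide[OF l1 l2 this] show ?thesis
      by (rule Lim_transform_eventually) (auto simp: eventually_at_filter)
  qed
  have cH0: "(H \<longlongrightarrow> H 0) (at 0 within {0..a})"
  proof -
    have "(U \<longlongrightarrow> U 0) (at 0 within {0..a})" using cU a by (simp add: continuous_on_def)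
    then have tU: "(U \<longlongrightarrow> 0) (at 0 within {0..a})" using U0 by simp
    have tUU: "((\<lambda>s. U s * (U s / u s)) \<longlongrightarrow> 0 * (U' 0 / (p 0 / (m 0)\<^sup>2))) (at 0 within {0..a})"
      by (rule tendsto_mult[OF tU ratio])
    have tp: "(p \<longlongrightarrow> p 0) (at 0 within {0..a})" using cp a by (simp add: continuous_on_def)
    have "continuous_on {0..a} (\<lambda>s. (m s)\<^sup>2 * U' s)" by (intro continuous_intros cm cU')
    then have tq: "((\<lambda>s. (m s)\<^sup>2 * U' s) \<longlongrightarrow> (m 0)\<^sup>2 * U' 0) (at 0 within {0..a})"
      using a by (simp add: continuous_on_def)
    have "(H \<longlongrightarrow> ((m 0)\<^sup>2 * U' 0) * 0 - p 0 * (0 * (U' 0 / (p 0 / (m 0)\<^sup>2)))) (at 0 within {0..a})"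
      unfolding H_def by (rule tendsto_diff[OF tendsto_mult[OF tq tU] tendsto_mult[OF tp tUU]])
    then show ?thesis using U0 by (simp add: H_def)
  qed
  have cH: "continuous_on {0..a} H"
    unfolding continuous_on_def
  proof
    fix s assume s: "s \<in> {0..a}"
    show "(H \<longlongrightarrow> H s) (at s within {0..a})"
    proof (cases "s = 0")
      case False
      then have us: "u s > 0" using s u[of s] by simp
      have "(f \<longlongrightarrow> f s) (at s within {0..a})" if "continuous_on {0..a} f" for f :: "real \<Rightarrow> real"
        using that s by (simp add: continuous_on_def)
      note this[OF cm] this[OF cU'] this[OF cU] this[OF cp] this[OF cu]
      then show ?thesis unfolding H_def using us by (intro tendsto_intros) auto
    qed (use cH0 in simp)
  qed
  have dH: "(H has_real_derivative (m s)\<^sup>2 * ((U' s - p s / ((m s)\<^sup>2 * u s) * U s)\<^sup>2 + (\<mu> - (1 + l)) * (U s)\<^sup>2)) (at s)"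
    if s: "0 < s" "s < a" for s
  proof -
    define M where "M = (m s)\<^sup>2"
    have M: "M > 0" using m(2)[of s] s by (simp add: M_def)
    have us: "u s > 0" using u[of s] s by simp
    have dur: "((\<lambda>s. U s / u s) has_real_derivative (U' s * u s - U s * (p s / M)) / (u s * u s)) (at s)"
      using DERIV_divide[OF dU'[OF s] D(5)[OF s(1)]] us by (simp add: M_def)
    have "(H has_real_derivative
        (- ((1 + l) * (M * U s)) * U s + U' s * (M * U' s)) -
        (- (\<mu> * (M * u s)) * (U s * (U s / u s)) +
          (U' s * (U s / u s) + (U' s * u s - U s * (p s / M)) / (u s * u s) * U s) * p s)) (at s)"
      unfolding H_def M_def
      by (intro DERIV_diff DERIV_mult dq[OF s] dU'[OF s] D(6)[OF s(1)] dur[unfolded M_def])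
    moreover have "(- ((1 + l) * (M * U s)) * U s + U' s * (M * U' s)) -
        (- (\<mu> * (M * u s)) * (U s * (U s / u s)) +
          (U' s * (U s / u s) + (U' s * u s - U s * (p s / M)) / (u s * u s) * U s) * p s)
      = M * ((U' s - p s / (M * u s) * U s)\<^sup>2 + (\<mu> - (1 + l)) * (U s)\<^sup>2)"
      using us M by (simp add: field_simps power2_eq_square)
    ultimately show ?thesis by (simp only: M_def)
  qed
  have dH0: "(m s)\<^sup>2 * ((U' s - p s / ((m s)\<^sup>2 * u s) * U s)\<^sup>2 + (\<mu> - (1 + l)) * (U s)\<^sup>2) \<ge> 0" for s
    using lt by simp
  have mono: "H s \<le> H t" if "0 \<le> s" "s \<le> t" "t \<le> a" for s t
  proof (rule DERIV_nonneg_imp_increasing_open[where f = H and a = s and b = t])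
    show "\<exists>y. (H has_real_derivative y) (at x) \<and> 0 \<le> y" if "s < x" "x < t" for x
      using dH[of x] dH0[of x] that \<open>0 \<le> s\<close> \<open>t \<le> a\<close> by auto
    show "continuous_on {s..t} H" by (rule continuous_on_subset[OF cH]) (use that in auto)
  qed (use that in auto)
  have "H 0 = 0" by (simp add: H_def U0)
  moreover have "H a = 0"
  proof -
    have ma: "(m a)\<^sup>2 > 0" using m(2)[of a] a by simp
    then have "p a = (m a)\<^sup>2 * u a" using bc by (simp add: field_simps)
    then show ?thesis using u[of a] a Ua by (simp add: H_def)
  qed
  ultimately have Hz: "H s = 0" if "0 \<le> s" "s \<le> a" for s
    using mono[of 0 s] mono[of s a] that a by force
  obtain s where s: "0 < s" "s < a" "U s \<noteq> 0" using nz by blast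
  have "((\<lambda>_. 0) has_real_derivative (m s)\<^sup>2 * ((U' s - p s / ((m s)\<^sup>2 * u s) * U s)\<^sup>2 + (\<mu> - (1 + l)) * (U s)\<^sup>2)) (at s)"
    by (rule has_field_derivative_transform_within_open[OF dH[OF s(1,2)], of "{0<..<a}"]) (use s Hz in auto)
  then have "(m s)\<^sup>2 * ((U' s - p s / ((m s)\<^sup>2 * u s) * U s)\<^sup>2 + (\<mu> - (1 + l)) * (U s)\<^sup>2) = 0"
    by (rule DERIV_unique[OF _ DERIV_const])
  moreover have "(m s)\<^sup>2 * ((U' s - p s / ((m s)\<^sup>2 * u s) * U s)\<^sup>2 + (\<mu> - (1 + l)) * (U s)\<^sup>2) > 0"
    using lt s m(2)[of s] by (intro mult_pos_pos add_nonneg_pos) auto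
  ultimately show False by (simp only: less_irrefl)
qed

lemma integrable_open_of_continuous:
  fixes f :: "real \<Rightarrow> real"
  assumes "continuous_on {0..a} f"
  shows "integrable (lebesgue_on {0<..<a}) f"
proof -
  have "integrable (lebesgue_on {0..a}) f" by (rule continuous_imp_integrable_real[OF assms])
  then have 1: "set_integrable lebesgue {0..a} f"
    by (simp add: set_integrable_def integrable_restrict_space)
  have "{0<..<a} \<subseteq> {0..a}" by auto
  from set_integrable_subset[OF 1 _ this] show ?thesis
    by (simp add: set_integrable_def integrable_restrict_space)
qed

lemma L2_of_continuous:
  assumes "continuous_on {0..a} f"
  shows "L2 (lebesgue_on {0<..<a}) f"
  unfolding L2_def
  using borel_measurable_integrable[OF integrable_open_of_continuous[OF assms]]
    integrable_open_of_continuous[OF continuous_on_power[OF assms, of 2]] by blast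

lemma L2_weighted_of_continuous:
  assumes m: "continuous_on {0..a} m" and f: "continuous_on {0..a} f"
  shows "L2 (weighted m a) f"
proof -
  let ?M = "lebesgue_on {0<..<a}"
  have mf: "f \<in> borel_measurable ?M" "(\<lambda>s. (f s)\<^sup>2) \<in> borel_measurable ?M"
    and mm: "(\<lambda>s. (m s)\<^sup>2) \<in> borel_measurable ?M"
    by (rule borel_measurable_integrable[OF integrable_open_of_continuous],
        intro continuous_on_power m f)+
  have i: "integrable ?M (\<lambda>s. (m s)\<^sup>2 * (f s)\<^sup>2)"
    by (rule integrable_open_of_continuous) (intro continuous_on_mult continuous_on_power m f)
  have "integrable (weighted m a) (\<lambda>s. (f s)\<^sup>2)"
    unfolding weighted_def by (subst integrable_density[OF mf(2) mm]) (simp_all add: i)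
  moreover have "f \<in> borel_measurable (weighted m a)"
    using mf(1) unfolding weighted_def by simp
  ultimately show ?thesis by (simp add: L2_def)
qed

text \<open>
  Here \<open>m\<close> has to be \<open>C\<^sup>1\<close>: otherwise \<open>u' = p / m\<^sup>2\<close> need not have a weak derivative in \<open>L\<^sup>2\<close>.
\<close>
lemma DR_eigenvalue_of_robin_flow:
  assumes m: "continuous_on {0..} m" "\<And>s. s \<ge> 0 \<Longrightarrow> m s > 0"
    and m': "continuous_on {0..} m'" "\<And>s. s \<ge> 0 \<Longrightarrow> (m has_real_derivative m' s) (at s within {0..})"
    and a: "a > 0" and f: "robin_flow m \<mu> u p" and u: "\<And>s. 0 < s \<Longrightarrow> s \<le> a \<Longrightarrow> u s > 0"
    and bc: "p a / (m a)\<^sup>2 = u a"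
  shows "DR_eigenvalue m a (\<mu> - 1)"
proof -
  note D = robin_flowD[OF f]
  have cm: "continuous_on {0..a} m" "continuous_on {0..a} m'"
    by (rule continuous_on_subset[OF m(1)], auto, rule continuous_on_subset[OF m'(1)], auto)
  have cu: "continuous_on {0..a} u" and cp: "continuous_on {0..a} p" using D(7,8) by auto
  have mne: "m s \<noteq> 0" if "s \<in> {0..a}" for s using m(2)[of s] that by auto
  define v where "v s = p s / (m s)\<^sup>2" for s
  define w where "w s = - (\<mu> * ((m s)\<^sup>2 * u s))" for s
  define u2 where "u2 s = (w s * (m s)\<^sup>2 - p s * (2 * m s * m' s)) / ((m s)\<^sup>2 * (m s)\<^sup>2)" for s
  have cv: "continuous_on {0..a} v" unfolding v_def
    by (intro continuous_on_divide cp continuous_on_power cm) (use mne in auto)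
  have cw: "continuous_on {0..a} w" unfolding w_def by (intro continuous_intros cm cu)
  have cu2: "continuous_on {0..a} u2" unfolding u2_def
    by (intro continuous_on_divide continuous_intros cw cp cm) (use mne in auto)
  have dm: "(m has_real_derivative m' s) (at s)" if "s > 0" for s
    using m'(2)[of s] that at_within_interior[of s "{0..}"] by simp
  have du: "(u has_real_derivative v s) (at s)" if "0 < s" "s < a" for s
    using D(5)[OF that(1)] by (simp add: v_def)
  have dv: "(v has_real_derivative u2 s) (at s)" if "0 < s" "s < a" for s
  proof -
    have ms: "(m s)\<^sup>2 \<noteq> 0" using mne[of s] that by simp
    have dm2: "((\<lambda>s. (m s)\<^sup>2) has_real_derivative 2 * m s * m' s) (at s)"
      by (rule DERIV_cong[OF DERIV_power[OF dm[OF that(1)], of 2]]) simp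
    show ?thesis unfolding v_def u2_def w_def
      by (rule DERIV_divide[OF D(6)[OF that(1)] dm2 ms])
  qed
  have w1: "weak_deriv {0<..<a} u v" by (rule weak_deriv_of_C1[OF a cu cv du])
  have w2: "weak_deriv {0<..<a} v u2" by (rule weak_deriv_of_C1[OF a cv cu2 dv])
  have w3: "weak_deriv {0<..<a} (\<lambda>s. (m s)\<^sup>2 * v s) w"
  proof (rule weak_deriv_of_C1[OF a _ cw])
    show "continuous_on {0..a} (\<lambda>s. (m s)\<^sup>2 * v s)" by (intro continuous_intros cm cv)
    fix s assume s: "0 < s" "s < a"
    have "(p has_real_derivative w s) (at s)" using D(6)[OF s(1)] by (simp add: w_def)
    then show "((\<lambda>s. (m s)\<^sup>2 * v s) has_real_derivative w s) (at s)"
      by (rule has_field_derivative_transform_within_open[where S = "{0<..<a}"])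
         (use s mne in \<open>auto simp: v_def\<close>)
  qed
  have dom: "u \<in> DR_domain a"
    unfolding DR_domain_def
  proof (intro CollectI conjI exI)
    show "H2 {0<..<a} u"
      unfolding H2_def
      by (intro exI conjI) (rule w1, rule w2, (rule L2_of_continuous, rule cu cv cu2)+)
    show "AE s in lebesgue_on {0<..<a}. u s = u s" by simp
    show "\<forall>s\<in>{0..a}. (u has_real_derivative v s) (at s within {0..a})"
    proof
      fix s assume "s \<in> {0..a}"
      then show "(u has_real_derivative v s) (at s within {0..a})"
        unfolding v_def by (intro DERIV_subset[OF D(1)]) auto
    qed
    show "continuous_on {0..a} v" by (rule cv)
    show "u 0 = 0" by (rule D(3))
    show "v a = u a" using bc by (simp add: v_def)
  qed
  have sp: "AE s in lebesgue_on {0<..<a}. s \<in> {0<..<a}"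
    by (rule AE_I2) (simp add: space_restrict_space)
  have "K_DR m a u (\<lambda>s. (\<mu> - 1) * u s)"
    unfolding K_DR_def
  proof (intro conjI exI)
    show "L2 (weighted m a) u" by (rule L2_weighted_of_continuous[OF cm(1) cu])
    show "L2 (weighted m a) (\<lambda>s. (\<mu> - 1) * u s)"
      by (rule L2_weighted_of_continuous[OF cm(1)]) (intro continuous_intros cu)
    have "AE s in lebesgue_on {0<..<a}. (\<mu> - 1) * u s = - (1 / (m s)\<^sup>2) * w s - u s"
      using sp
    proof eventually_elim
      case (elim s)
      then have "m s \<noteq> 0" using mne[of s] by auto
      then show ?case by (simp add: w_def algebra_simps)
    qed
    then show "AE s in weighted m a. (\<mu> - 1) * u s = - (1 / (m s)\<^sup>2) * w s - u s"
      using AE_weighted_iff[OF m, of "\<lambda>s. (\<mu> - 1) * u s = - (1 / (m s)\<^sup>2) * w s - u s" a] by blast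
  qed (rule dom w1 w3)+
  moreover have "\<not> (AE s in weighted m a. u s = 0)"
  proof
    assume "AE s in weighted m a. u s = 0"
    then have "AE s in lebesgue_on {0<..<a}. u s = 0"
      using AE_weighted_iff[OF m, of "\<lambda>s. u s = 0" a] by blast
    from this sp have "AE s in lebesgue_on {0<..<a}. False"
    proof eventually_elim
      case (elim s)
      then show ?case using u[of s] by auto
    qed
    then have "emeasure (lebesgue_on {0<..<a}) (space (lebesgue_on {0<..<a})) = 0"
      by (simp only: eventually_False ae_filter_eq_bot_iff)
    then show False using a by (simp add: emeasure_restrict_space space_restrict_space)
  qed
  ultimately show ?thesis unfolding DR_eigenvalue_def by blast
qed

lemma lambda_DR_eq:
  assumes m: "continuous_on {0..} m" "\<And>s. s \<ge> 0 \<Longrightarrow> m s > 0"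
    and m': "continuous_on {0..} m'" "\<And>s. s \<ge> 0 \<Longrightarrow> (m has_real_derivative m' s) (at s within {0..})"
    and a: "a > 0" and f: "robin_flow m \<mu> u p" and u: "\<And>s. 0 < s \<Longrightarrow> s \<le> a \<Longrightarrow> u s > 0"
    and bc: "p a / (m a)\<^sup>2 = u a"
  shows "lambda_DR a m = \<mu> - 1"
  unfolding lambda_DR_def
proof (rule Least_equality)
  show "DR_eigenvalue m a (\<mu> - 1)"
    by (rule DR_eigenvalue_of_robin_flow[OF m(1) _ m'(1) _ a f _ bc]) (fact m(2) m'(2) u)+
  show "\<mu> - 1 \<le> l" if "DR_eigenvalue m a l" for l
    by (rule DR_eigenvalue_lower_bound[OF m(1) _ a f _ bc that]) (fact m(2) u)+
qed

text \<open>
  \<open>e^(-s) u(s)\<close> is increasing where \<open>u' > u\<close>.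
\<close>
lemma robin_flow_growth_pos:
  assumes m: "\<And>s. s \<ge> 0 \<Longrightarrow> m s > 0" and f: "robin_flow m \<mu> u p"
    and gt: "\<And>s. 0 < s \<Longrightarrow> s < b \<Longrightarrow> u s < p s / (m s)\<^sup>2" and s: "0 < s" "s \<le> b"
  shows "u s > 0"
proof -
  note D = robin_flowD[OF f]
  have "exp (- 0) * u 0 < exp (- s) * u s"
  proof (rule DERIV_pos_imp_increasing_open[OF s(1)])
    fix x assume x: "0 < x" "x < s"
    have "((\<lambda>x. exp (- x) * u x) has_real_derivative exp (- x) * (p x / (m x)\<^sup>2 - u x)) (at x)"
      using D(5)[OF x(1)] by (auto intro!: derivative_eq_intros simp: algebra_simps)
    moreover have "exp (- x) * (p x / (m x)\<^sup>2 - u x) > 0" using gt[of x] x s by simp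
    ultimately show "\<exists>y. ((\<lambda>x. exp (- x) * u x) has_real_derivative y) (at x) \<and> 0 < y" by blast
  next
    show "continuous_on {0..s} (\<lambda>x. exp (- x) * u x)"
      by (intro continuous_intros D(7)) auto
  qed
  then show ?thesis using D(3) by (simp add: zero_less_mult_iff)
qed

lemma lambda_DR_pos:
  assumes m: "continuous_on {0..} m" "\<And>s. s \<ge> 0 \<Longrightarrow> m s > 0"
    and m': "continuous_on {0..} m'" "\<And>s. s \<ge> 0 \<Longrightarrow> (m has_real_derivative m' s) (at s within {0..})"
    and a: "a > 0" and f: "robin_flow m 1 u p" and gt: "\<And>s. 0 < s \<Longrightarrow> s \<le> a \<Longrightarrow> u s < p s / (m s)\<^sup>2"
  shows "lambda_DR a m > 0"
proof -
  have pos: "u s > 0" if "0 < s" "s \<le> a" for s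
    by (rule robin_flow_growth_pos[OF _ f _ that]) (use m(2) gt in auto)
  obtain \<mu> v q where *: "\<mu> > 1" "robin_flow m \<mu> v q"
    "\<And>s. 0 < s \<Longrightarrow> s \<le> a \<Longrightarrow> v s > 0" "q a / (m a)\<^sup>2 = v a"
  proof (rule robin_shooting[OF m(1) _ a f])
    show "m s > 0" if "s \<ge> 0" for s using m(2) that .
    show "0 < u s \<and> u s < p s / (m s)\<^sup>2" if "0 < s" "s \<le> a" for s using pos gt that by blast
  qed (rule that, assumption+)
  have "lambda_DR a m = \<mu> - 1"
    by (rule lambda_DR_eq[OF m(1) _ m'(1) _ a *(2) _ *(4)]) (fact m(2) m'(2) *(3))+
  then show ?thesis using *(1) by simp
qed

section \<open>The critical length and the semigroup estimate\<close>

text \<open>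
  If \<open>u' > u\<close> fails somewhere, then at the first point \<open>a\<close> of failure \<open>u\<close> satisfies the Robin condition and is
  positive, so it is a ground state with eigenvalue \<open>0\<close> on \<open>(0,a)\<close>.
\<close>

lemma lambda_DR_pos_iff:
  assumes m: "continuous_on {0..} m" "\<And>s. s \<ge> 0 \<Longrightarrow> m s > 0"
    and m': "continuous_on {0..} m'" "\<And>s. s \<ge> 0 \<Longrightarrow> (m has_real_derivative m' s) (at s within {0..})"
    and f: "robin_flow m 1 u p"
  shows "(\<forall>a. 0 < a \<and> a < b \<longrightarrow> lambda_DR a m > 0) \<longleftrightarrow> (\<forall>a. 0 < a \<and> a < b \<longrightarrow> u a < p a / (m a)\<^sup>2)"
proof
  assume R: "\<forall>a. 0 < a \<and> a < b \<longrightarrow> u a < p a / (m a)\<^sup>2"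
  show "\<forall>a. 0 < a \<and> a < b \<longrightarrow> lambda_DR a m > 0"
  proof (intro allI impI)
    fix a assume a: "0 < a \<and> a < b"
    show "lambda_DR a m > 0"
      by (rule lambda_DR_pos[OF m(1) _ m'(1) _ _ f]) (use m(2) m'(2) a R in auto)
  qed
next
  assume L: "\<forall>a. 0 < a \<and> a < b \<longrightarrow> lambda_DR a m > 0"
  note D = robin_flowD[OF f]
  define g where "g s = p s / (m s)\<^sup>2 - u s" for s
  have cg: "continuous_on {0..} g" unfolding g_def
    by (intro continuous_intros D(7,8) m(1)) (use m(2) in force)+
  have g0: "g 0 > 0" using D(3,4) m(2)[of 0] by (simp add: g_def)
  show "\<forall>a. 0 < a \<and> a < b \<longrightarrow> u a < p a / (m a)\<^sup>2"
  proof (rule ccontr)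
    assume "\<not> ?thesis"
    then obtain a0 where a0: "0 < a0" "a0 < b" "g a0 \<le> 0" by (auto simp: g_def not_less)
    let ?Z = "{0..a0} \<inter> g -` {..0}"
    have "closed ?Z"
      by (rule continuous_closed_preimage[OF continuous_on_subset[OF cg]]) auto
    then have "compact ?Z" by (meson bounded_closed_interval bounded_Int compact_eq_bounded_closed)
    moreover have "a0 \<in> ?Z" using a0 by simp
    then have "?Z \<noteq> {}" by blast
    ultimately obtain a where a: "a \<in> ?Z" "\<And>s. s \<in> ?Z \<Longrightarrow> a \<le> s"
      using compact_attains_inf by metis
    have apos: "a > 0" using a(1) g0 by (cases "a = 0") auto
    have before: "g s > 0" if "0 \<le> s" "s < a" for s
      using a(2)[of s] a(1) that by force
    have "g a \<ge> 0"
    proof (rule ccontr)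
      assume "\<not> 0 \<le> g a"
      then obtain s where "0 \<le> s" "s \<le> a" "g s = 0"
        using IVT2'[of g a 0 0] g0 apos continuous_on_subset[OF cg, of "{0..a}"] by auto
      then show False using before[of s] \<open>\<not> 0 \<le> g a\<close> by (cases "s = a") auto
    qed
    then have ga: "g a = 0" using a(1) by auto
    have pos: "u s > 0" if "0 < s" "s \<le> a" for s
      by (rule robin_flow_growth_pos[OF _ f _ that]) (use m(2) before in \<open>auto simp: g_def\<close>)
    have bc: "p a / (m a)\<^sup>2 = u a" using ga by (simp add: g_def)
    have "lambda_DR a m = 1 - 1"
      by (rule lambda_DR_eq[OF m(1) _ m'(1) _ apos f _ bc]) (fact m(2) m'(2) pos)+
    moreover have "lambda_DR a m > 0" using L a(1) a0 apos by auto
    ultimately show False by simp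
  qed
qed

lemma is_u0_of_robin_flow:
  assumes m: "\<And>s. s \<ge> 0 \<Longrightarrow> m s > 0" and f: "robin_flow m 1 u p"
  shows "is_u0 m u"
proof -
  note D = robin_flowD[OF f]
  have eq: "(m s)\<^sup>2 * (p s / (m s)\<^sup>2) = p s" if "s \<ge> 0" for s using m[OF that] by simp
  have "((\<lambda>r. (m r)\<^sup>2 * (p r / (m r)\<^sup>2)) has_real_derivative - ((m s)\<^sup>2 * u s)) (at s within {0..})"
    if s: "s \<ge> 0" for s
    by (rule has_real_derivative_transform[where f = p]) (use s eq D(2)[OF s] in auto)
  moreover have "p 0 / (m 0)\<^sup>2 > 0" using D(4) m[of 0] by simp
  ultimately show ?thesis
    unfolding is_u0_def by (intro exI[of _ "\<lambda>s. p s / (m s)\<^sup>2"] conjI allI impI D(1) D(3)) auto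
qed

lemma u0_flow:
  assumes cm: "continuous_on {0..} m" and m: "\<And>s. s \<ge> 0 \<Longrightarrow> m s > 0"
  obtains u' where
    "\<And>s. s \<ge> 0 \<Longrightarrow> (u0 m has_real_derivative u' s) (at s within {0..})"
    "\<And>s. s \<ge> 0 \<Longrightarrow> ((\<lambda>r. (m r)\<^sup>2 * u' r) has_real_derivative - ((m s)\<^sup>2 * u0 m s)) (at s within {0..})"
    "u0 m 0 = 0" "robin_flow m 1 (u0 m) (\<lambda>s. (m s)\<^sup>2 * u' s)"
    "\<And>s. s > 0 \<Longrightarrow> psi0 m s = u' s / u0 m s"
proof -
  have "is_u0 m (robin_series m 1 1)"
    by (rule is_u0_of_robin_flow[OF _ robin_flow_robin_series[OF cm]]) (fact m)+
  then have "is_u0 m (u0 m)" unfolding u0_def by (rule someI[of "is_u0 m"])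
  then obtain u' where
    1: "\<And>s. s \<ge> 0 \<Longrightarrow> (u0 m has_real_derivative u' s) (at s within {0..})"
    and 2: "\<And>s. s \<ge> 0 \<Longrightarrow> ((\<lambda>r. (m r)\<^sup>2 * u' r) has_real_derivative - ((m s)\<^sup>2 * u0 m s)) (at s within {0..})"
    and 3: "u0 m 0 = 0" "u' 0 > 0"
    unfolding is_u0_def by blast
  have 4: "robin_flow m 1 (u0 m) (\<lambda>s. (m s)\<^sup>2 * u' s)"
    unfolding robin_flow_def
  proof (intro conjI allI impI)
    fix s :: real assume s: "s \<ge> 0"
    have "(m s)\<^sup>2 * u' s / (m s)\<^sup>2 = u' s" using m[OF s] by simp
    then show "(u0 m has_real_derivative (m s)\<^sup>2 * u' s / (m s)\<^sup>2) (at s within {0..})"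
      using 1[OF s] by simp
    show "((\<lambda>s. (m s)\<^sup>2 * u' s) has_real_derivative - (1 * ((m s)\<^sup>2 * u0 m s))) (at s within {0..})"
      using 2[OF s] by simp
  qed (use 3 m[of 0] in auto)
  have 5: "psi0 m s = u' s / u0 m s" if "s > 0" for s
  proof -
    have "(u0 m has_real_derivative u' s) (at s)"
      using 1[of s] that at_within_interior[of s "{0..}"] by simp
    then show ?thesis by (simp add: psi0_def DERIV_imp_deriv)
  qed
  show ?thesis by (rule that[of u']) (fact 1 2 3(1) 4 5)+
qed

theorem theorem1p9:
  fixes S :: "real \<Rightarrow> 'h::complex_hilbert_space \<Rightarrow>\<^sub>L 'h"
    and A :: "('h \<times> 'h) set"
    and m :: "real \<Rightarrow> real"
  assumes "C0_semigroup S"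
    and "A = generator S"
    and "{z. Re z \<ge> 0} \<subseteq> resolvent_set A"
    and "\<exists>C. \<forall>z. Re z \<ge> 0 \<longrightarrow> norm (resolvent A z) \<le> C"
    and "(SUP z\<in>{z. Re z > 0}. norm (resolvent A z)) = 1"
    and "\<forall>t\<ge>0. m t > 0"
    and "C1_half_line m"
    and "\<forall>t\<ge>0. norm (S t) \<le> m t"
  shows "(\<forall>a b t. 0 < a \<and> ereal a \<le> a_star m \<and> 0 < b \<and> ereal b \<le> a_star m \<and> t > a + b \<longrightarrow>
            norm (exp t *\<^sub>R S t) \<le> exp (a + b) * m a * m b * sqrt (psi0 m a) * sqrt (psi0 m b))
       \<and> (a_star m < \<infinity> \<longrightarrow>
            (\<forall>t > 2 * real_of_ereal (a_star m).
               norm (exp t *\<^sub>R S t)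
                 \<le> exp (2 * real_of_ereal (a_star m)) * (m (real_of_ereal (a_star m)))\<^sup>2))"
proof -
  have pos: "m s > 0" if "s \<ge> 0" for s using assms(6) that by blast
  have bound: "norm (S s) \<le> m s" if "s \<ge> 0" for s using assms(8) that by blast
  obtain m' where cm': "continuous_on {0..} m'"
    and dm: "\<And>s. s \<ge> 0 \<Longrightarrow> (m has_real_derivative m' s) (at s within {0..})"
    using assms(7) unfolding C1_half_line_def by blast
  have cm: "continuous_on {0..} m"
    unfolding continuous_on_eq_continuous_within using DERIV_continuous[OF dm] by simp
  have R: "\<exists>R. is_resolvent (generator S) z R \<and> norm R \<le> 1" if z: "Re z > 0" for z
  proof -
    have "z \<in> resolvent_set A" using assms(3) z by auto
    then obtain R where R: "is_resolvent A z R" unfolding resolvent_set_def by blast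
    then have eq: "resolvent A z = R"
      unfolding resolvent_def by (rule the_equality) (rule is_resolvent_unique[OF _ R])
    obtain C where "\<And>z. Re z \<ge> 0 \<Longrightarrow> norm (resolvent A z) \<le> C" using assms(4) by blast
    then have "bdd_above ((\<lambda>z. norm (resolvent A z)) ` {z. Re z > 0})"
      by (intro bdd_aboveI2[of _ _ C]) simp
    then have "norm (resolvent A z) \<le> (SUP z\<in>{z. Re z > 0}. norm (resolvent A z))"
      by (rule cSUP_upper[rotated]) (use z in simp)
    then show ?thesis using R eq assms(2,5) by auto
  qed
  obtain u' where du: "\<And>s. s \<ge> 0 \<Longrightarrow> (u0 m has_real_derivative u' s) (at s within {0..})"
    and dp: "\<And>s. s \<ge> 0 \<Longrightarrow> ((\<lambda>r. (m r)\<^sup>2 * u' r) has_real_derivative - ((m s)\<^sup>2 * u0 m s)) (at s within {0..})"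
    and u00: "u0 m 0 = 0" and fl: "robin_flow m 1 (u0 m) (\<lambda>s. (m s)\<^sup>2 * u' s)"
    and psi: "\<And>s. s > 0 \<Longrightarrow> psi0 m s = u' s / u0 m s"
    by (rule u0_flow[OF cm]) (rule pos, assumption, rule that, assumption+)
  define g where "g s = u' s - u0 m s" for s
  have quot: "(m s)\<^sup>2 * u' s / (m s)\<^sup>2 = u' s" if "s \<ge> 0" for s using pos[OF that] by simp
  have cg: "continuous_on {0..} g"
  proof -
    have "continuous_on {0..} (\<lambda>s. (m s)\<^sup>2 * u' s / (m s)\<^sup>2)"
      by (intro continuous_on_divide robin_flowD(8)[OF fl] continuous_on_power cm)
         (use pos in force)+
    then have "continuous_on {0..} u'" by (rule continuous_on_eq) (simp add: quot)
    then show ?thesis unfolding g_def by (intro continuous_intros robin_flowD(7)[OF fl]) auto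
  qed
  define Z where "Z = {ereal b | b. 0 < b \<and> (\<forall>a. 0 < a \<and> a < b \<longrightarrow> g a > 0)}"
  have astar: "a_star m = Sup Z"
  proof -
    have "(\<forall>a. 0 < a \<and> a < b \<longrightarrow> lambda_DR a m > 0) \<longleftrightarrow> (\<forall>a. 0 < a \<and> a < b \<longrightarrow> g a > 0)" for b
    proof -
      have "(\<forall>a. 0 < a \<and> a < b \<longrightarrow> lambda_DR a m > 0) \<longleftrightarrow>
          (\<forall>a. 0 < a \<and> a < b \<longrightarrow> u0 m a < (m a)\<^sup>2 * u' a / (m a)\<^sup>2)"
        by (rule lambda_DR_pos_iff[OF cm _ cm' _ fl]) (fact pos dm)+
      also have "\<dots> \<longleftrightarrow> (\<forall>a. 0 < a \<and> a < b \<longrightarrow> g a > 0)"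
        using quot by (auto simp: g_def)
      finally show ?thesis .
    qed
    then show ?thesis unfolding a_star_def Z_def by simp
  qed
  have gpos: "g s > 0" if s: "0 < s" "ereal s < a_star m" for s
  proof -
    obtain z where "z \<in> Z" "ereal s < z" using s(2) unfolding astar less_Sup_iff by blast
    then show ?thesis using s(1) by (auto simp: Z_def)
  qed
  have below: "0 < u0 m s \<and> u0 m s \<le> u' s" if a: "0 < a" "ereal a \<le> a_star m" and s: "0 < s" "s \<le> a" for a s
  proof -
    have ga: "g r > 0" if "0 < r" "r < a" for r
      using gpos[of r] that a(2) by (meson ereal_less(2) less_ereal.simps(1) less_le_trans)
    have "u0 m s > 0"
    proof (rule robin_flow_growth_pos[OF _ fl _ s])
      show "m s > 0" if "s \<ge> 0" for s using pos that .
      show "u0 m r < (m r)\<^sup>2 * u' r / (m r)\<^sup>2" if "0 < r" "r < a" for r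
        using ga[OF that] quot[of r] that by (simp add: g_def)
    qed
    moreover have "g s \<ge> 0"
    proof (rule continuous_ge_on_closure[of "{0<..<a}" g s 0])
      show "continuous_on (closure {0<..<a}) g"
        using a(1) by (intro continuous_on_subset[OF cg]) auto
    qed (use a s ga in \<open>auto intro: less_imp_le\<close>)
    ultimately show ?thesis by (simp add: g_def)
  qed
  have main: "norm (exp t *\<^sub>R S t) \<le> exp (a + b) * m a * m b * sqrt (psi0 m a) * sqrt (psi0 m b)"
    if a: "0 < a" "ereal a \<le> a_star m" and b: "0 < b" "ereal b \<le> a_star m" and t: "t > a + b" for a b t
    unfolding psi[OF a(1)] psi[OF b(1)]
    by (rule semigroup_bound_of_robin_solution[where S = S and m = m and u = "u0 m" and u' = u',
          OF assms(1) R cm pos bound du dp u00 a(1) below[OF a] b(1) below[OF b] t])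
  have second: "norm (exp t *\<^sub>R S t) \<le> exp (2 * real_of_ereal (a_star m)) * (m (real_of_ereal (a_star m)))\<^sup>2"
    if fin: "a_star m < \<infinity>" and t: "t > 2 * real_of_ereal (a_star m)" for t
  proof -
    \<comment> \<open>The strict inequality is open; it makes \<open>a\<^sup>*\<close> positive and forces equality at \<open>a\<^sup>*\<close>.\<close>
    have extend: "\<exists>d>0. \<forall>s. x \<le> s \<and> s < x + d \<longrightarrow> g s > 0" if x: "x \<ge> 0" "g x > 0" for x
    proof -
      have "\<forall>\<^sub>F s in at x within {0..}. g s > 0"
        using cg x by (intro order_tendstoD(1)[of g "g x"]) (auto simp: continuous_on_def)
      then obtain d where "d > 0" "\<And>s. s \<ge> 0 \<Longrightarrow> s \<noteq> x \<Longrightarrow> dist s x < d \<Longrightarrow> g s > 0"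
        unfolding eventually_at by auto
      then show ?thesis using x by (intro exI[of _ d]) (metis abs_of_nonneg add.commute diff_ge_0_iff_ge diff_less_eq dist_real_def order_trans)
    qed
    have "g 0 > 0" using robin_flowD(4)[OF fl] pos[of 0] u00 by (simp add: g_def zero_less_mult_iff)
    then obtain d where d: "d > 0" "\<forall>s. 0 \<le> s \<and> s < 0 + d \<longrightarrow> g s > 0" using extend[of 0] by auto
    then have "ereal d \<in> Z" by (auto simp: Z_def)
    then have "ereal d \<le> a_star m" unfolding astar by (rule Sup_upper)
    then obtain \<alpha> where \<alpha>: "a_star m = ereal \<alpha>" "\<alpha> > 0"
      using fin d(1) by (cases "a_star m") auto
    have ba: "0 < u0 m \<alpha> \<and> u0 m \<alpha> \<le> u' \<alpha>" using below[of \<alpha> \<alpha>] \<alpha> by simp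
    have "u' \<alpha> = u0 m \<alpha>"
    proof (rule ccontr)
      assume "u' \<alpha> \<noteq> u0 m \<alpha>"
      then have "g \<alpha> > 0" using ba by (simp add: g_def)
      then obtain d where d: "d > 0" "\<forall>s. \<alpha> \<le> s \<and> s < \<alpha> + d \<longrightarrow> g s > 0"
        using extend[of \<alpha>] \<alpha>(2) by auto
      have "g s > 0" if "0 < s" "s < \<alpha> + d" for s
        using gpos[of s] d(2) that \<alpha>(1) by (cases "s < \<alpha>") auto
      then have "ereal (\<alpha> + d) \<in> Z" using \<alpha>(2) d(1) by (auto simp: Z_def)
      then have "ereal (\<alpha> + d) \<le> a_star m" unfolding astar by (rule Sup_upper)
      then show False using \<alpha>(1) d(1) by simp
    qed
    then have psi1: "psi0 m \<alpha> = 1" using psi[OF \<alpha>(2)] ba by simp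
    have "norm (exp t *\<^sub>R S t) \<le> exp (\<alpha> + \<alpha>) * m \<alpha> * m \<alpha> * sqrt (psi0 m \<alpha>) * sqrt (psi0 m \<alpha>)"
      using t \<alpha> by (intro main) auto
    then show ?thesis by (simp add: psi1 \<alpha>(1) power2_eq_square mult.assoc)
  qed
  show ?thesis using main second by blast
qed

end
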